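(* Let $\tau$ be a W-topology on a field $K$, and let $\tau_1,\ldots,\tau_n$ be the local components of $\tau$. Then each $\tau_i$ has a unique V-topological coarsening, and the map sending $\tau_i$ to its unique V-topological coarsening is a bijection from $\{\tau_1,\ldots,\tau_n\}$ onto the set of V-topological coarsenings of $\tau$.
   Context: Let $K$ be a field. A topology on $K$ here always means a Hausdorff, non-discrete, locally bounded ring topology on $K$ (a set $B\subseteq K$ is bounded if for every neighborhood $U$ of $0$ there is a neighborhood $V$ of $0$ with $V\cdot B\subseteq U$; locally bounded means some neighborhood of $0$ is bounded). A topology $\sigma$ is a coarsening of $\tau$ if every $\sigma$-open set is $\tau$-open. A V-topology is a field topology induced by a non-trivial valuation or absolute value. A subset $S\subseteq K$ is a $W_n$-set if for all $x_0,\ldots,x_n\in K$ there is $i$ with $x_i\in\sum_{j\neq i}S\cdot x_j=\{\sum_{j\ne i}s_jx_j : s_j\in S\}$. A topology $\tau$ is a $W_n$-topology if some $\tau$-bounded set is a $W_n$-set; its weight is the least such $n$; a W-topology is a topology of finite weight. Let $K^*$ be a monster model (sufficiently saturated and homogeneous elementary extension) of the theory of $K$ expanded by a unary predicate for every subset of $K$; for $U\subseteq K$, $U^*$ is the interpretation in $K^*$ of the predicate for $U$. For a topology $\tau$ let $R_\tau=\bigcup\{B^* : B\subseteq K\ \tau\text{-bounded}\}$, a subring of $K^*$ with fraction field $K^*$. If $\tau$ is a W-topology, $R_\tau$ has finitely many maximal ideals, and each localization of $R_\tau$ at a maximal ideal equals $R_\sigma$ for a unique W-topology $\sigma$ on $K$;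 the local components of $\tau$ are the W-topologies $\tau_1,\ldots,\tau_n$ such that $R_{\tau_1},\ldots,R_{\tau_n}$ are exactly the localizations of $R_\tau$ at its maximal ideals. *)

theory Defs
  imports "HOL-Analysis.Analysis" "HOL-Algebra.Ideal"
begin

section \<open>Ring topologies on a field\<close>

text \<open>The field \<open>K\<close> is the type \<open>'a\<close>; topologies on it are values of type \<open>'a topology\<close>, so that
  several of them can be considered at once.\<close>

definition nbhd_zero :: "'a::zero topology \<Rightarrow> 'a set \<Rightarrow> bool" where
  "nbhd_zero \<tau> U \<longleftrightarrow> (\<exists>W. openin \<tau> W \<and> 0 \<in> W \<and> W \<subseteq> U)"

definition top_bounded :: "'a::field topology \<Rightarrow> 'a set \<Rightarrow> bool" where
  "top_bounded \<tau> B \<longleftrightarrow>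
     (\<forall>U. nbhd_zero \<tau> U \<longrightarrow> (\<exists>V. nbhd_zero \<tau> V \<and> (\<forall>v\<in>V. \<forall>b\<in>B. v * b \<in> U)))"

definition ring_topology :: "'a::field topology \<Rightarrow> bool" where
  "ring_topology \<tau> \<longleftrightarrow>
     topspace \<tau> = UNIV \<and>
     continuous_map (prod_topology \<tau> \<tau>) \<tau> (\<lambda>(x, y). x + y) \<and>
     continuous_map \<tau> \<tau> (\<lambda>x. - x) \<and>
     continuous_map (prod_topology \<tau> \<tau>) \<tau> (\<lambda>(x, y). x * y)"

definition field_topology_lb :: "'a::field topology \<Rightarrow> bool" where
  "field_topology_lb \<tau> \<longleftrightarrow>
     ring_topology \<tau> \<and> Hausdorff_space \<tau> \<and> \<tau> \<noteq> discrete_topology UNIV \<and>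
     (\<exists>U. nbhd_zero \<tau> U \<and> top_bounded \<tau> U)"

definition coarsening :: "'a topology \<Rightarrow> 'a topology \<Rightarrow> bool" where
  "coarsening \<sigma> \<tau> \<longleftrightarrow> (\<forall>U. openin \<sigma> U \<longrightarrow> openin \<tau> U)"


section \<open>V-topologies\<close>

text \<open>Value groups are written multiplicatively but ordered as for additive
  valuations, so that \<open>v (x + y)\<close> is at least the minimum of \<open>v x\<close> and \<open>v y\<close>; the value \<open>\<infinity>\<close> of \<open>0\<close>
  is avoided by only using \<open>v\<close> on nonzero elements.\<close>

definition ordered_ab_group :: "'g monoid \<Rightarrow> ('g \<times> 'g) set \<Rightarrow> bool" where
  "ordered_ab_group G r \<longleftrightarrow>
     comm_group G \<and> linear_order_on (carrier G) r \<and>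
     (\<forall>a\<in>carrier G. \<forall>b\<in>carrier G. \<forall>c\<in>carrier G.
        (a, b) \<in> r \<longrightarrow> (a \<otimes>\<^bsub>G\<^esub> c, b \<otimes>\<^bsub>G\<^esub> c) \<in> r)"

definition valuation :: "'g monoid \<Rightarrow> ('g \<times> 'g) set \<Rightarrow> ('a::field \<Rightarrow> 'g) \<Rightarrow> bool" where
  "valuation G r v \<longleftrightarrow>
     ordered_ab_group G r \<and>
     (\<forall>x. x \<noteq> 0 \<longrightarrow> v x \<in> carrier G) \<and>
     (\<forall>g\<in>carrier G. \<exists>x. x \<noteq> 0 \<and> v x = g) \<and>
     (\<forall>x y. x \<noteq> 0 \<longrightarrow> y \<noteq> 0 \<longrightarrow> v (x * y) = v x \<otimes>\<^bsub>G\<^esub> v y) \<and>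
     (\<forall>x y. x \<noteq> 0 \<longrightarrow> y \<noteq> 0 \<longrightarrow> x + y \<noteq> 0 \<longrightarrow>
        (v x, v (x + y)) \<in> r \<or> (v y, v (x + y)) \<in> r)"

definition nontrivial_valuation :: "'g monoid \<Rightarrow> ('g \<times> 'g) set \<Rightarrow> ('a::field \<Rightarrow> 'g) \<Rightarrow> bool" where
  "nontrivial_valuation G r v \<longleftrightarrow> valuation G r v \<and> (\<exists>x. x \<noteq> 0 \<and> v x \<noteq> \<one>\<^bsub>G\<^esub>)"

definition induced_by_valuation ::
    "'a::field topology \<Rightarrow> 'g monoid \<Rightarrow> ('g \<times> 'g) set \<Rightarrow> ('a \<Rightarrow> 'g) \<Rightarrow> bool" where
  "induced_by_valuation \<sigma> G r v \<longleftrightarrow>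
     (\<forall>U. openin \<sigma> U \<longleftrightarrow>
        (\<forall>a\<in>U. \<exists>g\<in>carrier G. \<forall>y. y \<noteq> a \<longrightarrow> (g, v (y - a)) \<in> r \<longrightarrow> y \<in> U))"

definition nontrivial_absolute_value :: "('a::field \<Rightarrow> real) \<Rightarrow> bool" where
  "nontrivial_absolute_value f \<longleftrightarrow>
     (\<forall>x. 0 \<le> f x) \<and> (\<forall>x. f x = 0 \<longleftrightarrow> x = 0) \<and>
     (\<forall>x y. f (x * y) = f x * f y) \<and> (\<forall>x y. f (x + y) \<le> f x + f y) \<and>
     (\<exists>x. x \<noteq> 0 \<and> f x \<noteq> 1)"

text \<open>The value group of a valuation on \<open>'a\<close> (valuations being surjective onto their value group)
  is isomorphic to the group of cosets of the units of the valuation ring in the multiplicative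
  group; hence letting value groups live on the type \<open>'a set\<close> loses no generality.\<close>

definition V_topology :: "'a::field topology \<Rightarrow> bool" where
  "V_topology \<sigma> \<longleftrightarrow>
     (\<exists>(G :: 'a set monoid) r v. nontrivial_valuation G r v \<and> induced_by_valuation \<sigma> G r v) \<or>
     (\<exists>f. nontrivial_absolute_value f \<and>
          \<sigma> = Metric_space.mtopology UNIV (\<lambda>x y. f (x - y)))"

definition V_coarsening :: "'a::field topology \<Rightarrow> 'a topology \<Rightarrow> bool" where
  "V_coarsening \<sigma> \<tau> \<longleftrightarrow> V_topology \<sigma> \<and> coarsening \<sigma> \<tau>"


section \<open>W-topologies\<close>

definition W_set :: "nat \<Rightarrow> 'a::field set \<Rightarrow> bool" where
  "W_set n S \<longleftrightarrow>
     (\<forall>x :: nat \<Rightarrow> 'a. \<exists>i\<le>n. \<exists>s. (\<forall>j\<in>{..n} - {i}. s j \<in> S) \<and>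
        x i = (\<Sum>j\<in>{..n} - {i}. s j * x j))"

definition W_topology_n :: "nat \<Rightarrow> 'a::field topology \<Rightarrow> bool" where
  "W_topology_n n \<tau> \<longleftrightarrow> field_topology_lb \<tau> \<and> (\<exists>S. top_bounded \<tau> S \<and> W_set n S)"

definition W_topology :: "'a::field topology \<Rightarrow> bool" where
  "W_topology \<tau> \<longleftrightarrow> (\<exists>n. W_topology_n n \<tau>)"


section \<open>The monster model\<close>

text \<open>First-order formulas in the language of rings with unary predicate symbols from \<open>'p\<close>,
  with de Bruijn indices for bound variables.\<close>

datatype tm = Var nat | Zero | One | Plus tm tm | Neg tm | Times tm tm

datatype 'p fm =
    FEq tm tm | FPred 'p tm | FNot "'p fm" | FAnd "'p fm" "'p fm" | FEx "'p fm"

primrec eval_tm :: "(nat \<Rightarrow> 'm::field) \<Rightarrow> tm \<Rightarrow> 'm" where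
  "eval_tm e (Var i) = e i"
| "eval_tm e Zero = 0"
| "eval_tm e One = 1"
| "eval_tm e (Plus s t) = eval_tm e s + eval_tm e t"
| "eval_tm e (Neg t) = - eval_tm e t"
| "eval_tm e (Times s t) = eval_tm e s * eval_tm e t"

primrec sat :: "('p \<Rightarrow> 'm::field set) \<Rightarrow> (nat \<Rightarrow> 'm) \<Rightarrow> 'p fm \<Rightarrow> bool" where
  "sat P e (FEq s t) \<longleftrightarrow> eval_tm e s = eval_tm e t"
| "sat P e (FPred p t) \<longleftrightarrow> eval_tm e t \<in> P p"
| "sat P e (FNot \<phi>) \<longleftrightarrow> \<not> sat P e \<phi>"
| "sat P e (FAnd \<phi> \<psi>) \<longleftrightarrow> sat P e \<phi> \<and> sat P e \<psi>"
| "sat P e (FEx \<phi>) \<longleftrightarrow> (\<exists>a. sat P (case_nat a e) \<phi>)"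

text \<open>\<open>K\<close> has one predicate symbol for each of its subsets, interpreted as that subset.  An elementary
  extension \<open>K\<^sup>*\<close> is given by a field type \<open>'b\<close>, an embedding \<open>\<iota>\<close> and the interpretation
  \<open>star\<close> of the predicates.\<close>

definition elementary_extension :: "('a::field \<Rightarrow> 'b::field) \<Rightarrow> ('a set \<Rightarrow> 'b set) \<Rightarrow> bool" where
  "elementary_extension \<iota> star \<longleftrightarrow>
     (\<forall>\<phi> e. sat (\<lambda>B. B) e \<phi> \<longleftrightarrow> sat star (\<iota> \<circ> e) \<phi>)"

text \<open>A set \<open>A\<close> of parameters is small if its cardinality is at most that of the language of \<open>K\<close>,
  that is, at most the cardinality of the power set of \<open>K\<close>.  The second argument only serves to
  fix the type \<open>'a\<close>.  A pair \<open>(\<phi>, e)\<close> below stands for the formula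
  \<open>\<phi>(x, e 0, e 1, \<dots>)\<close> with parameters, where \<open>x\<close> is variable \<open>0\<close>.\<close>

definition small :: "'b set \<Rightarrow> 'a itself \<Rightarrow> bool" where
  "small A T \<longleftrightarrow> (card_of A, card_of (UNIV :: 'a set set)) \<in> ordLeq"

definition saturated :: "('a set \<Rightarrow> 'b::field set) \<Rightarrow> bool" where
  "saturated star \<longleftrightarrow>
     (\<forall>A. small A TYPE('a) \<longrightarrow>
       (\<forall>p :: ('a set fm \<times> (nat \<Rightarrow> 'b)) set.
          (\<forall>(\<phi>, e)\<in>p. range e \<subseteq> A) \<longrightarrow>
          (\<forall>F. finite F \<longrightarrow> F \<subseteq> p \<longrightarrow> (\<exists>b. \<forall>(\<phi>, e)\<in>F. sat star (case_nat b e) \<phi>)) \<longrightarrow>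
          (\<exists>b. \<forall>(\<phi>, e)\<in>p. sat star (case_nat b e) \<phi>)))"

definition partial_elementary :: "('p \<Rightarrow> 'b::field set) \<Rightarrow> 'b set \<Rightarrow> ('b \<Rightarrow> 'b) \<Rightarrow> bool" where
  "partial_elementary star A f \<longleftrightarrow>
     (\<forall>\<phi> e. range e \<subseteq> A \<longrightarrow> (sat star e \<phi> \<longleftrightarrow> sat star (f \<circ> e) \<phi>))"

definition automorphism :: "('p \<Rightarrow> 'b::field set) \<Rightarrow> ('b \<Rightarrow> 'b) \<Rightarrow> bool" where
  "automorphism star g \<longleftrightarrow>
     bij g \<and> (\<forall>x y. g (x + y) = g x + g y) \<and> (\<forall>x y. g (x * y) = g x * g y) \<and>
     (\<forall>p x. x \<in> star p \<longleftrightarrow> g x \<in> star p)"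

definition homogeneous :: "('a set \<Rightarrow> 'b::field set) \<Rightarrow> bool" where
  "homogeneous star \<longleftrightarrow>
     (\<forall>A f. small A TYPE('a) \<longrightarrow> partial_elementary star A f \<longrightarrow>
        (\<exists>g. automorphism star g \<and> (\<forall>x\<in>A. g x = f x)))"

definition monster_model :: "('a::field \<Rightarrow> 'b::field) \<Rightarrow> ('a set \<Rightarrow> 'b set) \<Rightarrow> bool" where
  "monster_model \<iota> star \<longleftrightarrow>
     elementary_extension \<iota> star \<and> saturated star \<and> homogeneous star"


section \<open>Local components\<close>

definition R_top :: "('a::field set \<Rightarrow> 'b::field set) \<Rightarrow> 'a topology \<Rightarrow> 'b set" where
  "R_top star \<tau> = (\<Union>B\<in>{B. top_bounded \<tau> B}. star B)"

definition subring_record :: "'b::field set \<Rightarrow> 'b ring" where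
  "subring_record R = \<lparr>carrier = R, mult = (*), one = 1, zero = 0, add = (+)\<rparr>"

text \<open>The localization of a subring \<open>R\<close> of a field at a prime ideal \<open>M\<close>, as a subring of the field.\<close>

definition localization :: "'b::field set \<Rightarrow> 'b set \<Rightarrow> 'b set" where
  "localization R M = {a / s | a s. a \<in> R \<and> s \<in> R - M}"

text \<open>The family \<open>t 0, \<dots>, t (n - 1)\<close> enumerates the local components of \<open>\<tau>\<close>.\<close>

definition local_components ::
    "('a::field set \<Rightarrow> 'b::field set) \<Rightarrow> 'a topology \<Rightarrow> nat \<Rightarrow> (nat \<Rightarrow> 'a topology) \<Rightarrow> bool" where
  "local_components star \<tau> n t \<longleftrightarrow>
     (\<forall>i<n. W_topology (t i)) \<and> inj_on t {..<n} \<and>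
     (\<lambda>i. R_top star (t i)) ` {..<n} =
       {localization (R_top star \<tau>) M | M. maximalideal M (subring_record (R_top star \<tau>))}"

end

(* Idea.  For a local W-topology with bounded W-set S, let R be the ring of bounded elements of the
   monster model and M its maximal ideal.  Adding one standard element c to an R-independent family
   of maximal length shows that c or 1/c agrees modulo M with an element of S*.  So the c in K that
   agree modulo M with an element of S* form a set T with K = T \<union> 1/T; T is nearly closed under the
   ring operations, hence induces a V-topology (Kowalsky-Duerbaum), and the valuation ring of that
   coarsening dominates R.  If O' is the valuation ring of another V-coarsening, the same relations,
   normalized to have coefficients in the intersection of both valuation rings, put the maximal ideal
   of the dominating ring inside O'; for V-topologies this forces equality.  Because of the
   domination, the maximal ideal belonging to a local component is recovered from its V-coarsening
   as the set of bounded infinitesimals, which gives injectivity; surjectivity holds because a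
   valuation ring containing R contains the localization of R at a maximal ideal above its centre. *)

theory Submission
  imports Defs "HOL-Algebra.Ring_Divisibility"
begin

section \<open>Transfer between a field and its elementary extension\<close>

text \<open>The obstacle is that \<open>R\<close> is a union over all standard scalings and not the
  interpretation of a predicate, so facts about \<open>R\<close> and \<open>M\<close> cannot be
  transferred as they stand. The remedy is a nonzero infinitesimal \<open>z\<close>, provided by
  saturation: \<open>z * R\<close> lies in \<open>star S\<close>, so one internal set, that of all
  \<open>y\<close> with \<open>z * y \<in> star S\<close>, contains \<open>R\<close>. "Not
  invertible in \<open>R\<close>" is replaced by the formula "no \<open>t \<in> S\<close> satisfies
  \<open>x * b * t = 1\<close>", which is proved for every standard nonzero \<open>b\<close> and
  transferred to \<open>b = inverse z\<close>. The length of the independent family comes from the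
  same device: minimality of the weight says that no scaling of \<open>S\<close> works one step
  lower, and this is transferred to the scaling by \<open>z\<close>. Topologies are represented by
  one bounded neighbourhood of 0, up to the preorder "contained after multiplication by a nonzero
  scalar"; this preorder describes boundedness, coarsening and inclusion of the rings
  \<open>R\<close> alike.\<close>

primrec ren_tm :: "(nat \<Rightarrow> nat) \<Rightarrow> tm \<Rightarrow> tm" where
  "ren_tm f (Var i) = Var (f i)"
| "ren_tm f Zero = Zero"
| "ren_tm f One = One"
| "ren_tm f (Plus s t) = Plus (ren_tm f s) (ren_tm f t)"
| "ren_tm f (Neg t) = Neg (ren_tm f t)"
| "ren_tm f (Times s t) = Times (ren_tm f s) (ren_tm f t)"

primrec ren_fm :: "(nat \<Rightarrow> nat) \<Rightarrow> 'p fm \<Rightarrow> 'p fm" where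
  "ren_fm f (FEq s t) = FEq (ren_tm f s) (ren_tm f t)"
| "ren_fm f (FPred p t) = FPred p (ren_tm f t)"
| "ren_fm f (FNot \<phi>) = FNot (ren_fm f \<phi>)"
| "ren_fm f (FAnd \<phi> \<psi>) = FAnd (ren_fm f \<phi>) (ren_fm f \<psi>)"
| "ren_fm f (FEx \<phi>) = FEx (ren_fm (case_nat 0 (\<lambda>i. Suc (f i))) \<phi>)"

primrec FExs :: "nat \<Rightarrow> 'p fm \<Rightarrow> 'p fm" where
  "FExs 0 \<phi> = \<phi>"
| "FExs (Suc n) \<phi> = FExs n (FEx \<phi>)"

lemma eval_ren_tm: "eval_tm e (ren_tm f t) = eval_tm (\<lambda>i. e (f i)) t"
  by (induction t) auto

lemma sat_ren_fm: "sat P e (ren_fm f \<phi>) \<longleftrightarrow> sat P (\<lambda>i. e (f i)) \<phi>"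
proof (induction \<phi> arbitrary: e f)
  case (FEx \<phi>)
  have "(\<lambda>i. case_nat a e (case_nat 0 (\<lambda>i. Suc (f i)) i)) = case_nat a (\<lambda>i. e (f i))" for a
    by (auto split: nat.split)
  then show ?case using FEx by simp
qed (auto simp: eval_ren_tm)

text \<open>Stated for maps into any type, so that values of terms and truth values of formulas are
  treated alike. Finite support is what later allows quantification over whole sequences.\<close>

definition supported :: "nat \<Rightarrow> ((nat \<Rightarrow> 'm) \<Rightarrow> 'c) \<Rightarrow> bool" where
  "supported N f \<longleftrightarrow> (\<forall>e e'. (\<forall>i<N. e i = e' i) \<longrightarrow> f e = f e')"

lemma supportedD: "supported N f \<Longrightarrow> (\<And>i. i < N \<Longrightarrow> e i = e' i) \<Longrightarrow> f e = f e'"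
  unfolding supported_def by simp

lemma supported_combine:
  assumes "supported M f" "supported N g"
  shows "supported (max M N) (\<lambda>e. h (f e) (g e))"
  unfolding supported_def
proof (intro allI impI)
  fix e e' :: "nat \<Rightarrow> 'a" assume *: "\<forall>i<max M N. e i = e' i"
  have "f e = f e'" by (rule supportedD[OF assms(1)]) (simp add: *)
  moreover have "g e = g e'" by (rule supportedD[OF assms(2)]) (simp add: *)
  ultimately show "h (f e) (g e) = h (f e') (g e')" by simp
qed

lemma supported_unary: "supported N f \<Longrightarrow> supported N (\<lambda>e. h (f e))"
  unfolding supported_def by metis

lemma eval_tm_supported: "\<exists>N. supported N (\<lambda>e. eval_tm e t)"
proof (induction t)
  case (Var i)
  have "supported (Suc i) (\<lambda>e. eval_tm e (Var i))" by (simp add: supported_def)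
  then show ?case by blast
next
  case (Plus s t)
  then show ?case by (auto intro: supported_combine)
next
  case (Neg t)
  then show ?case by (auto intro: supported_unary)
next
  case (Times s t)
  then show ?case by (auto intro: supported_combine)
qed (auto simp: supported_def)

lemma sat_supported: "\<exists>N. \<forall>P :: 'p \<Rightarrow> 'm::field set. supported N (\<lambda>e. sat P e \<phi>)"
proof (induction \<phi>)
  case (FEq s t)
  obtain M where "supported M (\<lambda>e :: nat \<Rightarrow> 'm. eval_tm e s)" using eval_tm_supported by blast
  moreover obtain N where "supported N (\<lambda>e :: nat \<Rightarrow> 'm. eval_tm e t)" using eval_tm_supported by blast
  ultimately have "supported (max M N) (\<lambda>e :: nat \<Rightarrow> 'm. eval_tm e s = eval_tm e t)"
    by (rule supported_combine[where h = "(=)"])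
  then show ?case by auto
next
  case (FPred p t)
  obtain N where "supported N (\<lambda>e :: nat \<Rightarrow> 'm. eval_tm e t)" using eval_tm_supported by blast
  then have "supported N (\<lambda>e :: nat \<Rightarrow> 'm. eval_tm e t \<in> P p)" for P :: "'p \<Rightarrow> 'm set" by (rule supported_unary[where h = "\<lambda>x. x \<in> P p"])
  then show ?case by auto
next
  case (FNot \<phi>)
  then obtain N where "supported N (\<lambda>e. sat P e \<phi>)" for P :: "'p \<Rightarrow> 'm set" by blast
  then have "supported N (\<lambda>e. \<not> sat P e \<phi>)" for P :: "'p \<Rightarrow> 'm set" by (rule supported_unary[where h = Not])
  then show ?case by auto
next
  case (FAnd \<phi> \<psi>)
  then obtain M N where "supported M (\<lambda>e. sat P e \<phi>)" "supported N (\<lambda>e. sat P e \<psi>)" for P :: "'p \<Rightarrow> 'm set" by blast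
  then have "supported (max M N) (\<lambda>e. sat P e \<phi> \<and> sat P e \<psi>)" for P :: "'p \<Rightarrow> 'm set"
    by (rule supported_combine[where h = "(\<and>)"])
  then show ?case by auto
next
  case (FEx \<phi>)
  then obtain N where N: "supported N (\<lambda>e. sat P e \<phi>)" for P :: "'p \<Rightarrow> 'm set" by blast
  have "supported N (\<lambda>e. sat P e (FEx \<phi>))" for P :: "'p \<Rightarrow> 'm set"
    unfolding supported_def
  proof (intro allI impI)
    fix e e' :: "nat \<Rightarrow> 'm" assume *: "\<forall>i<N. e i = e' i"
    have "sat P (case_nat a e) \<phi> = sat P (case_nat a e') \<phi>" for a
      by (rule supportedD[OF N]) (auto simp: * split: nat.split)
    then show "sat P e (FEx \<phi>) = sat P e' (FEx \<phi>)" by simp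
  qed
  then show ?case by auto
qed

text \<open>The block of quantifiers binds the variables below \<open>n\<close> and shifts the old
  valuation by \<open>n\<close>. A whole sequence \<open>s\<close> can serve as witness because its
  entries from \<open>n\<close> on are never read.\<close>

lemma sat_FExs:
  "sat P e (FExs n \<phi>) \<longleftrightarrow> (\<exists>s. sat P (\<lambda>i. if i < n then s i else e (i - n)) \<phi>)"
proof (induction n arbitrary: \<phi>)
  case (Suc n)
  have *: "case_nat a (\<lambda>i. if i < n then s i else e (i - n))
      = (\<lambda>i. if i < Suc n then case_nat a s i else e (i - Suc n))" for a s
    by (rule ext) (auto split: nat.split)
  have "(\<exists>s a. sat P (\<lambda>i. if i < Suc n then case_nat a s i else e (i - Suc n)) \<phi>)
      \<longleftrightarrow> (\<exists>s. sat P (\<lambda>i. if i < Suc n then s i else e (i - Suc n)) \<phi>)"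
  proof (intro iffI; elim exE)
    fix s assume "sat P (\<lambda>i. if i < Suc n then s i else e (i - Suc n)) \<phi>"
    moreover have "s = case_nat (s 0) (\<lambda>i. s (Suc i))" by (auto split: nat.split)
    ultimately show "\<exists>s a. sat P (\<lambda>i. if i < Suc n then case_nat a s i else e (i - Suc n)) \<phi>"
      by metis
  qed blast
  then show ?case using Suc[of "FEx \<phi>"] by (simp add: *)
qed simp

section \<open>Predicates on the two fields defined by one formula\<close>

definition transfer_tm :: "((nat \<Rightarrow> 'a::field) \<Rightarrow> 'a) \<Rightarrow> ((nat \<Rightarrow> 'b::field) \<Rightarrow> 'b) \<Rightarrow> bool" where
  "transfer_tm f g \<longleftrightarrow> (\<exists>t. (\<forall>e. eval_tm e t = f e) \<and> (\<forall>e. eval_tm e t = g e))"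

text \<open>The formula is hidden behind an existential quantifier, and pairs are built by rules
  that follow the shape of the predicates; so statements are transferred without their formulas
  being written down.\<close>

definition transfer_fm ::
    "('a::field set \<Rightarrow> 'b::field set) \<Rightarrow> ((nat \<Rightarrow> 'a) \<Rightarrow> bool) \<Rightarrow> ((nat \<Rightarrow> 'b) \<Rightarrow> bool) \<Rightarrow> bool" where
  "transfer_fm star P Q \<longleftrightarrow>
     (\<exists>\<phi>. (\<forall>e. sat (\<lambda>B. B) e \<phi> \<longleftrightarrow> P e) \<and> (\<forall>e. sat star e \<phi> \<longleftrightarrow> Q e))"

named_theorems transfer_intros

lemma transfer_tm_var [transfer_intros]: "transfer_tm (\<lambda>e. e i) (\<lambda>e. e i)"
  unfolding transfer_tm_def by (rule exI[of _ "Var i"]) simp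

lemma transfer_tm_zero [transfer_intros]: "transfer_tm (\<lambda>e. 0) (\<lambda>e. 0)"
  unfolding transfer_tm_def by (rule exI[of _ "Zero"]) simp

lemma transfer_tm_one [transfer_intros]: "transfer_tm (\<lambda>e. 1) (\<lambda>e. 1)"
  unfolding transfer_tm_def by (rule exI[of _ "One"]) simp

lemma transfer_tm_plus [transfer_intros]:
  assumes "transfer_tm f g" "transfer_tm f' g'"
  shows "transfer_tm (\<lambda>e. f e + f' e) (\<lambda>e. g e + g' e)"
  using assms unfolding transfer_tm_def by (metis eval_tm.simps(4))

lemma transfer_tm_uminus [transfer_intros]:
  assumes "transfer_tm f g"
  shows "transfer_tm (\<lambda>e. - f e) (\<lambda>e. - g e)"
  using assms unfolding transfer_tm_def by (metis eval_tm.simps(5))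

lemma transfer_tm_times [transfer_intros]:
  assumes "transfer_tm f g" "transfer_tm f' g'"
  shows "transfer_tm (\<lambda>e. f e * f' e) (\<lambda>e. g e * g' e)"
  using assms unfolding transfer_tm_def by (metis eval_tm.simps(6))

lemma transfer_tm_minus [transfer_intros]:
  assumes "transfer_tm f g" "transfer_tm f' g'"
  shows "transfer_tm (\<lambda>e. f e - f' e) (\<lambda>e. g e - g' e)"
  unfolding diff_conv_add_uminus
  by (intro transfer_tm_plus transfer_tm_uminus assms)

lemma transfer_tm_sum [transfer_intros]:
  assumes "finite A" "\<And>j. j \<in> A \<Longrightarrow> transfer_tm (f j) (g j)"
  shows "transfer_tm (\<lambda>e. \<Sum>j\<in>A. f j e) (\<lambda>e. \<Sum>j\<in>A. g j e)"
  using assms by (induction A) (auto intro!: transfer_tm_zero transfer_tm_plus)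

lemma transfer_fm_eq [transfer_intros]:
  assumes "transfer_tm f g" "transfer_tm f' g'"
  shows "transfer_fm star (\<lambda>e. f e = f' e) (\<lambda>e. g e = g' e)"
proof -
  obtain s t where "\<And>e. eval_tm e s = f e" "\<And>e. eval_tm e s = g e"
    "\<And>e. eval_tm e t = f' e" "\<And>e. eval_tm e t = g' e"
    using assms unfolding transfer_tm_def by metis
  then show ?thesis unfolding transfer_fm_def by (intro exI[of _ "FEq s t"]) simp
qed

lemma transfer_fm_mem [transfer_intros]:
  assumes "transfer_tm f g"
  shows "transfer_fm star (\<lambda>e. f e \<in> B) (\<lambda>e. g e \<in> star B)"
proof -
  obtain t where "\<And>e. eval_tm e t = f e" "\<And>e. eval_tm e t = g e"
    using assms unfolding transfer_tm_def by metis
  then show ?thesis unfolding transfer_fm_def by (intro exI[of _ "FPred B t"]) simp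
qed

lemma transfer_fm_not [transfer_intros]:
  assumes "transfer_fm star P Q"
  shows "transfer_fm star (\<lambda>e. \<not> P e) (\<lambda>e. \<not> Q e)"
proof -
  obtain \<phi> where "\<And>e. sat (\<lambda>B. B) e \<phi> \<longleftrightarrow> P e" "\<And>e. sat star e \<phi> \<longleftrightarrow> Q e"
    using assms unfolding transfer_fm_def by metis
  then show ?thesis unfolding transfer_fm_def by (intro exI[of _ "FNot \<phi>"]) simp
qed

lemma transfer_fm_conj [transfer_intros]:
  assumes "transfer_fm star P Q" "transfer_fm star P' Q'"
  shows "transfer_fm star (\<lambda>e. P e \<and> P' e) (\<lambda>e. Q e \<and> Q' e)"
proof -
  obtain \<phi> \<psi> where "\<And>e. sat (\<lambda>B. B) e \<phi> \<longleftrightarrow> P e" "\<And>e. sat star e \<phi> \<longleftrightarrow> Q e"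
    "\<And>e. sat (\<lambda>B. B) e \<psi> \<longleftrightarrow> P' e" "\<And>e. sat star e \<psi> \<longleftrightarrow> Q' e"
    using assms unfolding transfer_fm_def by metis
  then show ?thesis unfolding transfer_fm_def by (intro exI[of _ "FAnd \<phi> \<psi>"]) simp
qed

lemma transfer_fm_disj [transfer_intros]:
  assumes "transfer_fm star P Q" "transfer_fm star P' Q'"
  shows "transfer_fm star (\<lambda>e. P e \<or> P' e) (\<lambda>e. Q e \<or> Q' e)"
  using transfer_fm_not[OF transfer_fm_conj[OF assms[THEN transfer_fm_not]]] by simp

lemma transfer_fm_imp [transfer_intros]:
  assumes "transfer_fm star P Q" "transfer_fm star P' Q'"
  shows "transfer_fm star (\<lambda>e. P e \<longrightarrow> P' e) (\<lambda>e. Q e \<longrightarrow> Q' e)"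
  unfolding imp_conv_disj by (intro transfer_fm_disj transfer_fm_not assms)

text \<open>The index set belongs to the metatheory, so this is a finite conjunction and not a
  quantifier of the language; the empty conjunction is represented by \<open>0 = 0\<close>.\<close>

lemma transfer_fm_ball [transfer_intros]:
  assumes "finite A" "\<And>j. j \<in> A \<Longrightarrow> transfer_fm star (P j) (Q j)"
  shows "transfer_fm star (\<lambda>e. \<forall>j\<in>A. P j e) (\<lambda>e. \<forall>j\<in>A. Q j e)"
  using assms
proof (induction A)
  case empty
  show ?case
    using transfer_fm_eq[OF transfer_tm_zero transfer_tm_zero, of star] by simp
qed (auto intro!: transfer_fm_conj)

lemma transfer_fm_bex [transfer_intros]:
  assumes "finite A" "\<And>j. j \<in> A \<Longrightarrow> transfer_fm star (P j) (Q j)"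
  shows "transfer_fm star (\<lambda>e. \<exists>j\<in>A. P j e) (\<lambda>e. \<exists>j\<in>A. Q j e)"
  using transfer_fm_not[OF transfer_fm_ball[OF assms(1) transfer_fm_not[OF assms(2)]]] by simp

text \<open>A quantifier over a whole sequence stands for finitely many quantifiers, because a formula
  only mentions finitely many variables.  The sequence is interleaved with the old variables.\<close>

lemma transfer_fm_ex [transfer_intros]:
  assumes "transfer_fm star (\<lambda>e. P (\<lambda>k. e (2 * k)) (\<lambda>k. e (2 * k + 1)))
                            (\<lambda>e. Q (\<lambda>k. e (2 * k)) (\<lambda>k. e (2 * k + 1)))"
  shows "transfer_fm star (\<lambda>e. \<exists>s. P e s) (\<lambda>e. \<exists>s. Q e s)"
proof -
  obtain \<phi> where \<phi>: "\<And>e. sat (\<lambda>B. B) e \<phi> \<longleftrightarrow> P (\<lambda>k. e (2 * k)) (\<lambda>k. e (2 * k + 1))"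
    "\<And>e. sat star e \<phi> \<longleftrightarrow> Q (\<lambda>k. e (2 * k)) (\<lambda>k. e (2 * k + 1))"
    using assms unfolding transfer_fm_def by metis
  obtain N where Na: "\<And>P. supported N (\<lambda>e :: nat \<Rightarrow> 'a. sat P e \<phi>)"
    using sat_supported[of \<phi>] by blast
  obtain M where Mb: "\<And>P. supported M (\<lambda>e :: nat \<Rightarrow> 'b. sat P e \<phi>)"
    using sat_supported[of \<phi>] by blast
  \<comment> \<open>The two support bounds are found separately because \<open>sat\<close> is used
    at two types; the quantifier block must cover both.\<close>
  define n where "n = max M N"
  \<comment> \<open>Even positions of the interleaved valuation are old variables, which the block
    of \<open>n\<close> quantifiers has shifted by \<open>n\<close>; odd positions are entries of
    the quantified sequence.\<close>
  define r where "r k = (if even k then n + k div 2 else k div 2)" for k :: nat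
  have 1: "sat (\<lambda>B. B) (\<lambda>i. if r i < n then s (r i) else e (r i - n)) \<phi> \<longleftrightarrow> P e s" for e s
  proof -
    have "sat (\<lambda>B. B) (\<lambda>i. if r i < n then s (r i) else e (r i - n)) \<phi>
        \<longleftrightarrow> sat (\<lambda>B. B) (\<lambda>k. if even k then e (k div 2) else s (k div 2)) \<phi>"
      by (rule supportedD[OF Na]) (auto simp: r_def n_def)
    also have "\<dots> \<longleftrightarrow> P e s" by (simp add: \<phi>)
    finally show ?thesis .
  qed
  have 2: "sat star (\<lambda>i. if r i < n then s (r i) else e (r i - n)) \<phi> \<longleftrightarrow> Q e s" for e s
  proof -
    have "sat star (\<lambda>i. if r i < n then s (r i) else e (r i - n)) \<phi>
        \<longleftrightarrow> sat star (\<lambda>k. if even k then e (k div 2) else s (k div 2)) \<phi>"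
      by (rule supportedD[OF Mb]) (auto simp: r_def n_def)
    also have "\<dots> \<longleftrightarrow> Q e s" by (simp add: \<phi>)
    finally show ?thesis .
  qed
  have "sat (\<lambda>B. B) e (FExs n (ren_fm r \<phi>)) \<longleftrightarrow> (\<exists>s. P e s)" for e
    unfolding sat_FExs sat_ren_fm
  proof (rule iff_exI)
    fix s show "sat (\<lambda>B. B) (\<lambda>i. if r i < n then s (r i) else e (r i - n)) \<phi> \<longleftrightarrow> P e s"
      by (fact 1[of s e])
  qed
  moreover have "sat star e (FExs n (ren_fm r \<phi>)) \<longleftrightarrow> (\<exists>s. Q e s)" for e
    unfolding sat_FExs sat_ren_fm
  proof (rule iff_exI)
    fix s show "sat star (\<lambda>i. if r i < n then s (r i) else e (r i - n)) \<phi> \<longleftrightarrow> Q e s"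
      by (fact 2[of s e])
  qed
  ultimately show ?thesis unfolding transfer_fm_def by blast
qed

lemma transfer_fm_all [transfer_intros]:
  assumes "transfer_fm star (\<lambda>e. P (\<lambda>k. e (2 * k)) (\<lambda>k. e (2 * k + 1)))
                            (\<lambda>e. Q (\<lambda>k. e (2 * k)) (\<lambda>k. e (2 * k + 1)))"
  shows "transfer_fm star (\<lambda>e. \<forall>s. P e s) (\<lambda>e. \<forall>s. Q e s)"
proof -
  have "transfer_fm star (\<lambda>e. \<not> (\<exists>s. \<not> P e s)) (\<lambda>e. \<not> (\<exists>s. \<not> Q e s))"
    by (rule transfer_fm_not, rule transfer_fm_ex, rule transfer_fm_not, rule assms)
  then show ?thesis by simp
qed

lemma transfer_fm_ex1 [transfer_intros]:
  assumes "transfer_fm star (\<lambda>e. P (\<lambda>k. e (Suc k)) (e 0)) (\<lambda>e. Q (\<lambda>k. e (Suc k)) (e 0))"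
  shows "transfer_fm star (\<lambda>e. \<exists>x. P e x) (\<lambda>e. \<exists>x. Q e x)"
proof -
  obtain \<phi> where "\<And>e. sat (\<lambda>B. B) e \<phi> \<longleftrightarrow> P (\<lambda>k. e (Suc k)) (e 0)"
    "\<And>e. sat star e \<phi> \<longleftrightarrow> Q (\<lambda>k. e (Suc k)) (e 0)"
    using assms unfolding transfer_fm_def by metis
  then show ?thesis unfolding transfer_fm_def by (intro exI[of _ "FEx \<phi>"]) simp
qed

lemma transfer_fm_all1 [transfer_intros]:
  assumes "transfer_fm star (\<lambda>e. P (\<lambda>k. e (Suc k)) (e 0)) (\<lambda>e. Q (\<lambda>k. e (Suc k)) (e 0))"
  shows "transfer_fm star (\<lambda>e. \<forall>x. P e x) (\<lambda>e. \<forall>x. Q e x)"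
proof -
  have "transfer_fm star (\<lambda>e. \<not> (\<exists>x. \<not> P e x)) (\<lambda>e. \<not> (\<exists>x. \<not> Q e x))"
    by (rule transfer_fm_not, rule transfer_fm_ex1, rule transfer_fm_not, rule assms)
  then show ?thesis by simp
qed

lemma transfer_fm_Bex [transfer_intros]:
  assumes "transfer_fm star (\<lambda>e. P (\<lambda>k. e (Suc k)) (e 0)) (\<lambda>e. Q (\<lambda>k. e (Suc k)) (e 0))"
  shows "transfer_fm star (\<lambda>e. \<exists>x\<in>B. P e x) (\<lambda>e. \<exists>x\<in>star B. Q e x)"
  unfolding Bex_def by (intro transfer_intros assms)

lemma transfer_fm_Ball [transfer_intros]:
  assumes "transfer_fm star (\<lambda>e. P (\<lambda>k. e (Suc k)) (e 0)) (\<lambda>e. Q (\<lambda>k. e (Suc k)) (e 0))"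
  shows "transfer_fm star (\<lambda>e. \<forall>x\<in>B. P e x) (\<lambda>e. \<forall>x\<in>star B. Q e x)"
  unfolding Ball_def by (intro transfer_intros assms)

lemma transferD:
  assumes "transfer_fm star P Q" "elementary_extension \<iota> star"
  shows "P e \<longleftrightarrow> Q (\<iota> \<circ> e)"
proof -
  obtain \<phi> where "\<And>e. sat (\<lambda>B. B) e \<phi> \<longleftrightarrow> P e" "\<And>e. sat star e \<phi> \<longleftrightarrow> Q e"
    using assms(1) unfolding transfer_fm_def by blast
  then show ?thesis using assms(2) unfolding elementary_extension_def by simp
qed

section \<open>Locally bounded topologies given by one bounded neighbourhood\<close>

text \<open>The axioms under which the sets \<open>c * B\<close> with \<open>c \<noteq> 0\<close>
  can serve as basic neighbourhoods of 0 with \<open>B\<close> bounded. Each constant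
  \<open>k\<close> expresses continuity of an operation by a single scaling. The last clause absorbs
  points and, through \<open>lb_set_absorb\<close>, yields a common scaled copy inside two given
  ones. The clause \<open>1 \<in> B\<close> is a normalization.\<close>

definition lb_set :: "'a::field set \<Rightarrow> bool" where
  "lb_set B \<longleftrightarrow> 0 \<in> B \<and> 1 \<in> B \<and> B \<noteq> UNIV \<and>
     (\<exists>k. k \<noteq> 0 \<and> (\<forall>x\<in>B. \<forall>y\<in>B. k * (x + y) \<in> B)) \<and>
     (\<exists>k. k \<noteq> 0 \<and> (\<forall>x\<in>B. \<forall>y\<in>B. k * (x * y) \<in> B)) \<and>
     (\<exists>k. k \<noteq> 0 \<and> (\<forall>x\<in>B. k * (- x) \<in> B)) \<and>
     (\<forall>x y. \<exists>c. c \<noteq> 0 \<and> c * x \<in> B \<and> c * y \<in> B)"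

definition base_set :: "'a::field topology \<Rightarrow> 'a set \<Rightarrow> bool" where
  "base_set \<tau> B \<longleftrightarrow> (\<forall>W. openin \<tau> W \<longleftrightarrow> (\<forall>a\<in>W. \<exists>c. c \<noteq> 0 \<and> (\<forall>b\<in>B. a + c * b \<in> W)))"

text \<open>One preorder with three readings: boundedness in \<open>top_bounded_base\<close>,
  coarsening in \<open>coarsening_base\<close>, inclusion of rings of finite elements in
  \<open>lb_le_iff_fin\<close>.\<close>

definition lb_le :: "'a::field set \<Rightarrow> 'a set \<Rightarrow> bool" where
  "lb_le X B \<longleftrightarrow> (\<exists>c. c \<noteq> 0 \<and> (\<forall>x\<in>X. c * x \<in> B))"

lemma lb_set_zero: "lb_set B \<Longrightarrow> 0 \<in> B" and lb_set_one: "lb_set B \<Longrightarrow> 1 \<in> B"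
  and lb_set_proper: "lb_set B \<Longrightarrow> B \<noteq> UNIV"
  by (auto simp: lb_set_def)

lemma lb_set_addE:
  assumes "lb_set B" obtains k where "k \<noteq> 0" "\<And>x y. x \<in> B \<Longrightarrow> y \<in> B \<Longrightarrow> k * (x + y) \<in> B"
  using assms unfolding lb_set_def by blast

lemma lb_set_multE:
  assumes "lb_set B" obtains k where "k \<noteq> 0" "\<And>x y. x \<in> B \<Longrightarrow> y \<in> B \<Longrightarrow> k * (x * y) \<in> B"
  using assms unfolding lb_set_def by blast

lemma lb_set_negE:
  assumes "lb_set B" obtains k where "k \<noteq> 0" "\<And>x. x \<in> B \<Longrightarrow> k * (- x) \<in> B"
  using assms unfolding lb_set_def by blast

lemma lb_set_absorb2:
  assumes "lb_set B" obtains c where "c \<noteq> 0" "c * x \<in> B" "c * y \<in> B"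
  using assms unfolding lb_set_def by blast

text \<open>Induction on \<open>F\<close>: the two-element absorption clause treats the new member
  and the scalar found so far at the same time.\<close>

lemma lb_set_absorb:
  assumes B: "lb_set B" and "finite F"
  obtains c where "c \<noteq> 0" "\<And>x b. x \<in> F \<Longrightarrow> b \<in> B \<Longrightarrow> c * x * b \<in> B"
proof -
  obtain k where k: "k \<noteq> 0" "\<And>x y. x \<in> B \<Longrightarrow> y \<in> B \<Longrightarrow> k * (x * y) \<in> B"
    using lb_set_multE[OF B] by blast
  have "\<exists>c. c \<noteq> 0 \<and> (\<forall>x\<in>F. \<forall>b\<in>B. c * x * b \<in> B)"
    using \<open>finite F\<close>
  proof induction
    case (insert y F)
    then obtain c where c: "c \<noteq> 0" "\<And>x b. x \<in> F \<Longrightarrow> b \<in> B \<Longrightarrow> c * x * b \<in> B" by blast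
    \<comment> \<open>The factor \<open>inverse k\<close> is built in to cancel the constant
      \<open>k\<close> of the product rule.\<close>
    obtain c' where c': "c' \<noteq> 0" "c' * inverse k \<in> B" "c' * (c * y * inverse k) \<in> B"
      using lb_set_absorb2[OF B] by metis
    have "c' * c * x * b \<in> B" if "x \<in> insert y F" "b \<in> B" for x b
    proof (cases "x = y")
      case True
      then show ?thesis using k(2)[OF c'(3) that(2)] k(1) by (simp add: field_simps)
    next
      case False
      then have "c * x * b \<in> B" using c that by blast
      then show ?thesis using k(2)[OF c'(2), of "c * x * b"] k(1) by (simp add: field_simps)
    qed
    then show ?case using c c' by (intro exI[of _ "c' * c"]) auto
  qed (auto intro: exI[of _ 1])
  then show thesis using that by blast
qed

lemma base_set_openI:
  assumes "base_set \<tau> B" "\<And>a. a \<in> W \<Longrightarrow> \<exists>c. c \<noteq> 0 \<and> (\<forall>b\<in>B. a + c * b \<in> W)"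
  shows "openin \<tau> W"
  using assms by (simp add: base_set_def)

lemma base_set_openE:
  assumes "base_set \<tau> B" "openin \<tau> W" "a \<in> W"
  obtains c where "c \<noteq> 0" "\<And>b. b \<in> B \<Longrightarrow> a + c * b \<in> W"
proof -
  have "\<forall>a\<in>W. \<exists>c. c \<noteq> 0 \<and> (\<forall>b\<in>B. a + c * b \<in> W)"
    using assms(1,2) unfolding base_set_def by simp
  then show thesis using assms(3) that by blast
qed

section \<open>Neighbourhoods, bounded sets and coarsenings read off from \<open>B\<close>\<close>

lemma nbhd_zero_base:
  assumes B: "lb_set B" and \<tau>: "base_set \<tau> B"
  shows "nbhd_zero \<tau> U \<longleftrightarrow> (\<exists>c. c \<noteq> 0 \<and> (\<forall>b\<in>B. c * b \<in> U))"
proof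
  assume "nbhd_zero \<tau> U"
  then obtain W where W: "openin \<tau> W" "0 \<in> W" "W \<subseteq> U" unfolding nbhd_zero_def by blast
  then obtain c where "c \<noteq> 0" "\<And>b. b \<in> B \<Longrightarrow> 0 + c * b \<in> W"
    using base_set_openE[OF \<tau>] by blast
  then show "\<exists>c. c \<noteq> 0 \<and> (\<forall>b\<in>B. c * b \<in> U)" using W by auto
next
  assume "\<exists>c. c \<noteq> 0 \<and> (\<forall>b\<in>B. c * b \<in> U)"
  then obtain c where c: "c \<noteq> 0" "\<And>b. b \<in> B \<Longrightarrow> c * b \<in> U" by blast
  obtain k where k: "k \<noteq> 0" "\<And>x y. x \<in> B \<Longrightarrow> y \<in> B \<Longrightarrow> k * (x + y) \<in> B"
    using lb_set_addE[OF B] by blast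
  \<comment> \<open>The interior of \<open>U\<close>. It is open because \<open>k\<close> allows two
    small steps along \<open>B\<close> to be combined into one step of size
    \<open>c\<close>.\<close>
  define W where "W = {a. \<exists>c. c \<noteq> 0 \<and> (\<forall>b\<in>B. a + c * b \<in> U)}"
  have "openin \<tau> W"
  proof (rule base_set_openI[OF \<tau>])
    fix a assume "a \<in> W"
    then obtain c where c: "c \<noteq> 0" "\<And>b. b \<in> B \<Longrightarrow> a + c * b \<in> U" unfolding W_def by blast
    have "a + c * k * b \<in> W" if "b \<in> B" for b
      unfolding W_def
    proof (intro CollectI exI[of _ "c * k"] conjI ballI)
      fix b' assume "b' \<in> B"
      then show "a + c * k * b + c * k * b' \<in> U"
        using c(2)[OF k(2)[OF that, of b']] by (simp add: algebra_simps)
    qed (use c k in auto)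
    then show "\<exists>c. c \<noteq> 0 \<and> (\<forall>b\<in>B. a + c * b \<in> W)"
      using c k by (intro exI[of _ "c * k"]) auto
  qed
  moreover have "0 \<in> W" using c unfolding W_def by auto
  moreover have "W \<subseteq> U" using lb_set_zero[OF B] unfolding W_def by force
  ultimately show "nbhd_zero \<tau> U" unfolding nbhd_zero_def by blast
qed

lemma top_bounded_base:
  assumes B: "lb_set B" and \<tau>: "base_set \<tau> B"
  shows "top_bounded \<tau> X \<longleftrightarrow> lb_le X B"
proof
  assume X: "top_bounded \<tau> X"
  have "nbhd_zero \<tau> B" unfolding nbhd_zero_base[OF assms] by (intro exI[of _ 1]) auto
  then obtain V where V: "nbhd_zero \<tau> V" "\<And>v x. v \<in> V \<Longrightarrow> x \<in> X \<Longrightarrow> v * x \<in> B"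
    using X unfolding top_bounded_def by blast
  then obtain c where c: "c \<noteq> 0" "\<And>b. b \<in> B \<Longrightarrow> c * b \<in> V"
    unfolding nbhd_zero_base[OF assms] by blast
  \<comment> \<open>The normalization \<open>1 \<in> B\<close> makes the scalar itself a member of
    \<open>V\<close>.\<close>
  then have "c \<in> V" using c(2)[OF lb_set_one[OF B]] by simp
  then show "lb_le X B" unfolding lb_le_def using c V by blast
next
  assume "lb_le X B"
  then obtain c where c: "c \<noteq> 0" "\<And>x. x \<in> X \<Longrightarrow> c * x \<in> B" unfolding lb_le_def by blast
  obtain k where k: "k \<noteq> 0" "\<And>x y. x \<in> B \<Longrightarrow> y \<in> B \<Longrightarrow> k * (x * y) \<in> B"
    using lb_set_multE[OF B] by blast
  show "top_bounded \<tau> X" unfolding top_bounded_def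
  proof (intro allI impI)
    fix U assume "nbhd_zero \<tau> U"
    then obtain c' where c': "c' \<noteq> 0" "\<And>b. b \<in> B \<Longrightarrow> c' * b \<in> U"
      unfolding nbhd_zero_base[OF assms] by blast
    define V where "V = (\<lambda>b. c' * c * k * b) ` B"
    have "nbhd_zero \<tau> V" unfolding nbhd_zero_base[OF assms] V_def
      using c c' k by (intro exI[of _ "c' * c * k"]) auto
    moreover have "v * x \<in> U" if v: "v \<in> V" and x: "x \<in> X" for v x
    proof -
      obtain b where "b \<in> B" "v = c' * c * k * b" using v unfolding V_def by blast
      then show ?thesis using c'(2)[OF k(2)[of b "c * x"]] c(2)[OF x]
        by (simp add: algebra_simps)
    qed
    ultimately show "\<exists>V. nbhd_zero \<tau> V \<and> (\<forall>v\<in>V. \<forall>b\<in>X. v * b \<in> U)" by blast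
  qed
qed

text \<open>The order is reversed: a coarser topology has larger basic neighbourhoods, so it is
  \<open>B\<close> that has to fit into a scaled copy of \<open>T\<close>.\<close>

lemma coarsening_base:
  assumes B: "lb_set B" "base_set \<tau> B" and T: "lb_set T" "base_set \<sigma> T"
  shows "coarsening \<sigma> \<tau> \<longleftrightarrow> lb_le B T"
proof
  assume \<sigma>: "coarsening \<sigma> \<tau>"
  have "nbhd_zero \<sigma> T" unfolding nbhd_zero_base[OF T] by (intro exI[of _ 1]) auto
  then have "nbhd_zero \<tau> T" using \<sigma> unfolding nbhd_zero_def coarsening_def by blast
  then show "lb_le B T" unfolding nbhd_zero_base[OF B] lb_le_def .
next
  assume "lb_le B T"
  then obtain c where c: "c \<noteq> 0" "\<And>b. b \<in> B \<Longrightarrow> c * b \<in> T" unfolding lb_le_def by blast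
  show "coarsening \<sigma> \<tau>" unfolding coarsening_def
  proof (intro allI impI)
    fix U assume U: "openin \<sigma> U"
    have "\<exists>c. c \<noteq> 0 \<and> (\<forall>b\<in>B. a + c * b \<in> U)" if a: "a \<in> U" for a
    proof -
      obtain c' where "c' \<noteq> 0" "\<And>x. x \<in> T \<Longrightarrow> a + c' * x \<in> U"
        using base_set_openE[OF T(2) U a] by blast
      then show ?thesis using c by (intro exI[of _ "c' * c"]) (auto simp: mult.assoc)
    qed
    then show "openin \<tau> U" by (rule base_set_openI[OF B(2)])
  qed
qed

lemma coarsening_antisym: "coarsening \<sigma> \<tau> \<Longrightarrow> coarsening \<tau> \<sigma> \<Longrightarrow> \<sigma> = \<tau>"
  unfolding coarsening_def topology_eq by blast

lemma base_set_scaling: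
  assumes "base_set \<sigma> B" "lb_le B T" "lb_le T B"
  shows "base_set \<sigma> T"
proof -
  obtain a b where a: "a \<noteq> 0" "\<And>x. x \<in> B \<Longrightarrow> a * x \<in> T" and b: "b \<noteq> 0" "\<And>x. x \<in> T \<Longrightarrow> b * x \<in> B"
    using assms unfolding lb_le_def by blast
  have "(\<exists>c. c \<noteq> 0 \<and> (\<forall>b\<in>B. x + c * b \<in> W)) \<longleftrightarrow> (\<exists>c. c \<noteq> 0 \<and> (\<forall>b\<in>T. x + c * b \<in> W))" for x W
  proof
    assume "\<exists>c. c \<noteq> 0 \<and> (\<forall>b\<in>B. x + c * b \<in> W)"
    then obtain c where "c \<noteq> 0" "\<And>b. b \<in> B \<Longrightarrow> x + c * b \<in> W" by blast
    then show "\<exists>c. c \<noteq> 0 \<and> (\<forall>b\<in>T. x + c * b \<in> W)"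
      using b by (intro exI[of _ "c * b"]) (auto simp: mult.assoc)
  next
    assume "\<exists>c. c \<noteq> 0 \<and> (\<forall>b\<in>T. x + c * b \<in> W)"
    then obtain c where "c \<noteq> 0" "\<And>b. b \<in> T \<Longrightarrow> x + c * b \<in> W" by blast
    then show "\<exists>c. c \<noteq> 0 \<and> (\<forall>b\<in>B. x + c * b \<in> W)"
      using a by (intro exI[of _ "c * a"]) (auto simp: mult.assoc)
  qed
  then show ?thesis using assms(1) unfolding base_set_def by simp
qed

section \<open>A bounded neighbourhood describing a given ring topology\<close>

lemma openin_binary_section:
  assumes "topspace \<tau> = UNIV" "continuous_map (prod_topology \<tau> \<tau>) \<tau> (\<lambda>(x, y). f x y)"
    and "openin \<tau> W"
  shows "openin \<tau> {x. f a x \<in> W}"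
proof -
  have "continuous_map \<tau> (prod_topology \<tau> \<tau>) (\<lambda>x. (a, x))"
    by (intro continuous_intros) (auto simp: assms(1))
  from continuous_map_compose[OF this assms(2)] have "continuous_map \<tau> \<tau> (\<lambda>x. f a x)"
    by (simp add: o_def)
  from openin_continuous_map_preimage[OF this assms(3)] show ?thesis by (simp add: assms(1))
qed

lemma ring_topology_open_translate: "ring_topology \<tau> \<Longrightarrow> openin \<tau> W \<Longrightarrow> openin \<tau> {x. a + x \<in> W}"
  and ring_topology_open_scale: "ring_topology \<tau> \<Longrightarrow> openin \<tau> W \<Longrightarrow> openin \<tau> {x. a * x \<in> W}"
  unfolding ring_topology_def by (auto intro: openin_binary_section)

lemma nbhd_zero_binary:
  assumes "topspace \<tau> = UNIV" "continuous_map (prod_topology \<tau> \<tau>) \<tau> (\<lambda>(x, y). f x y)"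
    and "f 0 0 = 0" "nbhd_zero \<tau> U"
  obtains V where "nbhd_zero \<tau> V" "\<And>x y. x \<in> V \<Longrightarrow> y \<in> V \<Longrightarrow> f x y \<in> U"
proof -
  obtain W where W: "openin \<tau> W" "0 \<in> W" "W \<subseteq> U" using assms(4) unfolding nbhd_zero_def by blast
  have "openin (prod_topology \<tau> \<tau>) {z. f (fst z) (snd z) \<in> W}"
    using openin_continuous_map_preimage[OF assms(2) W(1)] by (simp add: assms(1) case_prod_beta)
  then have "\<forall>x y. (x, y) \<in> {z. f (fst z) (snd z) \<in> W} \<longrightarrow>
      (\<exists>X Y. openin \<tau> X \<and> openin \<tau> Y \<and> x \<in> X \<and> y \<in> Y \<and> X \<times> Y \<subseteq> {z. f (fst z) (snd z) \<in> W})"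
    by (simp only: openin_prod_topology_alt)
  from this[rule_format, of 0 0] obtain X Y where XY: "openin \<tau> X" "openin \<tau> Y" "0 \<in> X" "0 \<in> Y"
    "X \<times> Y \<subseteq> {z. f (fst z) (snd z) \<in> W}"
    using W(2) assms(3) by auto
  show thesis
  proof (rule that[of "X \<inter> Y"])
    show "nbhd_zero \<tau> (X \<inter> Y)" unfolding nbhd_zero_def using XY by blast
    show "f x y \<in> U" if "x \<in> X \<inter> Y" "y \<in> X \<inter> Y" for x y
      using that XY(5) W(3) by force
  qed
qed

text \<open>\<open>B\<close> is a bounded neighbourhood of 0 with 1 adjoined. Non-discreteness
  provides nonzero elements in every neighbourhood, boundedness turns them into scaled copies of
  \<open>B\<close>, and the Hausdorff property keeps \<open>B\<close> from being everything.\<close>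

lemma field_topology_lb_base:
  assumes \<tau>: "field_topology_lb \<tau>"
  obtains B where "lb_set B" "base_set \<tau> B"
proof -
  have rt: "ring_topology \<tau>" and haus: "Hausdorff_space \<tau>" and nd: "\<tau> \<noteq> discrete_topology UNIV"
    using \<tau> unfolding field_topology_lb_def by auto
  have top: "topspace \<tau> = UNIV" using rt unfolding ring_topology_def by auto
  obtain U0 where U0: "nbhd_zero \<tau> U0" "top_bounded \<tau> U0"
    using \<tau> unfolding field_topology_lb_def by blast
  have mono: "nbhd_zero \<tau> U \<Longrightarrow> U \<subseteq> V \<Longrightarrow> nbhd_zero \<tau> V" for U V
    unfolding nbhd_zero_def by blast
  have int: "nbhd_zero \<tau> (U \<inter> V)" if UV: "nbhd_zero \<tau> U" "nbhd_zero \<tau> V" for U V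
  proof -
    obtain W W' where "openin \<tau> W" "0 \<in> W" "W \<subseteq> U" "openin \<tau> W'" "0 \<in> W'" "W' \<subseteq> V"
      using UV unfolding nbhd_zero_def by blast
    then show ?thesis unfolding nbhd_zero_def by (intro exI[of _ "W \<inter> W'"]) auto
  qed
  have scale: "nbhd_zero \<tau> {x. a * x \<in> U}" if U: "nbhd_zero \<tau> U" for a U
  proof -
    obtain W where "openin \<tau> W" "0 \<in> W" "W \<subseteq> U" using U unfolding nbhd_zero_def by blast
    then show ?thesis using ring_topology_open_scale[OF rt, of W a]
      unfolding nbhd_zero_def by (intro exI[of _ "{x. a * x \<in> W}"]) auto
  qed
  have nontriv: "\<exists>c\<in>U. c \<noteq> 0" if U: "nbhd_zero \<tau> U" for U
  proof (rule ccontr)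
    assume "\<not> (\<exists>c\<in>U. c \<noteq> 0)"
    then have "openin \<tau> {0}" using U unfolding nbhd_zero_def
      by (metis (no_types, lifting) empty_iff insert_iff subset_eq subset_singletonD)
    then have "openin \<tau> {y. - x + y \<in> {0}}" for x by (rule ring_topology_open_translate[OF rt])
    moreover have "{y. - x + y \<in> {0}} = {x}" for x :: 'a by (auto simp: add_eq_0_iff)
    ultimately have "openin \<tau> {x}" for x by metis
    then have "\<tau> = discrete_topology UNIV"
      using top discrete_topology_unique[of UNIV \<tau>] by auto
    then show False using nd by blast
  qed
  define B where "B = insert 1 U0"
  have nB: "nbhd_zero \<tau> B" by (rule mono[OF U0(1)]) (auto simp: B_def)
  have bdd: "\<exists>V. nbhd_zero \<tau> V \<and> (\<forall>v\<in>V. \<forall>b\<in>B. v * b \<in> U)" if U: "nbhd_zero \<tau> U" for U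
  proof -
    obtain V where "nbhd_zero \<tau> V" "\<And>v b. v \<in> V \<Longrightarrow> b \<in> U0 \<Longrightarrow> v * b \<in> U"
      using U0(2) U unfolding top_bounded_def by blast
    \<comment> \<open>Intersecting with \<open>U\<close> takes care of the adjoined point 1.\<close>
    then show ?thesis using int[of V U] U by (intro exI[of _ "V \<inter> U"]) (auto simp: B_def)
  qed
  have small: "\<exists>c. c \<noteq> 0 \<and> (\<forall>b\<in>B. c * b \<in> U)" if U: "nbhd_zero \<tau> U" for U
  proof -
    obtain V where V: "nbhd_zero \<tau> V" "\<forall>v\<in>V. \<forall>b\<in>B. v * b \<in> U" using bdd[OF U] by auto
    obtain c where "c \<in> V" "c \<noteq> 0" using nontriv[OF V(1)] by auto
    then show ?thesis using V(2) by auto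
  qed
  \<comment> \<open>If the whole field were bounded, every neighbourhood of 0 would contain
    1.\<close>
  have proper: "B \<noteq> UNIV"
  proof
    assume B: "B = UNIV"
    obtain U V where UV: "openin \<tau> U" "openin \<tau> V" "0 \<in> U" "1 \<in> V" "disjnt U V"
      using haus top unfolding Hausdorff_space_def by (metis UNIV_I zero_neq_one)
    then have "nbhd_zero \<tau> U" unfolding nbhd_zero_def by blast
    from small[OF this] obtain c where c: "c \<noteq> 0" "\<And>b. c * b \<in> U" using B by auto
    from c(2)[of "inverse c"] have "1 \<in> U" using c(1) by simp
    then show False using UV by (auto simp: disjnt_def)
  qed
  have "\<exists>k. k \<noteq> 0 \<and> (\<forall>x\<in>B. \<forall>y\<in>B. k * (x + y) \<in> B)"
  proof -
    obtain V where V: "nbhd_zero \<tau> V" "\<And>x y. x \<in> V \<Longrightarrow> y \<in> V \<Longrightarrow> x + y \<in> B"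
      using nbhd_zero_binary[of \<tau> "(+)" B] rt nB unfolding ring_topology_def by auto
    obtain c where "c \<noteq> 0" "\<forall>b\<in>B. c * b \<in> V" using small[OF V(1)] by auto
    then show ?thesis using V(2) by (intro exI[of _ c]) (auto simp: distrib_left)
  qed
  moreover have "\<exists>k. k \<noteq> 0 \<and> (\<forall>x\<in>B. \<forall>y\<in>B. k * (x * y) \<in> B)"
  proof -
    obtain V where V: "nbhd_zero \<tau> V" "\<And>x y. x \<in> V \<Longrightarrow> y \<in> B \<Longrightarrow> x * y \<in> B"
      using bdd[OF nB] by auto
    obtain c where "c \<noteq> 0" "\<forall>b\<in>B. c * b \<in> V" using small[OF V(1)] by auto
    then show ?thesis using V(2) by (intro exI[of _ c]) (auto simp flip: mult.assoc)
  qed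
  moreover have "\<exists>k. k \<noteq> 0 \<and> (\<forall>x\<in>B. k * (- x) \<in> B)"
    using small[OF scale[OF nB, of "-1"]] by auto
  moreover have "\<exists>c. c \<noteq> 0 \<and> c * x \<in> B \<and> c * y \<in> B" for x y
    using nontriv[OF int[OF scale[OF nB, of x] scale[OF nB, of y]]] by (auto simp: mult.commute)
  moreover have "0 \<in> B" using nB unfolding nbhd_zero_def by blast
  ultimately have "lb_set B" using proper unfolding lb_set_def by (simp add: B_def)
  moreover have "base_set \<tau> B" unfolding base_set_def
  proof (intro allI iffI ballI)
    fix W a assume W: "openin \<tau> W" and a: "a \<in> W"
    have "nbhd_zero \<tau> {x. a + x \<in> W}"
      unfolding nbhd_zero_def using ring_topology_open_translate[OF rt W, of a] a by auto
    from small[OF this] show "\<exists>c. c \<noteq> 0 \<and> (\<forall>b\<in>B. a + c * b \<in> W)" by auto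
  next
    fix W assume W: "\<forall>a\<in>W. \<exists>c. c \<noteq> 0 \<and> (\<forall>b\<in>B. a + c * b \<in> W)"
    show "openin \<tau> W"
      unfolding openin_subopen[of \<tau> W]
    proof
      fix a assume "a \<in> W"
      then obtain c where c: "c \<noteq> 0" "\<And>b. b \<in> B \<Longrightarrow> a + c * b \<in> W" using W by auto
      obtain V where V: "openin \<tau> V" "0 \<in> V" "V \<subseteq> {x. inverse c * x \<in> B}"
        using scale[OF nB, of "inverse c"] unfolding nbhd_zero_def by blast
      have "x \<in> W" if "- a + x \<in> V" for x
      proof -
        have "inverse c * (- a + x) \<in> B" using that V by auto
        from c(2)[OF this] c(1) show ?thesis by (simp flip: mult.assoc)
      qed
      moreover have "openin \<tau> {x. - a + x \<in> V}" by (rule ring_topology_open_translate[OF rt V(1)])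
      ultimately show "\<exists>T. openin \<tau> T \<and> a \<in> T \<and> T \<subseteq> W"
        using V(2) by (intro exI[of _ "{x. - a + x \<in> V}"]) auto
    qed
  qed
  ultimately show thesis by (rule that)
qed

section \<open>V-topologies\<close>

text \<open>The defining property of valuation rings without closure under the operations. The
  convention \<open>inverse 0 = 0\<close> makes it include \<open>0 \<in> T\<close>, and
  \<open>x = 1\<close> gives \<open>1 \<in> T\<close>.\<close>

definition vset :: "'a::field set \<Rightarrow> bool" where
  "vset T \<longleftrightarrow> (\<forall>x. x \<in> T \<or> inverse x \<in> T)"

lemma vsetD: "vset T \<Longrightarrow> x \<notin> T \<Longrightarrow> inverse x \<in> T"
  unfolding vset_def by blast

text \<open>Absorption of two points is automatic: for nonzero \<open>x\<close> and \<open>y\<close>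
  one of \<open>y / x\<close>, \<open>x / y\<close> lies in \<open>T\<close>, so scaling by
  \<open>inverse x\<close> or \<open>inverse y\<close> works.\<close>

lemma lb_set_vsetI:
  assumes T: "vset T" "T \<noteq> UNIV"
    and "\<exists>k. k \<noteq> 0 \<and> (\<forall>x\<in>T. \<forall>y\<in>T. k * (x + y) \<in> T)"
    and "\<exists>k. k \<noteq> 0 \<and> (\<forall>x\<in>T. \<forall>y\<in>T. k * (x * y) \<in> T)"
    and "\<exists>k. k \<noteq> 0 \<and> (\<forall>x\<in>T. k * (- x) \<in> T)"
  shows "lb_set T"
proof -
  have 01: "0 \<in> T" "1 \<in> T" using T(1) unfolding vset_def by (metis inverse_zero, metis inverse_1)
  have "\<exists>c. c \<noteq> 0 \<and> c * x \<in> T \<and> c * y \<in> T" for x y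
  proof (cases "x = 0 \<or> y = 0")
    case True
    then show ?thesis
    proof
      assume "x = 0"
      then show ?thesis using 01 by (cases "y = 0") (auto intro: exI[of _ 1] exI[of _ "inverse y"])
    next
      assume "y = 0"
      then show ?thesis using 01 by (cases "x = 0") (auto intro: exI[of _ 1] exI[of _ "inverse x"])
    qed
  next
    case False
    then have "inverse (y * inverse x) = x * inverse y" by (simp add: field_simps)
    then consider "y * inverse x \<in> T" | "x * inverse y \<in> T" using T(1) unfolding vset_def by metis
    then show ?thesis
    proof cases
      case 1
      then show ?thesis using False 01 by (intro exI[of _ "inverse x"]) (auto simp: mult.commute)
    next
      case 2
      then show ?thesis using False 01 by (intro exI[of _ "inverse y"]) (auto simp: mult.commute)
    qed
  qed
  then show ?thesis using assms 01 unfolding lb_set_def by simp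
qed

lemma inverse_cancel:
  fixes k :: "'a::field"
  assumes "k \<noteq> 0"
  shows "c * inverse k * (k * z) = c * z" "k * (c * inverse k * z) = c * z"
  using assms by (simp_all add: field_simps)

text \<open>Absorbing \<open>inverse k\<close> and \<open>inverse l\<close>, which undo the separate
  constants, gives a common one. Its powers later measure the size of elements.\<close>

lemma lb_set_uniform:
  assumes B: "lb_set B"
  obtains e where "e \<noteq> 0" "\<And>x. x \<in> B \<Longrightarrow> e * x \<in> B"
    "\<And>x y. x \<in> B \<Longrightarrow> y \<in> B \<Longrightarrow> e * (x + y) \<in> B" "\<And>x y. x \<in> B \<Longrightarrow> y \<in> B \<Longrightarrow> e * (x * y) \<in> B"
proof -
  obtain k where k: "k \<noteq> 0" "\<And>x y. x \<in> B \<Longrightarrow> y \<in> B \<Longrightarrow> k * (x + y) \<in> B"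
    using lb_set_addE[OF B] by blast
  obtain l where l: "l \<noteq> 0" "\<And>x y. x \<in> B \<Longrightarrow> y \<in> B \<Longrightarrow> l * (x * y) \<in> B"
    using lb_set_multE[OF B] by blast
  have "finite {1, inverse k, inverse l}" by simp
  from lb_set_absorb[OF B this] obtain c where c: "c \<noteq> 0"
    "\<And>x b. x \<in> {1, inverse k, inverse l} \<Longrightarrow> b \<in> B \<Longrightarrow> c * x * b \<in> B" by metis
  show thesis
  proof (rule that[OF c(1)])
    show "c * x \<in> B" if "x \<in> B" for x using c(2)[of 1 x] that by simp
    show "c * (x + y) \<in> B" if "x \<in> B" "y \<in> B" for x y
    proof -
      have "c * inverse k * (k * (x + y)) \<in> B" by (rule c(2)[OF _ k(2)[OF that]]) simp
      then show ?thesis by (simp only: inverse_cancel[OF k(1)])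
    qed
    show "c * (x * y) \<in> B" if "x \<in> B" "y \<in> B" for x y
    proof -
      have "c * inverse l * (l * (x * y)) \<in> B" by (rule c(2)[OF _ l(2)[OF that]]) simp
      then show ?thesis by (simp only: inverse_cancel[OF l(1)])
    qed
  qed
qed

text \<open>V-topologies are minimal: comparable ones coincide. For \<open>p \<notin> T'\<close> the
  scalar \<open>a\<close> is chosen so that a failure \<open>inverse a * x \<notin> T\<close> would
  make \<open>k * (x * (c * (a / x)))\<close>, an element of \<open>T'\<close>, equal to
  \<open>p\<close>.\<close>

lemma vset_lb_le_sym:
  assumes T: "lb_set T" "vset T" and T': "lb_set T'" "vset T'" and le: "lb_le T T'"
  shows "lb_le T' T"
proof -
  obtain c where c: "c \<noteq> 0" "\<And>x. x \<in> T \<Longrightarrow> c * x \<in> T'" using le unfolding lb_le_def by auto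
  obtain k where k: "k \<noteq> 0" "\<And>x y. x \<in> T' \<Longrightarrow> y \<in> T' \<Longrightarrow> k * (x * y) \<in> T'"
    using lb_set_multE[OF T'(1)] by blast
  obtain p where p: "p \<notin> T'" using lb_set_proper[OF T'(1)] by auto
  define a where "a = p * inverse (k * c)"
  have p0: "p \<noteq> 0" using p lb_set_zero[OF T'(1)] by auto
  have a0: "a \<noteq> 0" using p0 k c by (simp add: a_def)
  have "inverse a * x \<in> T" if x: "x \<in> T'" for x
  proof (rule ccontr)
    assume nx: "inverse a * x \<notin> T"
    then have x0: "x \<noteq> 0" using lb_set_zero[OF T(1)] by auto
    from vsetD[OF T(2) nx] have "a * inverse x \<in> T" using a0 by simp
    from k(2)[OF x c(2)[OF this]] have "k * (x * (c * (a * inverse x))) \<in> T'" .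
    also have "k * (x * (c * (a * inverse x))) = p"
      using k(1) c(1) x0 by (simp add: a_def field_simps)
    finally show False using p by simp
  qed
  then show ?thesis unfolding lb_le_def using a0 by (intro exI[of _ "inverse a"]) simp
qed

lemma lb_set_topology_exists:
  assumes B: "lb_set B"
  obtains \<sigma> where "base_set \<sigma> B"
proof -
  define P where "P W \<longleftrightarrow> (\<forall>a\<in>W. \<exists>c. c \<noteq> 0 \<and> (\<forall>b\<in>B. a + c * b \<in> W))" for W
  have "P (S \<inter> W)" if S: "P S" and W: "P W" for S W
    unfolding P_def
  proof
    fix a assume a: "a \<in> S \<inter> W"
    obtain c where c: "c \<noteq> 0" "\<And>b. b \<in> B \<Longrightarrow> a + c * b \<in> S" using S a unfolding P_def by auto
    obtain c' where c': "c' \<noteq> 0" "\<And>b. b \<in> B \<Longrightarrow> a + c' * b \<in> W" using W a unfolding P_def by auto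
    \<comment> \<open>Absorbing \<open>inverse c\<close> and \<open>inverse c'\<close> gives a
      scaled copy of \<open>B\<close> inside both \<open>c * B\<close> and
      \<open>c' * B\<close>.\<close>
    have "finite {inverse c, inverse c'}" by simp
    from lb_set_absorb[OF B this] obtain d where d: "d \<noteq> 0"
      "\<And>x b. x \<in> {inverse c, inverse c'} \<Longrightarrow> b \<in> B \<Longrightarrow> d * x * b \<in> B" by metis
    have "a + d * b \<in> S \<inter> W" if b: "b \<in> B" for b
      using c(2)[OF d(2)[of "inverse c", OF _ b]] c'(2)[OF d(2)[of "inverse c'", OF _ b]]
      by (simp add: inverse_cancel[OF c(1)] inverse_cancel[OF c'(1)])
    then show "\<exists>c. c \<noteq> 0 \<and> (\<forall>b\<in>B. a + c * b \<in> S \<inter> W)" using d(1) by auto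
  qed
  moreover have "P (\<Union>\<K>)" if \<K>: "\<forall>K\<in>\<K>. P K" for \<K>
    unfolding P_def
  proof
    fix a assume "a \<in> \<Union>\<K>"
    then obtain K where K: "K \<in> \<K>" "a \<in> K" by auto
    then obtain c where "c \<noteq> 0" "\<And>b. b \<in> B \<Longrightarrow> a + c * b \<in> K" using \<K> unfolding P_def by metis
    then show "\<exists>c. c \<noteq> 0 \<and> (\<forall>b\<in>B. a + c * b \<in> \<Union>\<K>)" using K by (intro exI[of _ c]) auto
  qed
  ultimately have "istopology P" unfolding istopology_def by blast
  then have "base_set (topology P) B" unfolding base_set_def by (simp add: topology_inverse' P_def)
  then show thesis by (rule that)
qed

section \<open>Bounded sets of valuations and absolute values\<close>

lemma valuation_vset:
  assumes nv: "nontrivial_valuation G r v" and \<sigma>: "induced_by_valuation \<sigma> G r v"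
  obtains T where "lb_set T" "vset T" "base_set \<sigma> T"
proof -
  have val: "valuation G r v" and nontriv: "\<exists>x. x \<noteq> 0 \<and> v x \<noteq> \<one>\<^bsub>G\<^esub>"
    using nv unfolding nontrivial_valuation_def by auto
  have "comm_group G" and lin: "linear_order_on (carrier G) r"
    and mono: "\<And>a b c. a \<in> carrier G \<Longrightarrow> b \<in> carrier G \<Longrightarrow> c \<in> carrier G \<Longrightarrow> (a, b) \<in> r
        \<Longrightarrow> (a \<otimes>\<^bsub>G\<^esub> c, b \<otimes>\<^bsub>G\<^esub> c) \<in> r"
    and vc: "\<And>x. x \<noteq> 0 \<Longrightarrow> v x \<in> carrier G"
    and surj: "\<And>g. g \<in> carrier G \<Longrightarrow> \<exists>x. x \<noteq> 0 \<and> v x = g"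
    and vm: "\<And>x y. x \<noteq> 0 \<Longrightarrow> y \<noteq> 0 \<Longrightarrow> v (x * y) = v x \<otimes>\<^bsub>G\<^esub> v y"
    and va: "\<And>x y. x \<noteq> 0 \<Longrightarrow> y \<noteq> 0 \<Longrightarrow> x + y \<noteq> 0 \<Longrightarrow> (v x, v (x + y)) \<in> r \<or> (v y, v (x + y)) \<in> r"
    using val unfolding valuation_def ordered_ab_group_def by auto
  interpret comm_group G by fact
  have trans: "(a, c) \<in> r" if "(a, b) \<in> r" "(b, c) \<in> r" for a b c
    using lin that unfolding linear_order_on_def partial_order_on_def preorder_on_def trans_def by blast
  have anti: "a = b" if "(a, b) \<in> r" "(b, a) \<in> r" for a b
    using lin that unfolding linear_order_on_def partial_order_on_def antisym_def by blast
  have total: "(a, b) \<in> r \<or> (b, a) \<in> r" if "a \<in> carrier G" "b \<in> carrier G" for a b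
    using lin that unfolding linear_order_on_def partial_order_on_def preorder_on_def total_on_def refl_on_def
    by metis
  have v1: "v 1 = \<one>\<^bsub>G\<^esub>"
    using vm[of 1 1] vc[of 1] by (metis l_cancel_one mult_1 one_neq_zero)
  have vinv: "v x \<otimes>\<^bsub>G\<^esub> v (inverse x) = \<one>\<^bsub>G\<^esub>" if "x \<noteq> 0" for x
    using vm[of x "inverse x"] v1 that by simp
  \<comment> \<open>The valuation ring. Since \<open>v\<close> is constrained only at nonzero
    arguments, 0 is put in by hand; in the additive ordering, integral elements are those of value
    at least that of 1.\<close>
  define T where "T = {x. x = 0 \<or> (\<one>\<^bsub>G\<^esub>, v x) \<in> r}"
  have quot: "(v c, v y) \<in> r \<longleftrightarrow> inverse c * y \<in> T" if "c \<noteq> 0" "y \<noteq> 0" for c y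
  proof
    assume "(v c, v y) \<in> r"
    from mono[OF _ _ _ this, of "v (inverse c)"] show "inverse c * y \<in> T"
      using that vinv[of c] vm[of y "inverse c"] vc by (simp add: T_def mult.commute)
  next
    assume "inverse c * y \<in> T"
    then have "(\<one>\<^bsub>G\<^esub>, v (inverse c * y)) \<in> r" using that by (simp add: T_def)
    moreover have cy: "inverse c * y * c = y" using that by simp
    have "v (inverse c * y) \<otimes>\<^bsub>G\<^esub> v c = v (inverse c * y * c)"
      by (rule vm[symmetric]) (use that in auto)
    then have "v (inverse c * y) \<otimes>\<^bsub>G\<^esub> v c = v y" unfolding cy .
    ultimately show "(v c, v y) \<in> r"
      using that mono[of "\<one>\<^bsub>G\<^esub>" "v (inverse c * y)" "v c"] vc[of "inverse c * y"] vc[of c] by simp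
  qed
  have vT: "vset T" unfolding vset_def
  proof
    fix x show "x \<in> T \<or> inverse x \<in> T"
    proof (cases "x = 0")
      case False
      then have "(v 1, v x) \<in> r \<or> (v x, v 1) \<in> r" using total[of "v 1" "v x"] vc by simp
      then show ?thesis using quot[of 1 x] quot[of x 1] False by auto
    qed (simp add: T_def)
  qed
  have Tm: "x * y \<in> T" if "x \<in> T" "y \<in> T" for x y
  proof (cases "x = 0 \<or> y = 0")
    case False
    then have "(\<one>\<^bsub>G\<^esub>, v x) \<in> r" "(\<one>\<^bsub>G\<^esub>, v y) \<in> r" using that by (auto simp: T_def)
    moreover from mono[OF _ _ _ this(1), of "v y"] have "(v y, v (x * y)) \<in> r"
      using False vc vm[of x y] by simp
    ultimately have "(\<one>\<^bsub>G\<^esub>, v (x * y)) \<in> r" using trans by metis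
    then show ?thesis by (simp add: T_def)
  qed (auto simp: T_def)
  have Ta: "x + y \<in> T" if "x \<in> T" "y \<in> T" for x y
  proof (cases "x = 0 \<or> y = 0 \<or> x + y = 0")
    case False
    then have "(\<one>\<^bsub>G\<^esub>, v x) \<in> r" "(\<one>\<^bsub>G\<^esub>, v y) \<in> r" using that by (auto simp: T_def)
    then have "(\<one>\<^bsub>G\<^esub>, v (x + y)) \<in> r" 
    proof -
      from False have "(v x, v (x + y)) \<in> r \<or> (v y, v (x + y)) \<in> r" by (intro va) auto
      then show ?thesis using trans[OF \<open>(\<one>\<^bsub>G\<^esub>, v x) \<in> r\<close>] trans[OF \<open>(\<one>\<^bsub>G\<^esub>, v y) \<in> r\<close>] by auto
    qed
    then show ?thesis by (simp add: T_def)
  qed (use that in \<open>auto simp: T_def\<close>)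
  have "- 1 \<in> T" using vsetD[OF vT, of "- 1"] by (auto simp: inverse_minus_eq)
  then have Tn: "- x \<in> T" if "x \<in> T" for x using Tm[of "- 1" x] that by simp
  have "T \<noteq> UNIV"
  proof
    assume T: "T = UNIV"
    obtain x where x: "x \<noteq> 0" "v x \<noteq> \<one>\<^bsub>G\<^esub>" using nontriv by auto
    have "(v x, v 1) \<in> r" "(v 1, v x) \<in> r" using quot[of x 1] quot[of 1 x] x(1) T by auto
    then show False using anti x v1 by metis
  qed
  then have "lb_set T"
    using vT Ta Tm Tn by (intro lb_set_vsetI) (auto intro!: exI[of _ 1])
  moreover have "base_set \<sigma> T"
    unfolding base_set_def
  proof
    fix U
    have "(\<exists>g\<in>carrier G. \<forall>y. y \<noteq> a \<longrightarrow> (g, v (y - a)) \<in> r \<longrightarrow> y \<in> U)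
        \<longleftrightarrow> (\<exists>c. c \<noteq> 0 \<and> (\<forall>b\<in>T. a + c * b \<in> U))" if a: "a \<in> U" for a
    proof
      assume "\<exists>g\<in>carrier G. \<forall>y. y \<noteq> a \<longrightarrow> (g, v (y - a)) \<in> r \<longrightarrow> y \<in> U"
      then obtain g where g: "g \<in> carrier G" "\<And>y. y \<noteq> a \<Longrightarrow> (g, v (y - a)) \<in> r \<Longrightarrow> y \<in> U" by auto
      obtain c where c: "c \<noteq> 0" "v c = g" using surj[OF g(1)] by auto
      have "a + c * b \<in> U" if "b \<in> T" for b
      proof (cases "b = 0")
        case False
        then show ?thesis using g(2)[of "a + c * b"] quot[of c "c * b"] c that
          by (simp flip: mult.assoc)
      qed (simp add: a)
      then show "\<exists>c. c \<noteq> 0 \<and> (\<forall>b\<in>T. a + c * b \<in> U)" using c by auto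
    next
      assume "\<exists>c. c \<noteq> 0 \<and> (\<forall>b\<in>T. a + c * b \<in> U)"
      then obtain c where c: "c \<noteq> 0" "\<And>b. b \<in> T \<Longrightarrow> a + c * b \<in> U" by auto
      show "\<exists>g\<in>carrier G. \<forall>y. y \<noteq> a \<longrightarrow> (g, v (y - a)) \<in> r \<longrightarrow> y \<in> U"
      proof (intro bexI[of _ "v c"] allI impI)
        fix y assume "y \<noteq> a" "(v c, v (y - a)) \<in> r"
        then have "inverse c * (y - a) \<in> T" using quot[of c "y - a"] c(1) by simp
        from c(2)[OF this] c(1) show "y \<in> U" by (simp flip: mult.assoc)
      qed (use vc c in auto)
    qed
    then show "openin \<sigma> U \<longleftrightarrow> (\<forall>a\<in>U. \<exists>c. c \<noteq> 0 \<and> (\<forall>b\<in>T. a + c * b \<in> U))"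
      using \<sigma> unfolding induced_by_valuation_def by simp
  qed
  ultimately show thesis using vT that by blast
qed

lemma absolute_value_vset:
  assumes "nontrivial_absolute_value f"
  shows "lb_set {x. f x \<le> 1}" "vset {x. f x \<le> 1}"
    "base_set (Metric_space.mtopology UNIV (\<lambda>x y. f (x - y))) {x. f x \<le> 1}"
proof -
  have f0: "\<And>x. 0 \<le> f x" and fz: "\<And>x. f x = 0 \<longleftrightarrow> x = 0" and fm: "\<And>x y. f (x * y) = f x * f y"
    and fa: "\<And>x y. f (x + y) \<le> f x + f y" and "\<exists>x. x \<noteq> 0 \<and> f x \<noteq> 1"
    using assms unfolding nontrivial_absolute_value_def by auto
  have f1: "f 1 = 1" using fm[of 1 1] fz[of 1] by simp
  have finv: "f (inverse x) = inverse (f x)" for x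
  proof (cases "x = 0")
    case False
    then have "f x * f (inverse x) = 1" using fm[of x "inverse x"] f1 by simp
    then show ?thesis by (metis inverse_unique)
  qed (use fz[of 0] in simp)
  have "f (- 1) * f (- 1) = f (- 1 * - 1)" by (rule fm[symmetric])
  then have "f (- 1) * f (- 1) = 1" by (simp add: f1)
  then have "f (- 1) = 1" using f0[of "- 1"] by (metis abs_of_nonneg abs_square_eq_1 power2_eq_square)
  then have fneg: "f (- x) = f x" for x using fm[of "- 1" x] by simp
  have fpow: "f (x ^ n) = f x ^ n" for x n by (induction n) (auto simp: f1 fm)
  obtain x where x: "x \<noteq> 0" "f x \<noteq> 1" using \<open>\<exists>x. x \<noteq> 0 \<and> f x \<noteq> 1\<close> by auto
  obtain d where d: "f d > 1"
  proof (cases "f x > 1")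
    case False
    then have "f x < 1" "f x > 0" using x fz[of x] f0[of x] by auto
    then have "f (inverse x) > 1" by (simp add: finv one_less_inverse)
    then show ?thesis by (rule that)
  qed (rule that)
  have d0: "d \<noteq> 0" using d fz[of d] by auto
  have small: "\<exists>c. c \<noteq> 0 \<and> f c < r" if "r > 0" for r
  proof -
    obtain n where n: "f d ^ n > inverse r" using real_arch_pow[OF d] by blast
    then have "inverse (f d ^ n) < r" using that
      by (metis inverse_inverse_eq inverse_less_imp_less inverse_positive_iff_positive less_imp_inverse_less)
    then show ?thesis using d0 by (intro exI[of _ "inverse (d ^ n)"]) (simp add: finv fpow)
  qed
  show v: "vset {x. f x \<le> 1}"
  proof (unfold vset_def, intro allI)
    fix x show "x \<in> {x. f x \<le> 1} \<or> inverse x \<in> {x. f x \<le> 1}"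
      using f0[of x] by (auto simp: finv inverse_le_1_iff not_le)
  qed
  show "lb_set {x. f x \<le> 1}"
  proof (rule lb_set_vsetI[OF v])
    show "{x. f x \<le> 1} \<noteq> UNIV" using d by (metis UNIV_I mem_Collect_eq not_le)
    \<comment> \<open>For an archimedean absolute value the unit ball is not closed under addition;
      a scalar of absolute value below 1/2 absorbs the doubling.\<close>
    obtain c where c: "c \<noteq> 0" "f c < 1/2" using small[of "1/2"] by auto
    have "f (c * (x + y)) \<le> 1" if "f x \<le> 1" "f y \<le> 1" for x y
    proof -
      have "f (c * (x + y)) \<le> 1/2 * 2"
        unfolding fm using c(2) fa[of x y] that f0 by (intro mult_mono) auto
      then show ?thesis by simp
    qed
    then show "\<exists>k. k \<noteq> 0 \<and> (\<forall>x\<in>{x. f x \<le> 1}. \<forall>y\<in>{x. f x \<le> 1}. k * (x + y) \<in> {x. f x \<le> 1})"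
      using c(1) by auto
    show "\<exists>k. k \<noteq> 0 \<and> (\<forall>x\<in>{x. f x \<le> 1}. \<forall>y\<in>{x. f x \<le> 1}. k * (x * y) \<in> {x. f x \<le> 1})"
      using f0 by (intro exI[of _ 1]) (auto simp: f1 fm mult_le_one)
    show "\<exists>k. k \<noteq> 0 \<and> (\<forall>x\<in>{x. f x \<le> 1}. k * (- x) \<in> {x. f x \<le> 1})"
      by (intro exI[of _ 1]) (auto simp: f1 fneg)
  qed
  interpret Metric_space UNIV "\<lambda>x y. f (x - y)"
  proof
    show "0 \<le> f (x - y)" for x y by (rule f0)
    show "f (x - y) = f (y - x)" for x y using fneg[of "x - y"] by simp
    show "f (x - y) = 0 \<longleftrightarrow> x = y" for x y by (simp add: fz)
    show "f (x - z) \<le> f (x - y) + f (y - z)" for x y z using fa[of "x - y" "y - z"] by simp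
  qed
  show "base_set mtopology {x. f x \<le> 1}"
    unfolding base_set_def
  proof
    fix U
    have "(\<exists>r>0. mball a r \<subseteq> U) \<longleftrightarrow> (\<exists>c. c \<noteq> 0 \<and> (\<forall>b\<in>{x. f x \<le> 1}. a + c * b \<in> U))" for a
    proof
      assume "\<exists>r>0. mball a r \<subseteq> U"
      then obtain r where r: "r > 0" "mball a r \<subseteq> U" by auto
      obtain c where c: "c \<noteq> 0" "f c < r" using small[OF r(1)] by auto
      have "a + c * b \<in> U" if "f b \<le> 1" for b
      proof -
        have "f (c * b) \<le> f c" using that f0[of c] by (simp add: fm mult_left_le)
        then have "f (a - (a + c * b)) < r" using c fneg[of "c * b"] by simp
        then show ?thesis using r by (auto simp: in_mball)
      qed
      then show "\<exists>c. c \<noteq> 0 \<and> (\<forall>b\<in>{x. f x \<le> 1}. a + c * b \<in> U)" using c by auto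
    next
      assume "\<exists>c. c \<noteq> 0 \<and> (\<forall>b\<in>{x. f x \<le> 1}. a + c * b \<in> U)"
      then obtain c where c: "c \<noteq> 0" "\<And>b. f b \<le> 1 \<Longrightarrow> a + c * b \<in> U" by auto
      have fc: "f c > 0" using c(1) f0[of c] fz[of c] by simp
      have "mball a (f c) \<subseteq> U"
      proof
        fix y assume "y \<in> mball a (f c)"
        then have "f (y - a) < f c" using fneg[of "a - y"] by (simp add: in_mball)
        moreover have "f (inverse c * (y - a)) = inverse (f c) * f (y - a)" by (simp only: fm finv)
        moreover have "inverse (f c) * f (y - a) \<le> 1 \<longleftrightarrow> f (y - a) \<le> f c"
          using fc by (simp add: field_simps)
        ultimately have "f (inverse c * (y - a)) \<le> 1" by linarith
        from c(2)[OF this] c(1) show "y \<in> U" by (simp flip: mult.assoc)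
      qed
      then show "\<exists>r>0. mball a r \<subseteq> U" using fc by auto
    qed
    then show "openin mtopology U \<longleftrightarrow> (\<forall>a\<in>U. \<exists>c. c \<noteq> 0 \<and> (\<forall>b\<in>{x. f x \<le> 1}. a + c * b \<in> U))"
      by (auto simp: openin_mtopology)
  qed
qed

lemma V_topology_vset:
  assumes "V_topology \<sigma>"
  obtains T where "lb_set T" "vset T" "base_set \<sigma> T"
  using assms unfolding V_topology_def
proof (elim disjE exE conjE)
  fix G :: "'a set monoid" and r v
  assume "nontrivial_valuation G r v" "induced_by_valuation \<sigma> G r v"
  then show thesis using valuation_vset that by blast
next
  fix f assume "nontrivial_absolute_value f" "\<sigma> = Metric_space.mtopology UNIV (\<lambda>x y. f (x - y))"
  then show thesis using absolute_value_vset[of f] that by blast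
qed

section \<open>From bounded sets back to valuations and absolute values\<close>

lemma quasimorphism_homogenize:
  fixes g :: "'a::field \<Rightarrow> real"
  assumes g: "\<And>x y. x \<noteq> 0 \<Longrightarrow> y \<noteq> 0 \<Longrightarrow> \<bar>g (x * y) - g x - g y\<bar> \<le> C"
  obtains h where "\<And>x. x \<noteq> 0 \<Longrightarrow> \<bar>h x - g x\<bar> \<le> C"
    "\<And>x y. x \<noteq> 0 \<Longrightarrow> y \<noteq> 0 \<Longrightarrow> h (x * y) = h x + h y"
proof -
  \<comment> \<open>Values of \<open>g\<close> at powers, divided by the exponent; \<open>h\<close>
    is their limit. Division makes the defect \<open>C\<close> tend to 0, and since \<open>x\<close>
    and \<open>y\<close> commute, the defect of the pair of powers is what remains in the limit, so
    \<open>h\<close> is additive. The index \<open>Suc n\<close> avoids division by 0.\<close>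
  define a where "a x n = g (x ^ Suc n) / real (Suc n)" for x n
  have pow: "\<bar>g (x ^ Suc n) - real (Suc n) * g x\<bar> \<le> real (Suc n) * C" if x: "x \<noteq> 0" for x n
  proof (induction n)
    case 0
    have "C \<ge> 0" using g[OF x x] by linarith
    then show ?case by simp
  next
    case (Suc n)
    have "\<bar>g (x * x ^ Suc n) - g x - g (x ^ Suc n)\<bar> \<le> C" using g[of x "x ^ Suc n"] x by simp
    then show ?case using Suc by (simp add: algebra_simps abs_le_iff)
  qed
  have ag: "\<bar>a x n - g x\<bar> \<le> C" if x: "x \<noteq> 0" for x n
  proof -
    have "a x n - g x = (g (x ^ Suc n) - real (Suc n) * g x) / real (Suc n)"
      unfolding a_def diff_divide_distrib by simp
    then have "\<bar>a x n - g x\<bar> = \<bar>g (x ^ Suc n) - real (Suc n) * g x\<bar> / real (Suc n)"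
      by (simp add: abs_divide)
    also have "\<dots> \<le> real (Suc n) * C / real (Suc n)" by (intro divide_right_mono pow[OF x]) simp
    also have "\<dots> = C" by simp
    finally show ?thesis .
  qed
  \<comment> \<open>Compares the quotient for one exponent with that for the product of two
    exponents; two such comparisons bound the distance of any two quotients.\<close>
  have close: "\<bar>g (x ^ (Suc m * Suc n)) / real (Suc m * Suc n) - a x n\<bar> \<le> C / real (Suc n)"
    if x: "x \<noteq> 0" for x m n
  proof -
    have "\<bar>a (x ^ Suc n) m - g (x ^ Suc n)\<bar> / real (Suc n) \<le> C / real (Suc n)"
      using ag[of "x ^ Suc n" m] x by (intro divide_right_mono) auto
    moreover have "g (x ^ (Suc m * Suc n)) / real (Suc m * Suc n) - a x n
        = (a (x ^ Suc n) m - g (x ^ Suc n)) / real (Suc n)"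
    proof -
      have "(x ^ Suc n) ^ Suc m = x ^ (Suc m * Suc n)" by (simp only: power_mult[symmetric] mult.commute)
      then show ?thesis by (simp only: a_def diff_divide_distrib divide_divide_eq_left of_nat_mult)
    qed
    ultimately show ?thesis by (simp only: abs_divide)
  qed
  have cauchy: "\<bar>a x m - a x n\<bar> \<le> C / real (Suc m) + C / real (Suc n)" if x: "x \<noteq> 0" for x m n
    using close[OF x, of m n] close[OF x, of n m] by (simp only: mult.commute[of "Suc n"])
  have conv: "convergent (a x)" if x: "x \<noteq> 0" for x
  proof (rule Cauchy_convergent, rule metric_CauchyI)
    fix e :: real assume e: "e > 0"
    have C: "C \<ge> 0" using g[OF x x] by linarith
    obtain N where N: "real (Suc N) > 2 * (C + 1) / e" using reals_Archimedean2[of "2 * (C + 1) / e"]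
      by (metis less_Suc_eq of_nat_less_iff order_less_trans)
    have "C / real (Suc n) < e / 2" if "n \<ge> N" for n
    proof -
      have "2 * (C + 1) < e * real (Suc N)" using N e by (simp add: field_simps)
      also have "\<dots> \<le> e * real (Suc n)" using that e by (intro mult_left_mono) auto
      finally show ?thesis using C by (simp add: field_simps)
    qed
    then have "C / real (Suc m) + C / real (Suc n) < e" if "m \<ge> N" "n \<ge> N" for m n
      using that by (smt (verit) field_sum_of_halves)
    then have "dist (a x m) (a x n) < e" if "m \<ge> N" "n \<ge> N" for m n
      unfolding dist_real_def using cauchy[OF x, of m n] that by (meson le_less_trans)
    then show "\<exists>M. \<forall>m\<ge>M. \<forall>n\<ge>M. dist (a x m) (a x n) < e" by blast
  qed
  define h where "h x = lim (a x)" for x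
  have lim: "a x \<longlonglongrightarrow> h x" if "x \<noteq> 0" for x
    using conv[OF that] by (simp add: h_def convergent_LIMSEQ_iff)
  show thesis
  proof (rule that)
    fix x :: 'a assume x: "x \<noteq> 0"
    have "(\<lambda>n. \<bar>a x n - g x\<bar>) \<longlonglongrightarrow> \<bar>h x - g x\<bar>" by (intro tendsto_intros lim x)
    then show "\<bar>h x - g x\<bar> \<le> C"
      by (rule LIMSEQ_le_const2) (use ag[OF x] in auto)
  next
    fix x y :: 'a assume x: "x \<noteq> 0" and y: "y \<noteq> 0"
    have "(\<lambda>n. a (x * y) n - a x n - a y n) \<longlonglongrightarrow> h (x * y) - h x - h y"
      by (intro tendsto_intros lim) (use x y in auto)
    moreover have "(\<lambda>n. a (x * y) n - a x n - a y n) \<longlonglongrightarrow> 0"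
    proof (rule Lim_null_comparison)
      have "\<bar>a (x * y) n - a x n - a y n\<bar> \<le> C / real (Suc n)" for n
      proof -
        have "\<bar>g (x ^ Suc n * y ^ Suc n) - g (x ^ Suc n) - g (y ^ Suc n)\<bar> / real (Suc n) \<le> C / real (Suc n)"
          using x y by (intro divide_right_mono g) auto
        moreover have "a (x * y) n - a x n - a y n
            = (g (x ^ Suc n * y ^ Suc n) - g (x ^ Suc n) - g (y ^ Suc n)) / real (Suc n)"
          by (simp only: a_def diff_divide_distrib power_mult_distrib)
        ultimately show ?thesis by (simp only: abs_divide abs_of_nat)
      qed
      then show "\<forall>\<^sub>F n in sequentially. norm (a (x * y) n - a x n - a y n) \<le> C / real (Suc n)"
        by (simp only: real_norm_def eventually_True)
      show "(\<lambda>n. C / real (Suc n)) \<longlonglongrightarrow> 0" by (rule LIMSEQ_Suc[OF lim_const_over_n])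
    qed
    ultimately have "h (x * y) - h x - h y = 0" by (rule LIMSEQ_unique)
    then show "h (x * y) = h x + h y" by simp
  qed
qed

text \<open>Artin's argument. The constant 2 propagates to the bound \<open>2 ^ k * M\<close> for
  sums of \<open>2 ^ k\<close> terms, hence to a bound linear in the number of terms. Applied to the
  binomial expansion of \<open>(x + y) ^ n\<close>, it leaves a factor linear in \<open>n\<close>,
  which cannot keep up with geometric growth.\<close>

lemma absolute_value_triangle:
  fixes f :: "'a::field \<Rightarrow> real"
  assumes f0: "\<And>x. 0 \<le> f x" and f1: "f 1 = 1" and fm: "\<And>x y. f (x * y) = f x * f y"
    and f2: "\<And>x y. f (x + y) \<le> 2 * max (f x) (f y)" and fz: "f 0 = 0"
  shows "f (x + y) \<le> f x + f y"
proof -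
  have pow2: "f (\<Sum>i<2 ^ k. a i) \<le> 2 ^ k * M" if M: "\<And>i. f (a i) \<le> M" for k M and a :: "nat \<Rightarrow> 'a"
    using M
  proof (induction k arbitrary: a)
    case (Suc k)
    have "(\<Sum>i<2 ^ Suc k. a i) = (\<Sum>i<2 ^ k. a i) + (\<Sum>i<2 ^ k. a (i + 2 ^ k))"
    proof -
      have "(\<Sum>i<m + n. a i) = (\<Sum>i<m. a i) + (\<Sum>i<n. a (i + m))" for m n
        by (induction n) (simp_all add: ac_simps)
      from this[of "2 ^ k" "2 ^ k"] show ?thesis by (simp add: mult_2)
    qed
    then have "f (\<Sum>i<2 ^ Suc k. a i) \<le> 2 * max (f (\<Sum>i<2 ^ k. a i)) (f (\<Sum>i<2 ^ k. a (i + 2 ^ k)))"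
      using f2 by simp
    also have "\<dots> \<le> 2 * (2 ^ k * M)" using Suc.IH[of a] Suc.IH[of "\<lambda>i. a (i + 2 ^ k)"] Suc.prems by simp
    finally show ?case by simp
  qed simp
  have sum: "f (\<Sum>i<Suc n. a i) \<le> 2 * real (Suc n) * M"
    if M: "\<And>i. i < Suc n \<Longrightarrow> f (a i) \<le> M" for n a M
  proof -
    have M0: "M \<ge> 0" using f0[of "a 0"] M[of 0] by simp
    \<comment> \<open>The least power of 2 reaching the number of terms is at most twice that
      number; the sum is padded with zeros.\<close>
    define k where "k = (LEAST k. Suc n \<le> 2 ^ k)"
    have k: "Suc n \<le> 2 ^ k" unfolding k_def by (rule LeastI[of _ "Suc n"], rule less_imp_le[OF less_exp])
    have k': "2 ^ k \<le> 2 * Suc n"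
    proof (cases k)
      case (Suc j)
      then have "\<not> Suc n \<le> 2 ^ j" using not_less_Least[of j "\<lambda>k. Suc n \<le> 2 ^ k"] by (simp add: k_def)
      then show ?thesis using Suc by simp
    qed simp
    define b where "b i = (if i < Suc n then a i else 0)" for i
    have "(\<Sum>i<2 ^ k. b i) = (\<Sum>i<Suc n. a i)"
      unfolding b_def using k by (subst sum.mono_neutral_right[of _ "{..<Suc n}"]) auto
    moreover have "f (\<Sum>i<2 ^ k. b i) \<le> 2 ^ k * M"
      by (rule pow2) (use M M0 fz in \<open>auto simp: b_def\<close>)
    moreover have "2 ^ k * M \<le> 2 * real (Suc n) * M"
    proof (rule mult_right_mono[OF _ M0])
      have "real (2 ^ k) \<le> real (2 * Suc n)" using k' by (simp only: of_nat_le_iff)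
      then show "2 ^ k \<le> 2 * real (Suc n)" by simp
    qed
    ultimately show ?thesis by (metis order_trans)
  qed
  have fnat: "f (of_nat m) \<le> 2 * real m" for m
  proof (cases m)
    case (Suc n)
    then show ?thesis using sum[of n "\<lambda>_. 1" 1] f1 by (simp del: sum.lessThan_Suc)
  qed (simp add: fz)
  have fpow: "f (z ^ n) = f z ^ n" for z n by (induction n) (auto simp: f1 fm)
  define b where "b = f x + f y"
  have b0: "b \<ge> 0" using f0 by (simp add: b_def)
  \<comment> \<open>The 4 is a product of two 2s: one from bounding a sum by its largest term, one
    from \<open>f\<close> of a binomial coefficient being at most twice the coefficient.\<close>
  have main: "f (x + y) ^ n \<le> 4 * real (Suc n) * b ^ n" for n
  proof -
    have summand: "f (of_nat (n choose i) * x ^ i * y ^ (n - i)) \<le> 2 * b ^ n" if "i \<le> n" for i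
    proof -
      have "f (of_nat (n choose i) * x ^ i * y ^ (n - i)) \<le> 2 * real (n choose i) * f x ^ i * f y ^ (n - i)"
        unfolding fm fpow using fnat f0 by (intro mult_right_mono) auto
      also have "\<dots> = 2 * (real (n choose i) * f x ^ i * f y ^ (n - i))" by simp
      also have "\<dots> \<le> 2 * (\<Sum>i\<le>n. real (n choose i) * f x ^ i * f y ^ (n - i))"
        using f0 that by (intro mult_left_mono member_le_sum) auto
      also have "\<dots> = 2 * b ^ n" by (simp add: b_def binomial_ring)
      finally show ?thesis .
    qed
    have "f (x + y) ^ n = f (\<Sum>i<Suc n. of_nat (n choose i) * x ^ i * y ^ (n - i))"
      by (simp only: fpow[symmetric] binomial_ring lessThan_Suc_atMost)
    also have "\<dots> \<le> 2 * real (Suc n) * (2 * b ^ n)" by (rule sum) (rule summand, simp)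
    finally show ?thesis by (simp add: algebra_simps)
  qed
  show ?thesis
  proof (cases "b = 0")
    case True
    then have "f (x + y) \<le> 0" using main[of 1] by simp
    then show ?thesis using b0 b_def by linarith
  next
    case False
    then have bp: "b > 0" using b0 by simp
    define q where "q = f (x + y) / b"
    have q: "q ^ n \<le> 4 * real (Suc n)" for n
      using main[of n] bp by (simp add: q_def power_divide divide_le_eq)
    have "q \<le> 1"
    proof (rule ccontr)
      assume "\<not> q \<le> 1"
      then have q1: "1 < q" by simp
      have "(\<lambda>n. real n * inverse q ^ n) \<longlonglongrightarrow> 0"
        by (rule powser_times_n_limit_0) (use q1 in \<open>auto simp: inverse_less_1_iff\<close>)
      moreover have "(\<lambda>n. inverse q ^ n) \<longlonglongrightarrow> 0"
        by (rule LIMSEQ_power_zero) (use q1 in \<open>auto simp: inverse_less_1_iff\<close>)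
      ultimately have "(\<lambda>n. 4 * (real n * inverse q ^ n + inverse q ^ n)) \<longlonglongrightarrow> 4 * (0 + 0)"
        by (intro tendsto_mult tendsto_add tendsto_const)
      then have "(\<lambda>n. 4 * real (Suc n) * inverse q ^ n) \<longlonglongrightarrow> 0" by (simp add: algebra_simps)
      moreover have "4 * real (Suc n) * inverse q ^ n \<ge> 1" for n
        using q[of n] q1 by (simp add: field_simps power_inverse)
      ultimately have "(0::real) \<ge> 1" by (intro LIMSEQ_le_const) auto
      then show False by simp
    qed
    then show ?thesis using bp by (simp add: q_def b_def field_simps)
  qed
qed

text \<open>The valuation is the quotient map from the nonzero elements to the cosets of the unit
  group \<open>U\<close>. Cosets are subsets of the field, so the value group lives on the required
  type \<open>'a set\<close>; \<open>X\<close> lies below \<open>Y\<close> when a representative of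
  \<open>Y\<close> is an \<open>A\<close>-multiple of one of \<open>X\<close>.\<close>

lemma valuation_ring_V_topology:
  fixes A :: "'a::field set"
  assumes A: "vset A" "A \<noteq> UNIV" and Aa: "\<And>x y. x \<in> A \<Longrightarrow> y \<in> A \<Longrightarrow> x + y \<in> A"
    and Am: "\<And>x y. x \<in> A \<Longrightarrow> y \<in> A \<Longrightarrow> x * y \<in> A" and \<sigma>: "base_set \<sigma> A"
  shows "V_topology \<sigma>"
proof -
  have one: "1 \<in> A" using A(1) unfolding vset_def by (metis inverse_1)
  define U where "U = {u. u \<noteq> 0 \<and> u \<in> A \<and> inverse u \<in> A}"
  define coset where "coset x = (\<lambda>u. x * u) ` U" for x
  define G :: "'a set monoid" where
    "G = \<lparr>carrier = coset ` {x. x \<noteq> 0}, mult = (\<lambda>A B. (\<lambda>(a, b). a * b) ` (A \<times> B)), one = U\<rparr>"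
  define r where "r = {(coset x, coset y) | x y. x \<noteq> 0 \<and> y \<noteq> 0 \<and> y * inverse x \<in> A}"
  have U1: "1 \<in> U" using one by (simp add: U_def)
  have Um: "u * w \<in> U" if "u \<in> U" "w \<in> U" for u w using that Am by (auto simp: U_def)
  have Ui: "inverse u \<in> U" if "u \<in> U" for u using that by (auto simp: U_def)
  have coset_mem: "x \<in> coset x" for x unfolding coset_def using U1 by force
  have coset_unit: "coset (x * u) = coset x" if u: "u \<in> U" for x u
  proof
    show "coset (x * u) \<subseteq> coset x" using Um u by (auto simp: coset_def mult.assoc)
    show "coset x \<subseteq> coset (x * u)"
    proof
      fix z assume "z \<in> coset x"
      then obtain w where w: "w \<in> U" "z = x * w" by (auto simp: coset_def)
      then have "z = x * u * (inverse u * w)" using u by (simp add: U_def)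
      moreover have "inverse u * w \<in> U" using Um Ui u w by blast
      ultimately show "z \<in> coset (x * u)" unfolding coset_def by blast
    qed
  qed
  have coset_eq: "coset x = coset y \<longleftrightarrow> y * inverse x \<in> U" if x: "x \<noteq> 0" for x y
  proof
    assume "coset x = coset y"
    then have "y \<in> coset x" using coset_mem by simp
    then obtain u where "u \<in> U" "y = x * u" by (auto simp: coset_def)
    moreover from this(2) have "y * inverse x = u" using x by (simp add: field_simps)
    ultimately show "y * inverse x \<in> U" by metis
  next
    assume u: "y * inverse x \<in> U"
    have yx: "x * (y * inverse x) = y" using x by (simp add: field_simps)
    show "coset x = coset y" using coset_unit[OF u, of x] unfolding yx by (rule sym)
  qed
  \<comment> \<open>The definition of \<open>r\<close> asks for some representatives; changing them
    multiplies the quotient by units of \<open>A\<close>.\<close>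
  have r_iff: "(coset x, coset y) \<in> r \<longleftrightarrow> y * inverse x \<in> A" if x: "x \<noteq> 0" and y: "y \<noteq> 0" for x y
  proof
    assume "(coset x, coset y) \<in> r"
    then obtain x' y' where eq: "coset x = coset x'" "coset y = coset y'"
      and x': "x' \<noteq> 0" and y': "y' \<noteq> 0" and le: "y' * inverse x' \<in> A"
      unfolding r_def by blast
    have "x' * inverse x \<in> A" using eq(1) coset_eq[OF x, of x'] by (simp add: U_def)
    moreover have "y * inverse y' \<in> A" using eq(2) coset_eq[OF y', of y] by (simp add: U_def)
    ultimately have "y * inverse y' * (y' * inverse x' * (x' * inverse x)) \<in> A" using le Am by simp
    also have "y * inverse y' * (y' * inverse x' * (x' * inverse x)) = y * inverse x"
      using x y x' y' by (simp add: field_simps)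
    finally show "y * inverse x \<in> A" .
  next
    assume "y * inverse x \<in> A"
    then show "(coset x, coset y) \<in> r" unfolding r_def using x y by blast
  qed
  have mult_coset: "coset x \<otimes>\<^bsub>G\<^esub> coset y = coset (x * y)" for x y
  proof
    show "coset x \<otimes>\<^bsub>G\<^esub> coset y \<subseteq> coset (x * y)"
    proof
      fix z assume "z \<in> coset x \<otimes>\<^bsub>G\<^esub> coset y"
      then obtain u w where uw: "u \<in> U" "w \<in> U" "z = x * u * (y * w)" by (auto simp: G_def coset_def)
      then have "z = x * y * (u * w)" by (simp add: mult_ac)
      then show "z \<in> coset (x * y)" unfolding coset_def using Um[OF uw(1,2)] by blast
    qed
    show "coset (x * y) \<subseteq> coset x \<otimes>\<^bsub>G\<^esub> coset y"
    proof
      fix z assume "z \<in> coset (x * y)"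
      then obtain u where u: "u \<in> U" "z = x * (y * u)" by (auto simp: coset_def mult.assoc)
      then have "(x, y * u) \<in> coset x \<times> coset y" using coset_mem by (auto simp: coset_def)
      then have "(\<lambda>(a, b). a * b) (x, y * u) \<in> coset x \<otimes>\<^bsub>G\<^esub> coset y" unfolding G_def by auto
      then show "z \<in> coset x \<otimes>\<^bsub>G\<^esub> coset y" using u by simp
    qed
  qed
  have carr: "carrier G = coset ` {x. x \<noteq> 0}" and one_G: "\<one>\<^bsub>G\<^esub> = coset 1"
    by (auto simp: G_def coset_def)
  have "comm_group G"
  proof (rule comm_groupI)
    show "\<exists>y\<in>carrier G. y \<otimes>\<^bsub>G\<^esub> x = \<one>\<^bsub>G\<^esub>" if x: "x \<in> carrier G" for x
    proof -
      obtain a where a: "a \<noteq> 0" "x = coset a" using x by (auto simp: carr)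
      then have "coset (inverse a) \<otimes>\<^bsub>G\<^esub> x = \<one>\<^bsub>G\<^esub>" by (simp add: mult_coset one_G)
      moreover have "coset (inverse a) \<in> carrier G" using a(1) by (auto simp: carr)
      ultimately show ?thesis by blast
    qed
  qed (auto simp: carr one_G mult_coset mult_ac)
  moreover have "linear_order_on (carrier G) r"
    unfolding linear_order_on_def partial_order_on_def preorder_on_def
  proof (intro conjI)
    show "r \<subseteq> carrier G \<times> carrier G" by (auto simp: r_def carr)
    show "refl_on (carrier G) r" by (auto simp: refl_on_def carr r_iff one)
    show "trans r"
    proof (rule transI)
      fix X Y Z assume XY: "(X, Y) \<in> r" and YZ: "(Y, Z) \<in> r"
      obtain a b where a: "a \<noteq> 0" "X = coset a" and b: "b \<noteq> 0" "Y = coset b"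
        using XY unfolding r_def by blast
      obtain c where c: "c \<noteq> 0" "Z = coset c" using YZ unfolding r_def by blast
      have "b * inverse a \<in> A" "c * inverse b \<in> A"
        using XY YZ r_iff[OF a(1) b(1)] r_iff[OF b(1) c(1)] a b c by auto
      then have "c * inverse b * (b * inverse a) \<in> A" using Am by blast
      then have "c * inverse a \<in> A" by (simp only: inverse_cancel[OF b(1)])
      then show "(X, Z) \<in> r" using a c r_iff[OF a(1) c(1)] by simp
    qed
    show "antisym r"
    proof (rule antisymI)
      fix X Y assume XY: "(X, Y) \<in> r" and YX: "(Y, X) \<in> r"
      obtain a b where a: "a \<noteq> 0" "X = coset a" and b: "b \<noteq> 0" "Y = coset b"
        using XY unfolding r_def by blast
      have "b * inverse a \<in> A" "a * inverse b \<in> A"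
        using XY YX r_iff[OF a(1) b(1)] r_iff[OF b(1) a(1)] a b by auto
      then have "b * inverse a \<in> U" using a b by (simp add: U_def mult.commute)
      then show "X = Y" using a b coset_eq[OF a(1), of b] by simp
    qed
    show "total_on (carrier G) r"
    proof (rule total_onI)
      fix X Y assume "X \<in> carrier G" "Y \<in> carrier G"
      then obtain a b where a: "a \<noteq> 0" "X = coset a" and b: "b \<noteq> 0" "Y = coset b" by (auto simp: carr)
      have "b * inverse a \<in> A \<or> inverse (b * inverse a) \<in> A" using A(1) unfolding vset_def by blast
      then show "(X, Y) \<in> r \<or> (Y, X) \<in> r"
        using a b r_iff[OF a(1) b(1)] r_iff[OF b(1) a(1)] by (auto simp: mult.commute)
    qed
  qed
  moreover have "(X \<otimes>\<^bsub>G\<^esub> Z, Y \<otimes>\<^bsub>G\<^esub> Z) \<in> r"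
    if XYZ: "X \<in> carrier G" "Y \<in> carrier G" "Z \<in> carrier G" "(X, Y) \<in> r" for X Y Z
  proof -
    obtain a b c where a: "a \<noteq> 0" "X = coset a" and b: "b \<noteq> 0" "Y = coset b" and c: "c \<noteq> 0" "Z = coset c"
      using XYZ(1-3) by (auto simp: carr)
    have eq: "b * c * inverse (a * c) = b * inverse a" using c(1) a(1) by (simp add: field_simps)
    have nz: "a * c \<noteq> 0" "b * c \<noteq> 0" using a b c by auto
    have "(coset (a * c), coset (b * c)) \<in> r"
      unfolding r_iff[OF nz] eq using XYZ(4) r_iff[OF a(1) b(1)] a b by simp
    then show ?thesis using a b c by (simp only: mult_coset)
  qed
  ultimately have "ordered_ab_group G r" unfolding ordered_ab_group_def by simp
  moreover have "(coset x, coset (x + y)) \<in> r \<or> (coset y, coset (x + y)) \<in> r"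
    if xy: "x \<noteq> 0" "y \<noteq> 0" "x + y \<noteq> 0" for x y
  proof -
    have "y * inverse x \<in> A \<or> inverse (y * inverse x) \<in> A" using A(1) unfolding vset_def by blast
    then have "1 + y * inverse x \<in> A \<or> inverse (y * inverse x) + 1 \<in> A" using one Aa by blast
    moreover have "(x + y) * inverse x = 1 + y * inverse x" "(x + y) * inverse y = inverse (y * inverse x) + 1"
      using xy by (simp_all add: field_simps)
    ultimately show ?thesis using r_iff[OF xy(1,3)] r_iff[OF xy(2,3)] by metis
  qed
  ultimately have val: "valuation G r coset"
    unfolding valuation_def by (auto simp: carr mult_coset)
  obtain x where x: "x \<notin> A" using A(2) by auto
  have x0: "x \<noteq> 0" using x A(1) unfolding vset_def by (metis inverse_zero)
  have "coset x \<noteq> \<one>\<^bsub>G\<^esub>" using x coset_eq[of 1 x] by (auto simp: one_G U_def)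
  then have "nontrivial_valuation G r coset" using val x0 unfolding nontrivial_valuation_def by blast
  moreover have "induced_by_valuation \<sigma> G r coset"
    unfolding induced_by_valuation_def
  proof
    fix W
    have "(\<exists>c. c \<noteq> 0 \<and> (\<forall>b\<in>A. a + c * b \<in> W)) \<longleftrightarrow>
        (\<exists>g\<in>carrier G. \<forall>y. y \<noteq> a \<longrightarrow> (g, coset (y - a)) \<in> r \<longrightarrow> y \<in> W)" if a: "a \<in> W" for a
    proof
      assume "\<exists>c. c \<noteq> 0 \<and> (\<forall>b\<in>A. a + c * b \<in> W)"
      then obtain c where c: "c \<noteq> 0" "\<And>b. b \<in> A \<Longrightarrow> a + c * b \<in> W" by auto
      have "y \<in> W" if "y \<noteq> a" "(coset c, coset (y - a)) \<in> r" for y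
      proof -
        have "(y - a) * inverse c \<in> A" using r_iff[of c "y - a"] c(1) that by simp
        from c(2)[OF this] have "a + c * ((y - a) * inverse c) \<in> W" .
        also have "a + c * ((y - a) * inverse c) = y" using c(1) by (simp add: field_simps)
        finally show "y \<in> W" .
      qed
      moreover have "coset c \<in> carrier G" using c(1) by (auto simp: carr)
      ultimately show "\<exists>g\<in>carrier G. \<forall>y. y \<noteq> a \<longrightarrow> (g, coset (y - a)) \<in> r \<longrightarrow> y \<in> W" by blast
    next
      assume "\<exists>g\<in>carrier G. \<forall>y. y \<noteq> a \<longrightarrow> (g, coset (y - a)) \<in> r \<longrightarrow> y \<in> W"
      then obtain g where g: "g \<in> carrier G" "\<And>y. y \<noteq> a \<Longrightarrow> (g, coset (y - a)) \<in> r \<Longrightarrow> y \<in> W" by blast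
      obtain c where c: "c \<noteq> 0" "g = coset c" using g(1) by (auto simp: carr)
      have "a + c * b \<in> W" if b: "b \<in> A" for b
      proof (cases "b = 0")
        case False
        have cb: "c * b * inverse c = b" using c(1) by (simp add: field_simps)
        have "(coset c, coset (c * b)) \<in> r" using r_iff[of c "c * b"] c(1) False b unfolding cb by simp
        then show ?thesis using g(2)[of "a + c * b"] c False by simp
      qed (simp add: a)
      then show "\<exists>c. c \<noteq> 0 \<and> (\<forall>b\<in>A. a + c * b \<in> W)" using c(1) by auto
    qed
    then show "openin \<sigma> W \<longleftrightarrow> (\<forall>a\<in>W. \<exists>g\<in>carrier G. \<forall>y. y \<noteq> a \<longrightarrow> (g, coset (y - a)) \<in> r \<longrightarrow> y \<in> W)"
      using \<sigma> unfolding base_set_def by simp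
  qed
  ultimately show ?thesis unfolding V_topology_def by blast
qed

text \<open>The number found here becomes the gauge of a nonzero field element, with
  \<open>P k\<close> saying that the \<open>k\<close>-th power of a fixed scalar brings the element
  into a given bounded set.\<close>

lemma int_threshold:
  fixes P :: "int \<Rightarrow> bool"
  assumes mono: "\<And>k. P k \<Longrightarrow> P (k + 1)" and "P a" "\<not> P b"
  obtains n where "\<And>k. P k \<longleftrightarrow> n \<le> k"
proof -
  have up: "P (k + int j)" if "P k" for k j
  proof (induction j)
    case (Suc j)
    from mono[OF this] show ?case by (simp add: ac_simps)
  qed (use that in simp)
  have up': "P l" if "P k" "k \<le> l" for k l
    using up[OF that(1), of "nat (l - k)"] that(2) by simp
  have ba: "b < a" using up'[OF assms(2), of b] assms(3) by force
  define j where "j = (LEAST j. P (b + int j))"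
  have "P (b + int (nat (a - b)))" using ba assms(2) by simp
  then have j: "P (b + int j)" unfolding j_def by (rule LeastI)
  show thesis
  proof (rule that[of "b + int j"])
    fix k show "P k \<longleftrightarrow> b + int j \<le> k"
    proof
      assume k: "P k"
      then have bk: "b < k" using up'[OF k, of b] assms(3) by force
      then have "P (b + int (nat (k - b)))" using k by simp
      then have "j \<le> nat (k - b)" unfolding j_def by (rule Least_le)
      then show "b + int j \<le> k" using bk by linarith
    qed (rule up'[OF j])
  qed
qed

text \<open>The Kowalsky-Duerbaum dichotomy: the ring generated by \<open>T\<close> and by a scalar making \<open>T\<close>
  nearly closed under the operations is either a proper valuation ring, or the whole field, and in
  the latter case the gauge of \<open>T\<close> is a quasimorphism that homogenizes to an absolute value.\<close>

lemma vset_V_topology: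
  assumes T: "lb_set T" "vset T" and \<sigma>: "base_set \<sigma> T"
  shows "V_topology \<sigma>"
proof -
  obtain e where e: "e \<noteq> 0" and e1: "\<And>x. x \<in> T \<Longrightarrow> e * x \<in> T"
    and ea: "\<And>x y. x \<in> T \<Longrightarrow> y \<in> T \<Longrightarrow> e * (x + y) \<in> T"
    and em: "\<And>x y. x \<in> T \<Longrightarrow> y \<in> T \<Longrightarrow> e * (x * y) \<in> T"
    using lb_set_uniform[OF T(1)] by metis
  \<comment> \<open>Elements brought into \<open>T\<close> by some power of \<open>e\<close>. Each
    operation costs one further factor \<open>e\<close>, so \<open>R\<close> is closed under sums
    and products.\<close>
  define R where "R = {x. \<exists>k. e ^ k * x \<in> T}"
  have up: "e ^ (k + j) * x \<in> T" if "e ^ k * x \<in> T" for k j x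
  proof (induction j)
    case (Suc j)
    from e1[OF this] show ?case by (simp add: mult.assoc)
  qed (use that in simp)
  have TR: "T \<subseteq> R" unfolding R_def by (auto intro: exI[of _ 0])
  have Rm: "x * y \<in> R" if xy: "x \<in> R" "y \<in> R" for x y
  proof -
    obtain k l where "e ^ k * x \<in> T" "e ^ l * y \<in> T" using xy unfolding R_def by auto
    from em[OF this] have "e ^ Suc (k + l) * (x * y) \<in> T" by (simp add: power_add mult_ac)
    then show ?thesis unfolding R_def by blast
  qed
  have Ra: "x + y \<in> R" if xy: "x \<in> R" "y \<in> R" for x y
  proof -
    obtain k l where "e ^ k * x \<in> T" "e ^ l * y \<in> T" using xy unfolding R_def by auto
    from up[OF this(1), of l] up[OF this(2), of k] have "e ^ (k + l) * x \<in> T" "e ^ (k + l) * y \<in> T"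
      by (simp_all add: add.commute)
    from ea[OF this] have "e ^ Suc (k + l) * (x + y) \<in> T" by (simp add: algebra_simps)
    then show ?thesis unfolding R_def by blast
  qed
  show ?thesis
  proof (cases "R = UNIV")
    case False
    \<comment> \<open>A single \<open>a \<notin> R\<close> bounds \<open>R\<close>: if
      \<open>x \<in> R\<close> and \<open>inverse a * x \<notin> T\<close>, then
      \<open>a / x \<in> T\<close> and \<open>a = x * (a / x)\<close> would lie in \<open>R\<close>.
      Hence \<open>R\<close> and \<open>T\<close> define the same topology.\<close>
    then obtain a where a: "a \<notin> R" by auto
    have a0: "a \<noteq> 0" using a TR lb_set_zero[OF T(1)] by auto
    have "inverse a * x \<in> T" if x: "x \<in> R" for x
    proof (rule ccontr)
      assume n: "inverse a * x \<notin> T"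
      then have x0: "x \<noteq> 0" using lb_set_zero[OF T(1)] by auto
      from vsetD[OF T(2) n] have "a * inverse x \<in> R" using TR by auto
      from Rm[OF x this] have "x * (a * inverse x) \<in> R" .
      also have "x * (a * inverse x) = a" using x0 by (simp add: field_simps)
      finally show False using a by simp
    qed
    then have "lb_le R T" unfolding lb_le_def using a0 by (intro exI[of _ "inverse a"]) simp
    moreover have "lb_le T R" unfolding lb_le_def using TR by (intro exI[of _ 1]) auto
    ultimately have "base_set \<sigma> R" by (intro base_set_scaling[OF \<sigma>])
    moreover have "vset R" using T(2) TR unfolding vset_def by blast
    ultimately show ?thesis using Ra Rm False by (intro valuation_ring_V_topology[of R])
  next
    case True
    define P where "P x k \<longleftrightarrow> e powi k * x \<in> T" for x k
    have Pmono: "P x (k + 1)" if "P x k" for x k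
      using e1[of "e powi k * x"] that e by (simp add: P_def power_int_add mult_ac)
    have Pex: "\<exists>k. P x k" for x
    proof -
      obtain k where "e ^ k * x \<in> T" using True unfolding R_def by auto
      then show ?thesis unfolding P_def by (intro exI[of _ "int k"]) simp
    qed
    have Pnot: "\<exists>k. \<not> P x k" if x: "x \<noteq> 0" for x
    proof (rule ccontr)
      assume "\<not> (\<exists>k. \<not> P x k)"
      then have all: "e powi k * x \<in> T" for k by (simp add: P_def)
      have "y \<in> T" for y
      proof -
        obtain m where m: "e powi m * (inverse x * y) \<in> T" using Pex[of "inverse x * y"] by (auto simp: P_def)
        \<comment> \<open>The exponent \<open>- m - 1\<close> cancels both \<open>m\<close> and the
          factor \<open>e\<close> introduced by the product rule.\<close>
        from em[OF all[of "- m - 1"] m] have "e * (e powi (- m - 1) * x * (e powi m * (inverse x * y))) \<in> T" .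
        also have "e * (e powi (- m - 1) * x * (e powi m * (inverse x * y)))
            = (e powi 1 * e powi (- m - 1) * e powi m) * y" using x by simp
        also have "e powi 1 * e powi (- m - 1) * e powi m = e powi (1 + (- m - 1) + m)"
          by (simp only: power_int_add[OF disjI1[OF e]])
        finally show ?thesis by simp
      qed
      then show False using lb_set_proper[OF T(1)] by auto
    qed
    have "\<exists>n. \<forall>k. P x k \<longleftrightarrow> n \<le> k" if x: "x \<noteq> 0" for x
    proof -
      obtain a b where ab: "P x a" "\<not> P x b" using Pex Pnot[OF x] by blast
      obtain n where "\<And>k. P x k \<longleftrightarrow> n \<le> k" using int_threshold[of "P x", OF Pmono ab] by blast
      then show ?thesis by blast
    qed
    \<comment> \<open>The gauge \<open>N x\<close> is the least exponent bringing \<open>x\<close>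
      into \<open>T\<close>; up to bounded errors it is a logarithm of the size of
      \<open>x\<close>.\<close>
    then obtain N where N: "\<And>x k. x \<noteq> 0 \<Longrightarrow> P x k \<longleftrightarrow> N x \<le> k" by metis
    have PN: "e powi N x * x \<in> T" if "x \<noteq> 0" for x using N[OF that, of "N x"] by (simp add: P_def)
    have Nm: "N (x * y) \<le> N x + N y + 1" if xy: "x \<noteq> 0" "y \<noteq> 0" for x y
    proof -
      have "e * (e powi N x * x * (e powi N y * y)) \<in> T" by (intro em PN xy)
      then have "P (x * y) (N x + N y + 1)" using e by (simp add: P_def power_int_add mult_ac)
      then show ?thesis using N[of "x * y"] xy by simp
    qed
    have Ni: "N (inverse x) \<le> 1 - N x" if x: "x \<noteq> 0" for x
    proof -
      have "e powi (N x - 1) * x \<notin> T" using N[OF x, of "N x - 1"] by (simp add: P_def)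
      from vsetD[OF T(2) this] have "inverse (e powi (N x - 1)) * inverse x \<in> T" by simp
      also have "inverse (e powi (N x - 1)) = e powi (1 - N x)" by (simp add: power_int_minus[symmetric])
      finally show ?thesis using N[of "inverse x" "1 - N x"] x by (simp add: P_def)
    qed
    have Na: "N (x + y) \<le> max (N x) (N y) + 1" if xy: "x \<noteq> 0" "y \<noteq> 0" "x + y \<noteq> 0" for x y
    proof -
      have "e powi (max (N x) (N y)) * x \<in> T" "e powi (max (N x) (N y)) * y \<in> T"
        using N[OF xy(1), of "max (N x) (N y)"] N[OF xy(2), of "max (N x) (N y)"]
        by (simp_all add: P_def)
      from ea[OF this] have "P (x + y) (max (N x) (N y) + 1)"
        using e by (simp add: P_def power_int_add algebra_simps)
      then show ?thesis using N[OF xy(3)] by simp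
    qed
    have Ne: "N (e ^ m * x) = N x - int m" if x: "x \<noteq> 0" for x m
    proof (rule antisym)
      have *: "P (e ^ m * x) k \<longleftrightarrow> P x (k + int m)" for k
        using e by (simp add: P_def power_int_add mult_ac)
      have ex: "e ^ m * x \<noteq> 0" using e x by simp
      show "N (e ^ m * x) \<le> N x - int m" using *[of "N x - int m"] N[OF ex] N[OF x] by simp
      show "N x - int m \<le> N (e ^ m * x)" using *[of "N (e ^ m * x)"] N[OF ex] N[OF x] by simp
    qed
    \<comment> \<open>One direction is \<open>Nm\<close>. The other writes \<open>x\<close> as
      \<open>x * y * inverse y\<close> and uses the \<open>vset\<close> property through
      \<open>Ni\<close>; the two errors of 1 add up to 2.\<close>
    have qm: "\<bar>real_of_int (N (x * y)) - real_of_int (N x) - real_of_int (N y)\<bar> \<le> 2"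
      if xy: "x \<noteq> 0" "y \<noteq> 0" for x y
    proof -
      have "N (x * y * inverse y) \<le> N (x * y) + N (inverse y) + 1" by (rule Nm) (use xy in auto)
      moreover have "x * y * inverse y = x" using xy by (simp add: field_simps)
      ultimately have "N x \<le> N (x * y) + N (inverse y) + 1" by simp
      with Nm[OF xy] Ni[OF xy(2)] show ?thesis by linarith
    qed
    obtain h where hN: "\<And>x. x \<noteq> 0 \<Longrightarrow> \<bar>h x - real_of_int (N x)\<bar> \<le> 2"
      and hm: "\<And>x y. x \<noteq> 0 \<Longrightarrow> y \<noteq> 0 \<Longrightarrow> h (x * y) = h x + h y"
      using quasimorphism_homogenize[of "\<lambda>x. real_of_int (N x)" 2, OF qm] by blast
    have h1: "h 1 = 0" using hm[of 1 1] by simp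
    have hp: "h (e ^ m) = real m * h e" for m
    proof (induction m)
      case (Suc m)
      then show ?case using hm[of e "e ^ m"] e by (simp add: algebra_simps)
    qed (simp add: h1)
    \<comment> \<open>Multiplication by \<open>e\<close> lowers the gauge by exactly 1, and a map
      that is additive on products and within bounded distance of the gauge must have the same slope
      along the powers of \<open>e\<close>.\<close>
    have he: "h e = - 1"
    proof (rule ccontr)
      assume "h e \<noteq> - 1"
      then have pos: "\<bar>h e + 1\<bar> > 0" by simp
      obtain m :: nat where m: "2 + \<bar>real_of_int (N 1)\<bar> < real m * \<bar>h e + 1\<bar>"
        using reals_Archimedean3[OF pos] by blast
      have "\<bar>real m * h e - (real_of_int (N 1) - real m)\<bar> \<le> 2"
        using hN[of "e ^ m"] Ne[of 1 m] hp[of m] e by simp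
      moreover have "real m * h e - (real_of_int (N 1) - real m) = real m * (h e + 1) - real_of_int (N 1)"
        by (simp add: algebra_simps)
      moreover have "\<bar>real m * (h e + 1)\<bar> = real m * \<bar>h e + 1\<bar>" by (simp add: abs_mult)
      ultimately show False using m by linarith
    qed
    \<comment> \<open>\<open>N\<close> of a sum exceeds the maximum by at most 1 and
      \<open>h\<close> is within 2 of \<open>N\<close>, so \<open>h\<close> of a sum exceeds the
      maximum by at most 5. Dividing by 5 turns this into the factor 2 required by
      \<open>absolute_value_triangle\<close>.\<close>
    define f where "f x = (if x = 0 then 0 else 2 powr (h x / 5))" for x
    have fm: "f (x * y) = f x * f y" for x y
      by (auto simp: f_def hm powr_add add_divide_distrib)
    have f1: "f 1 = 1" by (simp add: f_def h1)
    have f0: "0 \<le> f x" for x by (simp add: f_def)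
    have f00: "f 0 = 0" by (simp add: f_def)
    have "2 powr (- (1 / 5)) < (2 powr 0 :: real)" by (rule powr_less_mono) auto
    then have fe: "f e \<noteq> 1" using e by (simp add: f_def he)
    have f2: "f (x + y) \<le> 2 * max (f x) (f y)" for x y
    proof (cases "x = 0 \<or> y = 0 \<or> x + y = 0")
      case True
      then show ?thesis using f0[of x] f0[of y] by (auto simp: f_def)
    next
      case False
      then have "N (x + y) \<le> N x + 1 \<or> N (x + y) \<le> N y + 1" using Na[of x y] by auto
      then have "h (x + y) \<le> h x + 5 \<or> h (x + y) \<le> h y + 5"
        using hN[of x] hN[of y] hN[of "x + y"] False by auto
      moreover have "f (x + y) \<le> 2 * f z" if z: "z \<noteq> 0" "h (x + y) \<le> h z + 5" for z
      proof -
        have "(2::real) powr (h (x + y) / 5) \<le> 2 powr (h z / 5 + 1)"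
          by (rule powr_mono) (use z(2) in auto)
        also have "\<dots> = 2 * 2 powr (h z / 5)" by (simp add: powr_add)
        finally show ?thesis using z(1) False by (simp add: f_def)
      qed
      ultimately have "f (x + y) \<le> 2 * f x \<or> f (x + y) \<le> 2 * f y" using False by blast
      then show ?thesis using max.cobounded1[of "f x" "f y"] max.cobounded2[of "f y" "f x"] by linarith
    qed
    have abs: "nontrivial_absolute_value f"
      unfolding nontrivial_absolute_value_def
    proof (intro conjI allI)
      show "f (x + y) \<le> f x + f y" for x y
        by (rule absolute_value_triangle[of f, OF f0 f1 fm f2 f00])
      show "\<exists>x. x \<noteq> 0 \<and> f x \<noteq> 1" using e fe by blast
      show "f x = 0 \<longleftrightarrow> x = 0" for x by (simp add: f_def)
    qed (rule f0 fm)+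
    have fle: "f x \<le> 1 \<longleftrightarrow> h x \<le> 0" if "x \<noteq> 0" for x
      using that powr_le_cancel_iff[of 2 "h x / 5" 0] by (simp add: f_def)
    \<comment> \<open>Passing between \<open>h\<close> and \<open>N\<close> costs 2, hence the
      scalar \<open>e ^ 2\<close> in both directions.\<close>
    have "e ^ 2 * x \<in> T" if fx: "f x \<le> 1" for x
    proof (cases "x = 0")
      case False
      then have "N x \<le> 2" using hN[OF False] fle[OF False] fx by linarith
      then show ?thesis using N[OF False, of 2] by (simp add: P_def)
    qed (use lb_set_zero[OF T(1)] in simp)
    then have "lb_le {x. f x \<le> 1} T" unfolding lb_le_def using e by (intro exI[of _ "e ^ 2"]) auto
    moreover have "f (e ^ 2 * x) \<le> 1" if x: "x \<in> T" for x
    proof (cases "x = 0")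
      case False
      then have "N x \<le> 0" using N[OF False, of 0] x by (simp add: P_def)
      moreover have "h (e ^ 2 * x) = h x - 2" using hm[of "e ^ 2" x] hp[of 2] he e False by simp
      ultimately have "h (e ^ 2 * x) \<le> 0" using hN[OF False] by linarith
      then show ?thesis using fle[of "e ^ 2 * x"] False e by simp
    qed (simp add: f_def)
    then have "lb_le T {x. f x \<le> 1}" unfolding lb_le_def using e by (intro exI[of _ "e ^ 2"]) auto
    ultimately have "base_set (Metric_space.mtopology UNIV (\<lambda>x y. f (x - y))) T"
      by (rule base_set_scaling[OF absolute_value_vset(3)[OF abs]])
    then have "\<sigma> = Metric_space.mtopology UNIV (\<lambda>x y. f (x - y))"
      using \<sigma> by (simp add: topology_eq base_set_def)
    then show ?thesis unfolding V_topology_def using abs by blast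
  qed
qed

section \<open>Bounded and infinitesimal elements of the monster model\<close>

locale monster =
  fixes \<iota> :: "'a::field \<Rightarrow> 'b::field" and star :: "'a set \<Rightarrow> 'b set"
  assumes elem: "elementary_extension \<iota> star" and saturated: "saturated star"
begin

lemmas transfer_elem = transferD[OF _ elem]

lemma iota_zero [simp]: "\<iota> 0 = 0"
proof -
  have "transfer_fm star (\<lambda>e. e 0 = 0) (\<lambda>e. e 0 = 0)" by (intro transfer_intros)
  from transfer_elem[OF this, of "\<lambda>_. 0"] show ?thesis by simp
qed

lemma iota_one [simp]: "\<iota> 1 = 1"
proof -
  have "transfer_fm star (\<lambda>e. e 0 = 1) (\<lambda>e. e 0 = 1)" by (intro transfer_intros)
  from transfer_elem[OF this, of "\<lambda>_. 1"] show ?thesis by simp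
qed

lemma iota_add: "\<iota> (x + y) = \<iota> x + \<iota> y"
proof -
  have "transfer_fm star (\<lambda>e. e 0 = e 1 + e 2) (\<lambda>e. e 0 = e 1 + e 2)" by (intro transfer_intros)
  from transfer_elem[OF this, of "\<lambda>i. if i = 0 then x + y else if i = 1 then x else y"]
  show ?thesis by simp
qed

lemma iota_mult: "\<iota> (x * y) = \<iota> x * \<iota> y"
proof -
  have "transfer_fm star (\<lambda>e. e 0 = e 1 * e 2) (\<lambda>e. e 0 = e 1 * e 2)" by (intro transfer_intros)
  from transfer_elem[OF this, of "\<lambda>i. if i = 0 then x * y else if i = 1 then x else y"]
  show ?thesis by simp
qed

lemma iota_eq_iff [simp]: "\<iota> x = \<iota> y \<longleftrightarrow> x = y"
proof -
  have "transfer_fm star (\<lambda>e. e 0 = e 1) (\<lambda>e. e 0 = e 1)" by (intro transfer_intros)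
  from transfer_elem[OF this, of "\<lambda>i. if i = 0 then x else y"] show ?thesis by simp
qed

lemma iota_minus: "\<iota> (- x) = - \<iota> x"
  using iota_add[of x "- x"] by (simp add: eq_neg_iff_add_eq_0 add.commute)

lemma iota_eq_0_iff [simp]: "\<iota> x = 0 \<longleftrightarrow> x = 0"
  using iota_eq_iff[of x 0] by simp

lemma iota_inverse: "\<iota> (inverse x) = inverse (\<iota> x)"
proof (cases "x = 0")
  case False
  then have "\<iota> x * \<iota> (inverse x) = 1" using iota_mult[of x "inverse x"] by simp
  then show ?thesis by (metis inverse_unique)
qed simp

lemma iota_divide: "\<iota> (x / y) = \<iota> x / \<iota> y"
  by (simp add: divide_inverse iota_mult iota_inverse)

lemma iota_in_star_iff [simp]: "\<iota> x \<in> star X \<longleftrightarrow> x \<in> X"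
proof -
  have "transfer_fm star (\<lambda>e. e 0 \<in> X) (\<lambda>e. e 0 \<in> star X)" by (intro transfer_intros)
  from transfer_elem[OF this, of "\<lambda>_. x"] show ?thesis by simp
qed

lemma star_UNIV: "star UNIV = UNIV"
proof -
  have "transfer_fm star (\<lambda>e. \<forall>x. x \<in> (UNIV :: 'a set)) (\<lambda>e. \<forall>x. x \<in> star UNIV)" by (intro transfer_intros)
  from transfer_elem[OF this] show ?thesis by auto
qed

lemma star_scale:
  assumes "\<And>x. x \<in> X \<Longrightarrow> c * x \<in> B" "x \<in> star X"
  shows "\<iota> c * x \<in> star B"
proof -
  have "transfer_fm star (\<lambda>e. \<forall>x\<in>X. e 0 * x \<in> B) (\<lambda>e. \<forall>x\<in>star X. e 0 * x \<in> star B)"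
    by (intro transfer_intros)
  from transfer_elem[OF this, of "\<lambda>_. c"] show ?thesis using assms by simp
qed

lemma star_scaled_iff: "x \<in> star {y. c * y \<in> B} \<longleftrightarrow> \<iota> c * x \<in> star B"
proof -
  have "transfer_fm star (\<lambda>e. \<forall>x. (x \<in> {y. c * y \<in> B} \<longrightarrow> e 0 * x \<in> B) \<and> (e 0 * x \<in> B \<longrightarrow> x \<in> {y. c * y \<in> B}))
    (\<lambda>e. \<forall>x. (x \<in> star {y. c * y \<in> B} \<longrightarrow> e 0 * x \<in> star B) \<and> (e 0 * x \<in> star B \<longrightarrow> x \<in> star {y. c * y \<in> B}))"
    by (intro transfer_intros)
  from transfer_elem[OF this, of "\<lambda>_. c"] show ?thesis by auto
qed

lemma star_add:
  assumes "\<And>x y. x \<in> B \<Longrightarrow> y \<in> B \<Longrightarrow> k * (x + y) \<in> B" "x \<in> star B" "y \<in> star B"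
  shows "\<iota> k * (x + y) \<in> star B"
proof -
  have "transfer_fm star (\<lambda>e. \<forall>x\<in>B. \<forall>y\<in>B. e 0 * (x + y) \<in> B)
    (\<lambda>e. \<forall>x\<in>star B. \<forall>y\<in>star B. e 0 * (x + y) \<in> star B)" by (intro transfer_intros)
  from transfer_elem[OF this, of "\<lambda>_. k"] show ?thesis using assms by simp
qed

lemma star_mult:
  assumes "\<And>x y. x \<in> B \<Longrightarrow> y \<in> B \<Longrightarrow> k * (x * y) \<in> B" "x \<in> star B" "y \<in> star B"
  shows "\<iota> k * (x * y) \<in> star B"
proof -
  have "transfer_fm star (\<lambda>e. \<forall>x\<in>B. \<forall>y\<in>B. e 0 * (x * y) \<in> B)
    (\<lambda>e. \<forall>x\<in>star B. \<forall>y\<in>star B. e 0 * (x * y) \<in> star B)" by (intro transfer_intros)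
  from transfer_elem[OF this, of "\<lambda>_. k"] show ?thesis using assms by simp
qed

definition fin :: "'a set \<Rightarrow> 'b set" where
  "fin B = {x. \<exists>c. c \<noteq> 0 \<and> \<iota> c * x \<in> star B}"

text \<open>While \<open>fin B\<close> is the ring \<open>R_top\<close> written with one bounded
  set, \<open>infinitesimal B\<close> is the intersection of the extensions of all neighbourhoods of
  0. It is an ideal of \<open>fin B\<close>, in general not a maximal one; for a \<open>vset\<close>
  it is the maximal ideal of the valuation ring \<open>fin B\<close>.\<close>

definition infinitesimal :: "'a set \<Rightarrow> 'b set" where
  "infinitesimal B = {x. \<forall>c. c \<noteq> 0 \<longrightarrow> \<iota> c * x \<in> star B}"

lemma finI: "c \<noteq> 0 \<Longrightarrow> \<iota> c * x \<in> star B \<Longrightarrow> x \<in> fin B"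
  unfolding fin_def by blast

lemma star_subset_fin: "star B \<subseteq> fin B"
  unfolding fin_def by (auto intro!: exI[of _ 1])

lemma R_top_eq_fin:
  assumes "lb_set B" "base_set \<tau> B"
  shows "R_top star \<tau> = fin B"
proof
  show "R_top star \<tau> \<subseteq> fin B"
  proof
    fix x assume "x \<in> R_top star \<tau>"
    then obtain X where X: "top_bounded \<tau> X" "x \<in> star X" unfolding R_top_def by auto
    then obtain c where "c \<noteq> 0" "\<And>x. x \<in> X \<Longrightarrow> c * x \<in> B"
      unfolding top_bounded_base[OF assms] lb_le_def by auto
    then show "x \<in> fin B" using star_scale[of X c B x] X(2) by (auto intro: finI)
  qed
  show "fin B \<subseteq> R_top star \<tau>"
  proof
    fix x assume "x \<in> fin B"
    then obtain c where c: "c \<noteq> 0" "x \<in> star {y. c * y \<in> B}" unfolding fin_def star_scaled_iff by auto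
    have "top_bounded \<tau> {y. c * y \<in> B}"
      unfolding top_bounded_base[OF assms] lb_le_def using c(1) by auto
    then show "x \<in> R_top star \<tau>" unfolding R_top_def using c(2) by auto
  qed
qed

text \<open>The separate scalars \<open>a j\<close> are replaced by a single one that absorbs all
  their inverses.\<close>

lemma fin_common:
  assumes B: "lb_set B" and "finite J" and w: "\<And>j. j \<in> J \<Longrightarrow> w j \<in> fin B"
  obtains c where "c \<noteq> 0" "\<And>j. j \<in> J \<Longrightarrow> \<iota> c * w j \<in> star B"
proof -
  have "\<forall>j. \<exists>c. j \<in> J \<longrightarrow> c \<noteq> 0 \<and> \<iota> c * w j \<in> star B" using w unfolding fin_def by auto
  then obtain a where a: "\<And>j. j \<in> J \<Longrightarrow> a j \<noteq> 0" "\<And>j. j \<in> J \<Longrightarrow> \<iota> (a j) * w j \<in> star B" by metis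
  have "finite ((\<lambda>j. inverse (a j)) ` J)" using \<open>finite J\<close> by simp
  from lb_set_absorb[OF B this] obtain c where c: "c \<noteq> 0"
    "\<And>x b. x \<in> (\<lambda>j. inverse (a j)) ` J \<Longrightarrow> b \<in> B \<Longrightarrow> c * x * b \<in> B" by metis
  have "\<iota> c * w j \<in> star B" if j: "j \<in> J" for j
  proof -
    have "\<iota> (c * inverse (a j)) * (\<iota> (a j) * w j) \<in> star B"
      by (rule star_scale[of B]) (use c(2) j a(2)[OF j] in auto)
    moreover have "\<iota> (c * inverse (a j)) * (\<iota> (a j) * w j) = \<iota> c * w j"
      using a(1)[OF j] by (simp add: iota_mult iota_inverse iota_divide field_simps)
    ultimately show ?thesis by simp
  qed
  then show thesis using c(1) that by blast
qed

lemma fin_add: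
  assumes B: "lb_set B" and x: "x \<in> fin B" and y: "y \<in> fin B"
  shows "x + y \<in> fin B"
proof -
  have "finite {x, y}" "\<And>j. j \<in> {x, y} \<Longrightarrow> j \<in> fin B" using x y by auto
  from fin_common[OF B this, of "\<lambda>j. j"] obtain c
    where c: "c \<noteq> 0" "\<And>j. j \<in> {x, y} \<Longrightarrow> \<iota> c * j \<in> star B"
    by metis
  obtain k where k: "k \<noteq> 0" "\<And>x y. x \<in> B \<Longrightarrow> y \<in> B \<Longrightarrow> k * (x + y) \<in> B"
    using lb_set_addE[OF B] by metis
  have "\<iota> (k * c) * (x + y) \<in> star B"
    using star_add[OF k(2) c(2)[of x] c(2)[of y]] by (simp add: iota_mult algebra_simps)
  then show ?thesis using k(1) c(1) by (intro finI[of "k * c"]) auto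
qed

lemma fin_mult:
  assumes B: "lb_set B" and x: "x \<in> fin B" and y: "y \<in> fin B"
  shows "x * y \<in> fin B"
proof -
  obtain a b where a: "a \<noteq> 0" "\<iota> a * x \<in> star B" and b: "b \<noteq> 0" "\<iota> b * y \<in> star B"
    using x y unfolding fin_def by auto
  obtain k where k: "k \<noteq> 0" "\<And>x y. x \<in> B \<Longrightarrow> y \<in> B \<Longrightarrow> k * (x * y) \<in> B"
    using lb_set_multE[OF B] by metis
  have "\<iota> (k * a * b) * (x * y) \<in> star B"
    using star_mult[OF k(2) a(2) b(2)] by (simp add: iota_mult mult_ac)
  then show ?thesis using k(1) a(1) b(1) by (intro finI[of "k * a * b"]) auto
qed

lemma iota_fin: "lb_set B \<Longrightarrow> \<iota> x \<in> fin B"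
  using lb_set_absorb2[of B x x] by (metis finI iota_mult iota_in_star_iff)

lemma fin_zero: "lb_set B \<Longrightarrow> 0 \<in> fin B" and fin_one: "lb_set B \<Longrightarrow> 1 \<in> fin B"
  using iota_fin[of B 0] iota_fin[of B 1] by auto

lemma fin_uminus: "lb_set B \<Longrightarrow> x \<in> fin B \<Longrightarrow> - x \<in> fin B"
  using fin_mult[OF _ iota_fin[of B "- 1"]] by (simp add: iota_minus)

lemma fin_sum:
  "lb_set B \<Longrightarrow> (\<And>j. j \<in> J \<Longrightarrow> f j \<in> fin B) \<Longrightarrow> (\<Sum>j\<in>J. f j) \<in> fin B"
  by (induction J rule: infinite_finite_induct) (auto simp: fin_zero fin_add)

lemma infinitesimal_subset_star: "infinitesimal B \<subseteq> star B"
  unfolding infinitesimal_def using iota_one by (metis (mono_tags, lifting) mem_Collect_eq mult_1 subsetI zero_neq_one)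

lemma infinitesimal_mult:
  assumes B: "lb_set B" and z: "z \<in> infinitesimal B" and x: "x \<in> fin B"
  shows "z * x \<in> infinitesimal B"
  unfolding infinitesimal_def
proof (intro CollectI allI impI)
  fix c :: 'a assume c: "c \<noteq> 0"
  obtain a where a: "a \<noteq> 0" "\<iota> a * x \<in> star B" using x unfolding fin_def by auto
  obtain k where k: "k \<noteq> 0" "\<And>x y. x \<in> B \<Longrightarrow> y \<in> B \<Longrightarrow> k * (x * y) \<in> B"
    using lb_set_multE[OF B] by metis
  have "c * inverse (k * a) \<noteq> 0" using a k c by simp
  then have "\<iota> (c * inverse (k * a)) * z \<in> star B" using z unfolding infinitesimal_def by blast
  from star_mult[OF k(2) this a(2)]
  have "\<iota> k * (\<iota> (c * inverse (k * a)) * z * (\<iota> a * x)) \<in> star B" .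
  also have "\<iota> k * (\<iota> (c * inverse (k * a)) * z * (\<iota> a * x)) = \<iota> c * (z * x)"
    using a(1) k(1) by (simp add: iota_mult iota_inverse iota_divide field_simps)
  finally show "\<iota> c * (z * x) \<in> star B" .
qed

lemma infinitesimal_add:
  assumes B: "lb_set B" and x: "x \<in> infinitesimal B" and y: "y \<in> infinitesimal B"
  shows "x + y \<in> infinitesimal B"
  unfolding infinitesimal_def
proof (intro CollectI allI impI)
  fix c :: 'a assume c: "c \<noteq> 0"
  obtain k where k: "k \<noteq> 0" "\<And>x y. x \<in> B \<Longrightarrow> y \<in> B \<Longrightarrow> k * (x + y) \<in> B"
    using lb_set_addE[OF B] by metis
  have "c * inverse k \<noteq> 0" using k c by simp
  then have "\<iota> (c * inverse k) * x \<in> star B" "\<iota> (c * inverse k) * y \<in> star B"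
    using x y unfolding infinitesimal_def by blast+
  from star_add[OF k(2) this] show "\<iota> c * (x + y) \<in> star B"
    using k(1) by (simp add: iota_mult iota_inverse algebra_simps)
qed

lemma one_not_infinitesimal:
  assumes B: "lb_set B"
  shows "1 \<notin> infinitesimal B"
proof
  assume "1 \<in> infinitesimal B"
  then have "c \<in> B" if "c \<noteq> 0" for c using that unfolding infinitesimal_def by simp
  then have "c \<in> B" for c using lb_set_zero[OF B] by (cases "c = 0") auto
  then have "B = UNIV" by auto
  then show False using lb_set_proper[OF B] by simp
qed

lemma infinitesimal_zero: "lb_set B \<Longrightarrow> 0 \<in> infinitesimal B"
proof -
  assume B: "lb_set B"
  have "\<iota> 0 \<in> star B" using lb_set_zero[OF B] by (simp only: iota_in_star_iff)
  then show ?thesis by (simp add: infinitesimal_def)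
qed

lemma infinitesimal_sum:
  "lb_set B \<Longrightarrow> (\<And>j. j \<in> J \<Longrightarrow> f j \<in> infinitesimal B) \<Longrightarrow> (\<Sum>j\<in>J. f j) \<in> infinitesimal B"
  by (induction J rule: infinite_finite_induct) (auto simp: infinitesimal_zero infinitesimal_add)

text \<open>Saturation is applied to the conditions \<open>x \<noteq> 0\<close> and
  \<open>c * x \<in> B\<close> for all standard \<open>c \<noteq> 0\<close>. Each set
  \<open>{y. c * y \<in> B}\<close> has its own predicate symbol, so \<open>c\<close> is no
  parameter and the valuation constantly 0 is a dummy. Finitely many conditions are met by a
  standard scalar absorbing the elements \<open>c\<close> involved.\<close>

lemma infinitesimal_exists:
  assumes B: "lb_set B"
  obtains z where "z \<noteq> 0" "z \<in> infinitesimal B"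
proof -
  define p where "p = insert (FNot (FEq (Var 0) Zero), \<lambda>_ :: nat. 0 :: 'b)
    ((\<lambda>c. (FPred {y. c * y \<in> B} (Var 0), \<lambda>_. 0)) ` {c. c \<noteq> 0})"
  have "small {0 :: 'b} TYPE('a)" unfolding small_def by (rule card_of_singl_ordLeq) simp
  moreover have "\<forall>(\<phi>, e)\<in>p. range e \<subseteq> {0}" by (auto simp: p_def)
  moreover have "\<exists>b. \<forall>(\<phi>, e)\<in>F. sat star (case_nat b e) \<phi>" if F: "finite F" "F \<subseteq> p" for F
  proof -
    have "F - {(FNot (FEq (Var 0) Zero), \<lambda>_. 0)} \<subseteq> (\<lambda>c. (FPred {y. c * y \<in> B} (Var 0), \<lambda>_. 0)) ` {c. c \<noteq> 0}"
      using F(2) by (auto simp: p_def)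
    moreover have "finite (F - {(FNot (FEq (Var 0) Zero), \<lambda>_. 0)})" using F(1) by simp
    ultimately have "\<exists>C. finite C \<and> C \<subseteq> {c. c \<noteq> 0} \<and>
      F - {(FNot (FEq (Var 0) Zero), \<lambda>_. 0)} = (\<lambda>c. (FPred {y. c * y \<in> B} (Var 0), \<lambda>_. 0)) ` C"
      by (metis (no_types, lifting) finite_subset_image)
    then obtain C where C: "finite C"
      "F - {(FNot (FEq (Var 0) Zero), \<lambda>_. 0)} = (\<lambda>c. (FPred {y. c * y \<in> B} (Var 0), \<lambda>_. 0)) ` C"
      by (elim exE conjE)
    obtain a where a: "a \<noteq> 0" "\<And>x b. x \<in> C \<Longrightarrow> b \<in> B \<Longrightarrow> a * x * b \<in> B"
      using lb_set_absorb[OF B C(1)] by metis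
    have Ca: "c * a \<in> B" if "c \<in> C" for c using a(2)[OF that lb_set_one[OF B]] by (simp add: mult.commute)
    have "sat star (case_nat (\<iota> a) e) \<phi>" if \<phi>: "(\<phi>, e) \<in> F" for \<phi> e
    proof (cases "(\<phi>, e) = (FNot (FEq (Var 0) Zero), \<lambda>_. 0)")
      case False
      then have "(\<phi>, e) \<in> (\<lambda>c. (FPred {y. c * y \<in> B} (Var 0), \<lambda>_. 0)) ` C" using C(2) \<phi> by blast
      then show ?thesis using Ca by auto
    qed (use a(1) in simp)
    then show ?thesis by (intro exI[of _ "\<iota> a"]) auto
  qed
  ultimately obtain b where b: "\<forall>(\<phi>, e)\<in>p. sat star (case_nat b e) \<phi>"
    using saturated unfolding saturated_def by meson
  have "b \<noteq> 0" using b unfolding p_def by auto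
  moreover have "\<iota> c * b \<in> star B" if "c \<noteq> 0" for c
  proof -
    have "(FPred {y. c * y \<in> B} (Var 0), \<lambda>_. 0) \<in> p" using that by (auto simp: p_def)
    then have "b \<in> star {y. c * y \<in> B}" using b by fastforce
    then show ?thesis by (simp add: star_scaled_iff)
  qed
  then have "b \<in> infinitesimal B" unfolding infinitesimal_def by simp
  ultimately show thesis by (rule that)
qed

lemma fin_mono: "lb_le B T \<Longrightarrow> fin B \<subseteq> fin T"
proof
  fix x assume le: "lb_le B T" and "x \<in> fin B"
  then obtain c d where "c \<noteq> 0" "\<iota> c * x \<in> star B" "d \<noteq> 0" "\<And>b. b \<in> B \<Longrightarrow> d * b \<in> T"
    unfolding fin_def lb_le_def by auto
  then show "x \<in> fin T" using star_scale[of B d T "\<iota> c * x"]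
    by (intro finI[of "d * c"]) (auto simp: iota_mult mult.assoc)
qed

lemma infinitesimal_mono:
  assumes "lb_le B T"
  shows "infinitesimal B \<subseteq> infinitesimal T"
proof
  fix x assume x: "x \<in> infinitesimal B"
  obtain d where d: "d \<noteq> 0" "\<And>b. b \<in> B \<Longrightarrow> d * b \<in> T" using assms unfolding lb_le_def by auto
  show "x \<in> infinitesimal T" unfolding infinitesimal_def
  proof (intro CollectI allI impI)
    fix c :: 'a assume "c \<noteq> 0"
    then have "\<iota> (inverse d * c) * x \<in> star B" using x d(1) unfolding infinitesimal_def by simp
    then show "\<iota> c * x \<in> star T"
      using star_scale[of B d T] d by (fastforce simp: iota_mult iota_inverse mult.assoc[symmetric])
  qed
qed

text \<open>The scalar \<open>z\<close> may be nonstandard: failure of \<open>lb_le\<close> is a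
  first-order statement about all nonzero scalars, and it transfers.\<close>

lemma lb_leI_infinitesimal:
  assumes z: "z \<noteq> 0" "\<And>x. x \<in> star B \<Longrightarrow> z * x \<in> star T"
  shows "lb_le B T"
proof (rule ccontr)
  assume "\<not> lb_le B T"
  then have *: "\<forall>c. c \<noteq> 0 \<longrightarrow> (\<exists>b\<in>B. c * b \<notin> T)" unfolding lb_le_def by auto
  have tr: "transfer_fm star (\<lambda>e. \<forall>c. \<not> c = 0 \<longrightarrow> (\<exists>b\<in>B. \<not> c * b \<in> T))
    (\<lambda>e. \<forall>c. \<not> c = 0 \<longrightarrow> (\<exists>b\<in>star B. \<not> c * b \<in> star T))" by (intro transfer_intros)
  have "\<forall>c. c \<noteq> 0 \<longrightarrow> (\<exists>b\<in>star B. c * b \<notin> star T)"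
    by (rule iffD1[OF transfer_elem[OF tr] *])
  then show False using z by metis
qed

text \<open>An inclusion of rings bounds each element separately. An infinitesimal for
  \<open>T\<close> makes the bound uniform, since it carries all of \<open>fin T\<close> into
  \<open>star T\<close>, and one nonstandard scalar is enough.\<close>

lemma lb_le_iff_fin:
  assumes B: "lb_set B" and T: "lb_set T"
  shows "lb_le B T \<longleftrightarrow> fin B \<subseteq> fin T"
proof
  assume fin: "fin B \<subseteq> fin T"
  obtain z where z: "z \<noteq> 0" "z \<in> infinitesimal T" using infinitesimal_exists[OF T] by metis
  show "lb_le B T"
  proof (rule lb_leI_infinitesimal[OF z(1)])
    fix x assume "x \<in> star B"
    then have "x \<in> fin T" using star_subset_fin fin by auto
    from infinitesimal_mult[OF T z(2) this] show "z * x \<in> star T" using infinitesimal_subset_star by auto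
  qed
qed (rule fin_mono)

lemma vset_star:
  assumes "vset T"
  shows "x \<in> star T \<or> inverse x \<in> star T"
proof (cases "x = 0")
  case True
  have "0 \<in> T" using assms unfolding vset_def by (metis inverse_zero)
  then have "\<iota> 0 \<in> star T" by (simp only: iota_in_star_iff)
  then show ?thesis using True by simp
next
  case False
  \<comment> \<open>The language has no symbol for inversion, hence the formulation with
    \<open>x * y = 1\<close>.\<close>
  have *: "\<forall>x y. x * y = 1 \<longrightarrow> x \<in> T \<or> y \<in> T" using assms unfolding vset_def by (metis inverse_unique)
  have tr: "transfer_fm star (\<lambda>e. \<forall>x y. x * y = 1 \<longrightarrow> x \<in> T \<or> y \<in> T)
    (\<lambda>e. \<forall>x y. x * y = 1 \<longrightarrow> x \<in> star T \<or> y \<in> star T)" by (intro transfer_intros)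
  have "\<forall>x y. x * y = 1 \<longrightarrow> x \<in> star T \<or> y \<in> star T"
    by (rule iffD1[OF transfer_elem[OF tr] *])
  then show ?thesis using False by (metis right_inverse)
qed

text \<open>\<open>fin T\<close> is a valuation ring with the infinitesimals as its nonunits: if
  some \<open>\<iota> c * x\<close> is not in \<open>star T\<close>, its inverse is, which makes
  \<open>inverse x\<close> finite.\<close>

lemma infinitesimal_iff_vset:
  assumes T: "lb_set T" "vset T"
  shows "x \<in> infinitesimal T \<longleftrightarrow> x = 0 \<or> inverse x \<notin> fin T"
proof
  assume x: "x \<in> infinitesimal T"
  show "x = 0 \<or> inverse x \<notin> fin T"
  proof (rule ccontr)
    assume "\<not> (x = 0 \<or> inverse x \<notin> fin T)"
    then show False using infinitesimal_mult[OF T(1) x, of "inverse x"] one_not_infinitesimal[OF T(1)] by simp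
  qed
next
  assume x: "x = 0 \<or> inverse x \<notin> fin T"
  show "x \<in> infinitesimal T" unfolding infinitesimal_def
  proof (intro CollectI allI impI)
    fix c :: 'a assume c: "c \<noteq> 0"
    show "\<iota> c * x \<in> star T"
    proof (rule ccontr)
      assume n: "\<iota> c * x \<notin> star T"
      have "\<iota> 0 \<in> star T" using lb_set_zero[OF T(1)] by (simp only: iota_in_star_iff)
      then have "x \<noteq> 0" using n by auto
      moreover have "\<iota> (inverse c) * inverse x \<in> star T"
        using vset_star[OF T(2), of "\<iota> c * x"] n by (simp add: iota_inverse)
      then have "inverse x \<in> fin T" using c by (intro finI[of "inverse c"]) auto
      ultimately show False using x by simp
    qed
  qed
qed

lemma vset_fin: "lb_set T \<Longrightarrow> vset T \<Longrightarrow> x \<in> fin T \<or> inverse x \<in> fin T"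
  using vset_star star_subset_fin by blast

end

section \<open>Local subrings of a field and independent families\<close>

locale field_subring =
  fixes R :: "'b::field set"
  assumes one: "1 \<in> R" and add: "x \<in> R \<Longrightarrow> y \<in> R \<Longrightarrow> x + y \<in> R"
    and mult: "x \<in> R \<Longrightarrow> y \<in> R \<Longrightarrow> x * y \<in> R" and uminus: "x \<in> R \<Longrightarrow> - x \<in> R"
begin

lemma zero: "0 \<in> R"
  using add[OF one uminus[OF one]] by simp

end

text \<open>Only the inverse has to lie in \<open>R\<close>, so this makes sense for
  \<open>x\<close> outside \<open>R\<close>; \<open>dominating_set_properties\<close> relies on
  that.\<close>

definition unit_in :: "'b::field set \<Rightarrow> 'b \<Rightarrow> bool" where
  "unit_in R x \<longleftrightarrow> x \<noteq> 0 \<and> inverse x \<in> R"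

text \<open>Locality in the elementwise form from which the nonunits are shown to be closed under
  addition and under multiplication by \<open>R\<close>.\<close>

locale local_subring = field_subring R for R :: "'b::field set" +
  assumes local: "x \<in> R \<Longrightarrow> unit_in R x \<or> unit_in R (1 - x)"
begin

definition nonunits :: "'b set" where
  "nonunits = {x \<in> R. \<not> unit_in R x}"

lemma diff: "x \<in> R \<Longrightarrow> y \<in> R \<Longrightarrow> x - y \<in> R"
  using add[of x "- y"] uminus[of y] by simp

lemma nonunits_subset: "x \<in> nonunits \<Longrightarrow> x \<in> R"
  by (simp add: nonunits_def)

lemma one_notin_nonunits: "1 \<notin> nonunits"
  by (simp add: nonunits_def unit_in_def one)

lemma zero_nonunits: "0 \<in> nonunits"
  by (simp add: nonunits_def unit_in_def zero)

lemma nonunits_mult: "a \<in> R \<Longrightarrow> x \<in> nonunits \<Longrightarrow> a * x \<in> nonunits"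
proof -
  assume a: "a \<in> R" and x: "x \<in> nonunits"
  have "\<not> unit_in R (a * x)"
  proof
    assume u: "unit_in R (a * x)"
    then have "inverse (a * x) * a \<in> R" using a mult unfolding unit_in_def by blast
    moreover have "inverse (a * x) * a = inverse x" using u by (simp add: unit_in_def field_simps)
    ultimately have "inverse x \<in> R" by metis
    then have "unit_in R x" using u by (simp add: unit_in_def)
    then show False using x by (simp add: nonunits_def)
  qed
  then show ?thesis using a x mult by (simp add: nonunits_def)
qed

lemma nonunits_add: "x \<in> nonunits \<Longrightarrow> y \<in> nonunits \<Longrightarrow> x + y \<in> nonunits"
proof -
  assume x: "x \<in> nonunits" and y: "y \<in> nonunits"
  have "\<not> unit_in R (x + y)"
  proof
    assume u: "unit_in R (x + y)"
    define i where "i = inverse (x + y)"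
    have i: "i \<in> R" "1 - i * x = i * y" using u by (auto simp: i_def unit_in_def field_simps)
    have "i * x \<in> nonunits" "i * y \<in> nonunits" using nonunits_mult i(1) x y by auto
    then show False using local[of "i * x"] i(2) by (simp add: nonunits_def)
  qed
  then show ?thesis using x y add by (simp add: nonunits_def)
qed

lemma nonunits_uminus: "x \<in> nonunits \<Longrightarrow> - x \<in> nonunits"
  using nonunits_mult[of "- 1" x] uminus[OF one] by simp

lemma nonunits_diff: "x \<in> nonunits \<Longrightarrow> y \<in> nonunits \<Longrightarrow> x - y \<in> nonunits"
  using nonunits_add[of x "- y"] nonunits_uminus[of y] by simp

lemma unit_one_minus: "x \<in> nonunits \<Longrightarrow> unit_in R (1 - x)"
  using local[of x] by (simp add: nonunits_def)

lemma unit_if_not_nonunit: "x \<in> R \<Longrightarrow> x \<notin> nonunits \<Longrightarrow> unit_in R x"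
  by (simp add: nonunits_def)

text \<open>Every linear relation over \<open>R\<close> has its coefficients in the maximal ideal.
  For a finite family over a local ring this says that the \<open>w j\<close> form a minimal
  generating system of the module they span.\<close>

definition indep :: "'i set \<Rightarrow> ('i \<Rightarrow> 'b) \<Rightarrow> bool" where
  "indep J w \<longleftrightarrow> (\<forall>r. (\<forall>j\<in>J. r j \<in> R) \<longrightarrow> (\<Sum>j\<in>J. r j * w j) = 0 \<longrightarrow> (\<forall>j\<in>J. r j \<in> nonunits))"

lemma indepD:
  "indep J w \<Longrightarrow> (\<And>j. j \<in> J \<Longrightarrow> r j \<in> R) \<Longrightarrow> (\<Sum>j\<in>J. r j * w j) = 0 \<Longrightarrow> j \<in> J \<Longrightarrow> r j \<in> nonunits"
  unfolding indep_def by blast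

text \<open>A relation with a unit coefficient could be solved for the corresponding member, placing
  it in the span of the others.\<close>

lemma indepI_span:
  assumes "finite J"
    and not_span: "\<And>i s. i \<in> J \<Longrightarrow> (\<And>j. j \<in> J - {i} \<Longrightarrow> s j \<in> R) \<Longrightarrow> w i \<noteq> (\<Sum>j\<in>J - {i}. s j * w j)"
  shows "indep J w"
  unfolding indep_def
proof (intro allI impI ballI)
  fix r i assume r: "\<forall>j\<in>J. r j \<in> R" and eq: "(\<Sum>j\<in>J. r j * w j) = 0" and i: "i \<in> J"
  show "r i \<in> nonunits"
  proof (rule ccontr)
    assume "r i \<notin> nonunits"
    then have u: "unit_in R (r i)" using r i unit_if_not_nonunit by blast
    define s where "s j = - inverse (r i) * r j" for j
    have s: "s j \<in> R" if "j \<in> J - {i}" for j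
      using that u r uminus mult unfolding s_def unit_in_def by auto
    have "r i * w i + (\<Sum>j\<in>J - {i}. r j * w j) = 0"
      using eq sum.remove[OF \<open>finite J\<close> i, of "\<lambda>j. r j * w j"] by simp
    then have "r i * w i = - (\<Sum>j\<in>J - {i}. r j * w j)" by (simp add: eq_neg_iff_add_eq_0)
    then have "inverse (r i) * (r i * w i) = - inverse (r i) * (\<Sum>j\<in>J - {i}. r j * w j)" by simp
    also have "\<dots> = (\<Sum>j\<in>J - {i}. s j * w j)" unfolding s_def by (simp add: sum_distrib_left mult.assoc sum_negf)
    also have "inverse (r i) * (r i * w i) = w i" using u by (simp add: unit_in_def)
    finally show False using not_span[of i s, OF i s] by blast
  qed
qed

lemma indep_nonzero:
  assumes "indep J w" "i \<in> J"
  shows "w i \<noteq> 0"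
proof
  assume "w i = 0"
  have "(\<Sum>j\<in>J. (if j = i then 1 else 0) * w j) = 0"
    by (rule sum.neutral) (simp add: \<open>w i = 0\<close>)
  then have "(if i = i then 1 else 0) \<in> nonunits"
    by (intro indepD[of J w "\<lambda>j. if j = i then 1 else 0", OF assms(1) _ _ assms(2)]) (auto simp: one zero)
  then show False using one_notin_nonunits by simp
qed

lemma indep_scale:
  assumes "indep J w" "u \<noteq> 0"
  shows "indep J (\<lambda>j. w j / u)"
  unfolding indep_def
proof (intro allI impI)
  fix r assume r: "\<forall>j\<in>J. r j \<in> R" and eq: "(\<Sum>j\<in>J. r j * (w j / u)) = 0"
  have "(\<Sum>j\<in>J. r j * w j) / u = 0" using eq by (simp add: sum_divide_distrib)
  then have "(\<Sum>j\<in>J. r j * w j) = 0" using assms(2) by simp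
  then show "\<forall>j\<in>J. r j \<in> nonunits" using assms(1) r unfolding indep_def by blast
qed

text \<open>A relation with coefficients \<open>r\<close> for the new family is a relation for the
  old one in which \<open>r k\<close> becomes \<open>r k + c * r i\<close>. As \<open>r i\<close> is
  a nonunit too, the correction can be subtracted within the nonunits.\<close>

lemma indep_replace:
  assumes w: "indep J w" and J: "finite J" "i \<in> J" "k \<in> J" "i \<noteq> k" and c: "c \<in> R"
  shows "indep J (w(i := w i + c * w k))"
  unfolding indep_def
proof (intro allI impI)
  fix r assume r: "\<forall>j\<in>J. r j \<in> R" and eq: "(\<Sum>j\<in>J. r j * (w(i := w i + c * w k)) j) = 0"
  define r' where "r' = r(k := r k + c * r i)"
  have r': "\<And>j. j \<in> J \<Longrightarrow> r' j \<in> R" using r J c add mult unfolding r'_def by auto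
  have "(\<Sum>j\<in>J. r' j * w j) = (\<Sum>j\<in>J. r j * w j) + c * r i * w k"
  proof -
    have "(\<Sum>j\<in>J. r' j * w j) = (\<Sum>j\<in>J. r j * w j + (if j = k then c * r i * w k else 0))"
      by (rule sum.cong) (auto simp: r'_def algebra_simps)
    then show ?thesis using J by (simp add: sum.distrib sum.delta)
  qed
  moreover have "(\<Sum>j\<in>J. r j * (w(i := w i + c * w k)) j) = (\<Sum>j\<in>J. r j * w j) + c * r i * w k"
  proof -
    have "(\<Sum>j\<in>J. r j * (w(i := w i + c * w k)) j) = (\<Sum>j\<in>J. r j * w j + (if j = i then c * r i * w k else 0))"
      by (rule sum.cong) (auto simp: algebra_simps)
    then show ?thesis using J by (simp add: sum.distrib sum.delta)
  qed
  ultimately have "(\<Sum>j\<in>J. r' j * w j) = 0" using eq by simp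
  then have m: "r' j \<in> nonunits" if "j \<in> J" for j using indepD[of J w r', OF w r' _ that] by simp
  have ri: "r i \<in> nonunits" using m[OF J(2)] J(4) by (simp add: r'_def)
  have "r' k - c * r i \<in> nonunits" using m[OF J(3)] nonunits_mult[OF c ri] nonunits_diff by blast
  then have "r k \<in> nonunits" by (simp add: r'_def)
  then show "\<forall>j\<in>J. r j \<in> nonunits" using m unfolding r'_def by (metis fun_upd_apply)
qed

text \<open>The \<open>W_set\<close> relation is applied to the family enlarged by \<open>c\<close>; being solved for a member
  other than \<open>w k\<close> would contradict independence.\<close>

lemma W_set_dichotomy:
  fixes n :: nat
  assumes S: "W_set n S" "S \<subseteq> R" and w: "indep {..<n} w" and k: "k < n" "w k = 1" and c: "c \<in> R"
  obtains s where "\<And>j. j < n \<Longrightarrow> s j \<in> S" "\<And>j. j \<in> {..<n} - {k} \<Longrightarrow> s j \<in> nonunits"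
    "c - s k \<in> nonunits \<and> c = s k + (\<Sum>j\<in>{..<n} - {k}. s j * w j) \<or>
     1 - s k * c \<in> nonunits \<and> 1 = s k * c + (\<Sum>j\<in>{..<n} - {k}. s j * w j)"
proof -
  \<comment> \<open>Position \<open>n\<close> holds the additional element \<open>c\<close>.\<close>
  define x where "x j = (if j < n then w j else c)" for j
  obtain i s where i: "i \<le> n" and s: "\<And>j. j \<in> {..n} - {i} \<Longrightarrow> s j \<in> S"
    and eq: "x i = (\<Sum>j\<in>{..n} - {i}. s j * x j)"
    using S(1) unfolding W_set_def by blast
  have split: "(\<Sum>j<n. g j) = g k + (\<Sum>j\<in>{..<n} - {k}. g j)" for g :: "nat \<Rightarrow> 'b"
    using k by (simp add: sum.remove)
  consider "i = n" | "i = k" | "i < n" "i \<noteq> k" using i by linarith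
  then show thesis
  proof cases
    case 1
    have "{..n} - {n} = {..<n}" by auto
    then have sS: "\<And>j. j < n \<Longrightarrow> s j \<in> S" and "c = (\<Sum>j<n. s j * x j)"
      using s eq 1 by (auto simp: x_def)
    then have c_eq: "c = s k + (\<Sum>j\<in>{..<n} - {k}. s j * w j)"
      unfolding split using k by (simp add: x_def)
    \<comment> \<open>Since \<open>w k = 1\<close>, the element \<open>c\<close> counts as
      \<open>c * w k\<close>, and the relation becomes one among the \<open>w j\<close>
      alone.\<close>
    define r where "r = s(k := s k - c)"
    have r: "r j \<in> nonunits" if "j < n" for j
    proof (rule indepD[OF w])
      show "(\<Sum>j<n. r j * w j) = 0" unfolding split using k c_eq by (simp add: r_def)
    qed (use that sS S(2) c diff in \<open>auto simp: r_def\<close>)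
    then have "s k - c \<in> nonunits" using k(1) r[of k] by (simp add: r_def)
    then have "c - s k \<in> nonunits" using nonunits_uminus by fastforce
    moreover have "s j \<in> nonunits" if "j \<in> {..<n} - {k}" for j using r[of j] that by (simp add: r_def)
    ultimately show thesis using that[of s] sS c_eq by blast
  next
    case 2
    have set: "{..n} - {k} = insert n ({..<n} - {k})" using k by auto
    have "(\<Sum>j\<in>{..n} - {k}. s j * x j) = s n * c + (\<Sum>j\<in>{..<n} - {k}. s j * w j)"
      unfolding set by (subst sum.insert) (auto simp: x_def intro!: sum.cong)
    then have one_eq: "1 = s n * c + (\<Sum>j\<in>{..<n} - {k}. s j * w j)"
      using eq 2 k by (simp add: x_def)
    have sS: "s n \<in> S" "\<And>j. j \<in> {..<n} - {k} \<Longrightarrow> s j \<in> S" using s[unfolded 2 set] by auto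
    define r where "r = s(k := s n * c - 1)"
    have r: "r j \<in> nonunits" if "j < n" for j
    proof (rule indepD[OF w])
      show "(\<Sum>j<n. r j * w j) = 0" unfolding split using k one_eq by (simp add: r_def algebra_simps)
    qed (use that sS S(2) c diff mult one in \<open>auto simp: r_def\<close>)
    then have "s n * c - 1 \<in> nonunits" using k(1) r[of k] by (simp add: r_def)
    then have "1 - s n * c \<in> nonunits" using nonunits_uminus by fastforce
    moreover have "s j \<in> nonunits" if "j \<in> {..<n} - {k}" for j using r[of j] that by (simp add: r_def)
    \<comment> \<open>The relation was solved for index \<open>k\<close>, so no coefficient is kept
      there; the coefficient of \<open>c\<close> is stored in its place.\<close>
    moreover have "(\<Sum>j\<in>{..<n} - {k}. (s(k := s n)) j * w j) = (\<Sum>j\<in>{..<n} - {k}. s j * w j)"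
      by (rule sum.cong) auto
    ultimately show thesis using that[of "s(k := s n)"] sS one_eq by auto
  next
    case 3
    have set: "{..n} - {i} = insert n ({..<n} - {i})" using 3 by auto
    have "(\<Sum>j\<in>{..n} - {i}. s j * x j) = s n * c + (\<Sum>j\<in>{..<n} - {i}. s j * w j)"
      unfolding set by (subst sum.insert) (auto simp: x_def intro!: sum.cong)
    then have wi: "w i = s n * c + (\<Sum>j\<in>{..<n} - {i}. s j * w j)" using eq 3 by (simp add: x_def)
    have sS: "s n \<in> S" "\<And>j. j \<in> {..<n} - {i} \<Longrightarrow> s j \<in> S" using s[unfolded set] by auto
    \<comment> \<open>The term in \<open>c\<close> is merged into position \<open>k\<close>; the
      coefficient \<open>- 1\<close> of \<open>w i\<close> is a unit.\<close>
    define r where "r j = (if j = i then - 1 else if j = k then s k + s n * c else s j)" for j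
    have "r i \<in> nonunits"
    proof (rule indepD[OF w])
      have "(\<Sum>j<n. r j * w j) = - w i + (\<Sum>j\<in>{..<n} - {i}. r j * w j)"
        using 3 by (simp add: sum.remove r_def)
      also have "(\<Sum>j\<in>{..<n} - {i}. r j * w j)
          = (\<Sum>j\<in>{..<n} - {i}. s j * w j + (if j = k then s n * c else 0))"
        by (rule sum.cong) (auto simp: r_def k algebra_simps)
      also have "\<dots> = (\<Sum>j\<in>{..<n} - {i}. s j * w j) + s n * c"
        using 3 k by (simp add: sum.distrib sum.delta)
      finally show "(\<Sum>j<n. r j * w j) = 0" using wi by (simp add: algebra_simps)
      have "s n \<in> R" "s k \<in> R" using sS S(2) k 3 by auto
      then have "s k + s n * c \<in> R" using c by (intro add mult)
      then show "r j \<in> R" if "j \<in> {..<n}" for j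
        using that sS(2)[of j] S(2) uminus[OF one] by (auto simp: r_def)
    qed (use 3 in simp)
    then have "- 1 \<in> nonunits" by (simp add: r_def)
    from nonunits_uminus[OF this] show thesis using one_notin_nonunits by simp
  qed
qed

end

section \<open>The dominating V-coarsening of a local W-topology\<close>

lemma W_set_mono: "W_set n S \<Longrightarrow> S \<subseteq> S' \<Longrightarrow> W_set n S'"
  unfolding W_set_def by (meson subsetD)

text \<open>Multiplying the relation by \<open>c\<close> moves the scalar out of the set. The
  condition becomes a formula in the variable \<open>c\<close>, which can be evaluated at
  nonstandard scalars.\<close>

lemma W_set_scaled:
  fixes c :: "'a::field"
  assumes c: "c \<noteq> 0"
  shows "W_set n {y. c * y \<in> B} \<longleftrightarrow> (\<forall>x :: nat \<Rightarrow> 'a. \<exists>i\<in>{..n}. \<exists>s.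
    (\<forall>j\<in>{..n} - {i}. s j \<in> B) \<and> c * x i = (\<Sum>j\<in>{..n} - {i}. s j * x j))"
proof -
  have "(\<exists>s. (\<forall>j\<in>J. s j \<in> {y. c * y \<in> B}) \<and> x i = (\<Sum>j\<in>J. s j * x j)) \<longleftrightarrow>
      (\<exists>s. (\<forall>j\<in>J. s j \<in> B) \<and> c * x i = (\<Sum>j\<in>J. s j * x j))" for J i and x :: "nat \<Rightarrow> 'a"
  proof
    assume "\<exists>s. (\<forall>j\<in>J. s j \<in> {y. c * y \<in> B}) \<and> x i = (\<Sum>j\<in>J. s j * x j)"
    then obtain s where "\<forall>j\<in>J. c * s j \<in> B" "x i = (\<Sum>j\<in>J. s j * x j)" by auto
    then show "\<exists>s. (\<forall>j\<in>J. s j \<in> B) \<and> c * x i = (\<Sum>j\<in>J. s j * x j)"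
      by (intro exI[of _ "\<lambda>j. c * s j"]) (simp add: sum_distrib_left mult.assoc)
  next
    assume "\<exists>s. (\<forall>j\<in>J. s j \<in> B) \<and> c * x i = (\<Sum>j\<in>J. s j * x j)"
    then obtain s where s: "\<forall>j\<in>J. s j \<in> B" "c * x i = (\<Sum>j\<in>J. s j * x j)" by auto
    have "inverse c * (c * x i) = (\<Sum>j\<in>J. inverse c * s j * x j)"
      unfolding s(2) by (simp add: sum_distrib_left mult.assoc)
    moreover have "inverse c * (c * x i) = x i" using c by (simp add: field_simps)
    ultimately have "x i = (\<Sum>j\<in>J. inverse c * s j * x j)" by metis
    moreover have "c * (inverse c * t) = t" for t using c by (simp add: field_simps)
    then have "\<forall>j\<in>J. inverse c * s j \<in> {y. c * y \<in> B}" using s(1) by (simp only: mem_Collect_eq)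
    ultimately show "\<exists>s. (\<forall>j\<in>J. s j \<in> {y. c * y \<in> B}) \<and> x i = (\<Sum>j\<in>J. s j * x j)"
      by (intro exI[of _ "\<lambda>j. inverse c * s j"] conjI)
  qed
  then show ?thesis unfolding W_set_def by (simp add: atMost_def Bex_def)
qed

text \<open>The scaled set need not contain 1. It is enlarged to another scaling
  \<open>{y. a * y \<in> B}\<close>, where \<open>a\<close> absorbs both 1 and
  \<open>inverse c\<close>.\<close>

lemma lb_set_scaled:
  assumes B: "lb_set B" and c: "c \<noteq> 0"
  obtains S where "lb_set S" "lb_le S B" "lb_le B S" "{y. c * y \<in> B} \<subseteq> S"
proof -
  have "finite {1, inverse c}" by simp
  from lb_set_absorb[OF B this] obtain a where a: "a \<noteq> 0"
    "\<And>x b. x \<in> {1, inverse c} \<Longrightarrow> b \<in> B \<Longrightarrow> a * x * b \<in> B" by metis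
  define S where "S = {y. a * y \<in> B}"
  have aB: "a * b \<in> B" if "b \<in> B" for b using a(2)[of 1 b] that by simp
  obtain k where k: "k \<noteq> 0" "\<And>x y. x \<in> B \<Longrightarrow> y \<in> B \<Longrightarrow> k * (x + y) \<in> B"
    using lb_set_addE[OF B] by metis
  obtain l where l: "l \<noteq> 0" "\<And>x y. x \<in> B \<Longrightarrow> y \<in> B \<Longrightarrow> l * (x * y) \<in> B"
    using lb_set_multE[OF B] by metis
  obtain m where m: "m \<noteq> 0" "\<And>x. x \<in> B \<Longrightarrow> m * (- x) \<in> B"
    using lb_set_negE[OF B] by metis
  have "\<exists>k. k \<noteq> 0 \<and> (\<forall>x\<in>S. \<forall>y\<in>S. k * (x + y) \<in> S)"
  proof (intro exI[of _ k] conjI ballI k(1))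
    fix x y assume "x \<in> S" "y \<in> S"
    then have "k * (a * x + a * y) \<in> B" by (intro k(2)) (auto simp: S_def)
    then show "k * (x + y) \<in> S" by (simp add: S_def algebra_simps)
  qed
  moreover have "\<exists>k. k \<noteq> 0 \<and> (\<forall>x\<in>S. \<forall>y\<in>S. k * (x * y) \<in> S)"
  proof (intro exI[of _ "l * a"] conjI ballI)
    fix x y assume "x \<in> S" "y \<in> S"
    then have "l * (a * x * (a * y)) \<in> B" by (intro l(2)) (auto simp: S_def)
    then show "l * a * (x * y) \<in> S" by (simp add: S_def algebra_simps)
  qed (use a l in simp)
  moreover have "\<exists>k. k \<noteq> 0 \<and> (\<forall>x\<in>S. k * (- x) \<in> S)"
  proof (intro exI[of _ m] conjI ballI m(1))
    fix x assume "x \<in> S"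
    then have "m * (- (a * x)) \<in> B" by (intro m(2)) (auto simp: S_def)
    then show "m * (- x) \<in> S" by (simp add: S_def algebra_simps)
  qed
  moreover have "\<exists>c. c \<noteq> 0 \<and> c * x \<in> S \<and> c * y \<in> S" for x y
  proof -
    obtain d where "d \<noteq> 0" "d * (a * x) \<in> B" "d * (a * y) \<in> B" using lb_set_absorb2[OF B] by metis
    then show ?thesis by (intro exI[of _ d]) (simp add: S_def mult.left_commute)
  qed
  moreover have "S \<noteq> UNIV"
  proof
    assume "S = UNIV"
    then have "a * (inverse a * y) \<in> B" for y by (auto simp: S_def)
    then have "y \<in> B" for y using a(1) by (simp flip: mult.assoc)
    then show False using lb_set_proper[OF B] by auto
  qed
  ultimately have "lb_set S"
    using lb_set_zero[OF B] aB[OF lb_set_one[OF B]] unfolding lb_set_def by (simp add: S_def)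
  moreover have "lb_le S B" unfolding lb_le_def using a(1) by (intro exI[of _ a]) (simp add: S_def)
  moreover have "lb_le B S" unfolding lb_le_def using aB by (intro exI[of _ 1]) (simp add: S_def)
  moreover have "{y. c * y \<in> B} \<subseteq> S"
  proof
    fix y assume "y \<in> {y. c * y \<in> B}"
    then have "a * inverse c * (c * y) \<in> B" by (intro a(2)) auto
    then show "y \<in> S" by (simp add: S_def inverse_cancel[OF c])
  qed
  ultimately show thesis by (rule that)
qed

text \<open>Here \<open>Suc n\<close> is the weight of \<tau>; it is positive because the constant
  family 1 refutes \<open>W_set 0\<close>. Failure at \<open>n\<close> is recorded for every
  scaling, since this is the statement that is transferred to infinitesimal scalars.\<close>

lemma W_topology_minimal_base:
  assumes "W_topology \<tau>"
  obtains S n where "lb_set S" "base_set \<tau> S" "W_set (Suc n) S"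
    "\<And>c. c \<noteq> 0 \<Longrightarrow> \<not> W_set n {y. c * y \<in> S}"
proof -
  obtain m S0 where \<tau>: "field_topology_lb \<tau>" and S0: "top_bounded \<tau> S0" "W_set m S0"
    using assms unfolding W_topology_def W_topology_n_def by blast
  obtain B where B: "lb_set B" "base_set \<tau> B" using field_topology_lb_base[OF \<tau>] by blast
  define P where "P n \<longleftrightarrow> (\<exists>c. c \<noteq> 0 \<and> W_set n {y. c * y \<in> B})" for n
  obtain c where c: "c \<noteq> 0" "\<And>x. x \<in> S0 \<Longrightarrow> c * x \<in> B"
    using S0(1) unfolding top_bounded_base[OF B] lb_le_def by blast
  have "P m" unfolding P_def using c W_set_mono[OF S0(2), of "{y. c * y \<in> B}"] by auto
  define n where "n = (LEAST n. P n)"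
  have Pn: "P n" unfolding n_def by (rule LeastI[of P, OF \<open>P m\<close>])
  have "\<not> W_set 0 X" for X :: "'a set"
  proof
    assume "W_set 0 X"
    then have "\<forall>x :: nat \<Rightarrow> 'a. \<exists>i\<le>0. \<exists>s. (\<forall>j\<in>{..0} - {i}. s j \<in> X) \<and>
        x i = (\<Sum>j\<in>{..0} - {i}. s j * x j)"
      unfolding W_set_def .
    from spec[OF this, of "\<lambda>_. 1"] show False by auto
  qed
  then have "n \<noteq> 0" using Pn unfolding P_def by metis
  then obtain n' where n': "n = Suc n'" by (cases n) auto
  have not_P: "\<not> P n'" using not_less_Least[of n' P] n' by (simp add: n_def)
  obtain a where a: "a \<noteq> 0" "W_set n {y. a * y \<in> B}" using Pn unfolding P_def by blast
  obtain S where S: "lb_set S" "lb_le S B" "lb_le B S" "{y. a * y \<in> B} \<subseteq> S"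
    using lb_set_scaled[OF B(1) a(1)] by blast
  obtain d where d: "d \<noteq> 0" "\<And>x. x \<in> S \<Longrightarrow> d * x \<in> B" using S(2) unfolding lb_le_def by blast
  show thesis
  proof (rule that[OF S(1)])
    show "base_set \<tau> S" by (rule base_set_scaling[OF B(2) S(3,2)])
    show "W_set (Suc n') S" using W_set_mono[OF a(2) S(4)] n' by simp
    fix c :: 'a assume c: "c \<noteq> 0"
    show "\<not> W_set n' {y. c * y \<in> S}"
    proof
      assume W: "W_set n' {y. c * y \<in> S}"
      have "W_set n' {y. d * c * y \<in> B}"
        by (rule W_set_mono[OF W]) (use d(2) in \<open>auto simp: mult.assoc\<close>)
      then show False using not_P c d(1) unfolding P_def by (metis mult_eq_0_iff)
    qed
  qed
qed

section \<open>Transferring W-set conditions\<close>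

lemma transfer_fm_rename:
  assumes "transfer_fm star P Q"
  shows "transfer_fm star (\<lambda>e. P (\<lambda>i. e (f i))) (\<lambda>e. Q (\<lambda>i. e (f i)))"
proof -
  obtain \<phi> where "\<And>e. sat (\<lambda>B. B) e \<phi> \<longleftrightarrow> P e" "\<And>e. sat star e \<phi> \<longleftrightarrow> Q e"
    using assms unfolding transfer_fm_def by metis
  then show ?thesis unfolding transfer_fm_def by (intro exI[of _ "ren_fm f \<phi>"]) (simp add: sat_ren_fm)
qed

context monster
begin

text \<open>Transfer in both directions: the statement is checked at standard points of
  \<open>X\<close>, where nonstandard witnesses may be used, pulled down to \<open>K\<close>, and
  lifted from there to all points of \<open>star X\<close> and all nonzero \<open>b\<close>. The two
  variables are coded in one sequence, so that a single quantifier rule applies.\<close>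

lemma transfer_binary:
  assumes tr: "transfer_fm star (\<lambda>e. \<Phi> (e 0) (e 1)) (\<lambda>e. \<Psi> (e 0) (e 1))"
    and hyp: "\<And>c b. c \<in> X \<Longrightarrow> b \<noteq> 0 \<Longrightarrow> \<Psi> (\<iota> c) (\<iota> b)" and c: "c \<in> star X" and b: "b \<noteq> 0"
  shows "\<Psi> c b"
proof -
  have "\<Phi> c b" if "c \<in> X" "b \<noteq> 0" for c b
    using transfer_elem[OF tr, of "\<lambda>i. if i = 0 then c else b"] hyp[OF that] by simp
  then have *: "\<forall>x :: nat \<Rightarrow> 'a. x 0 \<in> X \<longrightarrow> \<not> x 1 = 0 \<longrightarrow> \<Phi> (x 0) (x 1)" by blast
  have "transfer_fm star (\<lambda>e. \<forall>x :: nat \<Rightarrow> 'a. x 0 \<in> X \<longrightarrow> \<not> x 1 = 0 \<longrightarrow> \<Phi> (x 0) (x 1))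
    (\<lambda>e. \<forall>x :: nat \<Rightarrow> 'b. x 0 \<in> star X \<longrightarrow> \<not> x 1 = 0 \<longrightarrow> \<Psi> (x 0) (x 1))"
    using transfer_fm_rename[OF tr, of "\<lambda>i. 2 * i + 1"]
    by (intro transfer_fm_all transfer_fm_imp transfer_fm_not transfer_fm_mem transfer_fm_eq
        transfer_tm_var transfer_tm_zero) simp
  from iffD1[OF transfer_elem[OF this] *]
  have "\<forall>x :: nat \<Rightarrow> 'b. x 0 \<in> star X \<longrightarrow> \<not> x 1 = 0 \<longrightarrow> \<Psi> (x 0) (x 1)" .
  from spec[OF this, of "\<lambda>i. if i = 0 then c else b"] show ?thesis using c b by simp
qed

lemma star_W_set:
  assumes "W_set n S"
  shows "W_set n (star S)"
proof -
  \<comment> \<open>The factor \<open>1 *\<close> matches the form of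
    \<open>W_set_scaled\<close>.\<close>
  have tr: "transfer_fm star
    (\<lambda>e. \<forall>x. \<exists>i\<in>{..n}. \<exists>s. (\<forall>j\<in>{..n} - {i}. s j \<in> S) \<and> 1 * x i = (\<Sum>j\<in>{..n} - {i}. s j * x j))
    (\<lambda>e. \<forall>x. \<exists>i\<in>{..n}. \<exists>s. (\<forall>j\<in>{..n} - {i}. s j \<in> star S) \<and> 1 * x i = (\<Sum>j\<in>{..n} - {i}. s j * x j))"
    by (intro transfer_intros finite_atMost finite_Diff)
  show ?thesis
    using transfer_elem[OF tr] W_set_scaled[OF one_neq_zero, of n S] W_set_scaled[OF one_neq_zero, of n "star S"]
      assms by simp
qed

text \<open>For standard scalars this is minimality of the weight; transfer extends it to scalars as
  small as an infinitesimal.\<close>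

lemma star_not_W_set:
  assumes "\<And>c. c \<noteq> 0 \<Longrightarrow> \<not> W_set n {y. c * y \<in> S}" and z: "z \<noteq> 0"
  shows "\<not> W_set n {y. z * y \<in> star S}"
proof -
  let ?W = "\<lambda>c. \<forall>x :: nat \<Rightarrow> 'a. \<exists>i\<in>{..n}. \<exists>s. (\<forall>j\<in>{..n} - {i}. s j \<in> S) \<and>
      c * x i = (\<Sum>j\<in>{..n} - {i}. s j * x j)"
  let ?W' = "\<lambda>c. \<forall>x :: nat \<Rightarrow> 'b. \<exists>i\<in>{..n}. \<exists>s. (\<forall>j\<in>{..n} - {i}. s j \<in> star S) \<and>
      c * x i = (\<Sum>j\<in>{..n} - {i}. s j * x j)"
  have tr: "transfer_fm star (\<lambda>e. \<forall>c. \<not> c = 0 \<longrightarrow> \<not> ?W c) (\<lambda>e. \<forall>c. \<not> c = 0 \<longrightarrow> \<not> ?W' c)"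
    by (intro transfer_intros finite_atMost finite_Diff)
  have *: "\<forall>c. \<not> c = 0 \<longrightarrow> \<not> ?W c"
  proof (intro allI impI)
    fix c :: 'a assume c: "\<not> c = 0"
    show "\<not> ?W c" using assms(1)[OF c] unfolding W_set_scaled[OF c] .
  qed
  have "\<forall>c. \<not> c = 0 \<longrightarrow> \<not> ?W' c" by (rule iffD1[OF transfer_elem[OF tr] *])
  then show ?thesis using z unfolding W_set_scaled[OF z] by simp
qed

text \<open>Encloses the ring \<open>fin S\<close>, a union over all standard scalings, in a single
  internal set.\<close>

lemma fin_subset_star_scaled:
  assumes "lb_set S" "z \<in> infinitesimal S" "x \<in> fin S"
  shows "z * x \<in> star S"
  using infinitesimal_mult[OF assms] infinitesimal_subset_star by blast

text \<open>For an infinitesimal \<open>z\<close> the set of \<open>y\<close> with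
  \<open>z * y \<in> star S\<close> contains \<open>fin S\<close> and is not a W-set for
  \<open>n\<close>. Hence there are \<open>n + 1\<close> elements none of which is a combination of
  the others over \<open>fin S\<close>.\<close>

lemma maximal_independent_family:
  assumes S: "lb_set S" and loc: "local_subring (fin S)"
    and min: "\<And>c. c \<noteq> 0 \<Longrightarrow> \<not> W_set n {y. c * y \<in> S}"
  obtains w where "local_subring.indep (fin S) {..<Suc n} w"
proof -
  interpret local_subring "fin S" by (rule loc)
  obtain z where z: "z \<noteq> 0" "z \<in> infinitesimal S" using infinitesimal_exists[OF S] by blast
  have "\<not> W_set n {y. z * y \<in> star S}" by (rule star_not_W_set[OF min z(1)])
  then obtain w :: "nat \<Rightarrow> 'b" where w: "\<And>i s. i \<le> n \<Longrightarrow> (\<And>j. j \<in> {..n} - {i} \<Longrightarrow> s j \<in> {y. z * y \<in> star S})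
      \<Longrightarrow> w i \<noteq> (\<Sum>j\<in>{..n} - {i}. s j * w j)"
    unfolding W_set_def by blast
  have "indep {..<Suc n} w"
  proof (rule indepI_span)
    fix i s assume "i \<in> {..<Suc n}" "\<And>j. j \<in> {..<Suc n} - {i} \<Longrightarrow> s j \<in> fin S"
    then show "w i \<noteq> (\<Sum>j\<in>{..<Suc n} - {i}. s j * w j)"
      unfolding lessThan_Suc_atMost using w[of i s] fin_subset_star_scaled[OF S z(2)] by auto
  qed simp
  then show thesis by (rule that)
qed

text \<open>Representatives are taken from \<open>star S\<close> to impose a uniform bound: with
  \<open>fin S\<close> in its place every \<open>c\<close> would qualify, since standard elements
  are finite.\<close>

definition dominating_set :: "'a set \<Rightarrow> 'a set" where
  "dominating_set S = {c. \<exists>s\<in>star S. \<iota> c - s \<in> local_subring.nonunits (fin S)}"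

lemma dominating_set_properties:
  assumes S: "lb_set S" and loc: "local_subring (fin S)" and W: "W_set (Suc n) S"
    and min: "\<And>c. c \<noteq> 0 \<Longrightarrow> \<not> W_set n {y. c * y \<in> S}"
  shows "vset (dominating_set S)" "lb_set (dominating_set S)" "lb_le S (dominating_set S)"
    "local_subring.nonunits (fin S) \<subseteq> infinitesimal (dominating_set S)"
proof -
  define T where "T = dominating_set S"
  interpret local_subring "fin S" by (rule loc)
  have T_def': "T = {c. \<exists>s\<in>star S. \<iota> c - s \<in> nonunits}" by (simp add: T_def dominating_set_def)
  obtain w0 where w0: "indep {..<Suc n} w0" using maximal_independent_family[OF S loc min] by blast
  define w where "w j = w0 j / w0 0" for j
  have w00: "w0 0 \<noteq> 0" by (rule indep_nonzero[OF w0]) simp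
  have w: "indep {..<Suc n} w" "w 0 = 1"
    using indep_scale[OF w0 w00] w00 by (simp_all add: w_def[abs_def])
  have v: "vset T" unfolding vset_def
  proof
    fix c
    obtain s where s: "\<And>j. j < Suc n \<Longrightarrow> s j \<in> star S"
      "\<iota> c - s 0 \<in> nonunits \<or> 1 - s 0 * \<iota> c \<in> nonunits"
      using W_set_dichotomy[OF star_W_set[OF W] star_subset_fin w(1) _ w(2) iota_fin[OF S, of c]]
      by (metis zero_less_Suc)
    from s(2) show "c \<in> T \<or> inverse c \<in> T"
    proof
      assume "\<iota> c - s 0 \<in> nonunits"
      then show ?thesis using s(1)[of 0] unfolding T_def' by auto
    next
      assume m: "1 - s 0 * \<iota> c \<in> nonunits"
      have "c \<noteq> 0" using m one_notin_nonunits by auto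
      then have "\<iota> (inverse c) * (1 - s 0 * \<iota> c) = \<iota> (inverse c) - s 0"
        by (simp add: iota_inverse iota_divide field_simps)
      then have "\<iota> (inverse c) - s 0 \<in> nonunits"
        using nonunits_mult[OF iota_fin[OF S, of "inverse c"] m] by simp
      then show ?thesis using s(1)[of 0] unfolding T_def' by auto
    qed
  qed
  \<comment> \<open>\<open>T\<close> is defined through the nonunits, which are not internal, so the
    definition does not carry over to \<open>star T\<close>. What transfers is that some
    \<open>c - s\<close> has no inverse in \<open>b * S\<close>, for each standard nonzero
    \<open>b\<close>; at \<open>b = inverse z\<close> this excludes every inverse in
    \<open>fin S\<close>. Since \<open>c - s\<close> may lie outside \<open>fin S\<close>, the
    conclusion is only that it is not a unit.\<close>
  have key: "\<exists>s\<in>star S. \<not> unit_in (fin S) (c - s)" if c: "c \<in> star T" for c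
  proof -
    obtain z where z: "z \<noteq> 0" "z \<in> infinitesimal S" using infinitesimal_exists[OF S] by blast
    have "\<exists>s\<in>star S. \<forall>t\<in>star S. \<not> (c - s) * inverse z * t = 1"
    proof (rule transfer_binary[where X = T and b = "inverse z"
        and \<Phi> = "\<lambda>c b. \<exists>s\<in>S. \<forall>t\<in>S. \<not> (c - s) * b * t = 1"
        and \<Psi> = "\<lambda>c b. \<exists>s\<in>star S. \<forall>t\<in>star S. \<not> (c - s) * b * t = 1"])
      show "transfer_fm star (\<lambda>e. \<exists>s\<in>S. \<forall>t\<in>S. \<not> (e 0 - s) * e 1 * t = 1)
        (\<lambda>e. \<exists>s\<in>star S. \<forall>t\<in>star S. \<not> (e 0 - s) * e 1 * t = 1)"
        by (intro transfer_intros)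
      fix c b assume "c \<in> T"
      then obtain s where s: "s \<in> star S" "\<iota> c - s \<in> nonunits" unfolding T_def' by blast
      have "(\<iota> c - s) * \<iota> b * t \<noteq> 1" if t: "t \<in> star S" for t
      proof -
        have "\<iota> b * t \<in> fin S" using fin_mult[OF S iota_fin[OF S]] t star_subset_fin by blast
        from nonunits_mult[OF this s(2)] have "(\<iota> c - s) * \<iota> b * t \<in> nonunits" by (simp add: mult_ac)
        then show ?thesis using one_notin_nonunits by metis
      qed
      then show "\<exists>s\<in>star S. \<forall>t\<in>star S. \<not> (\<iota> c - s) * \<iota> b * t = 1" using s(1) by blast
    qed (use c z in auto)
    then obtain s where s: "s \<in> star S" "\<And>t. t \<in> star S \<Longrightarrow> (c - s) * inverse z * t \<noteq> 1" by blast
    have "\<not> unit_in (fin S) (c - s)"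
    proof
      assume u: "unit_in (fin S) (c - s)"
      then have "z * inverse (c - s) \<in> star S" using fin_subset_star_scaled[OF S z(2)] by (simp add: unit_in_def)
      from s(2)[OF this] show False using u by (simp add: unit_in_def inverse_cancel[OF z(1)])
    qed
    then show ?thesis using s(1) by blast
  qed
  have inf_nonunit: "x \<in> nonunits" if x: "x \<in> infinitesimal S" for x
  proof -
    have "\<not> unit_in (fin S) x"
      using infinitesimal_mult[OF S x, of "inverse x"] one_not_infinitesimal[OF S] by (auto simp: unit_in_def)
    moreover have "x \<in> fin S" using x infinitesimal_subset_star star_subset_fin by blast
    ultimately show ?thesis by (simp add: nonunits_def)
  qed
  \<comment> \<open>Otherwise \<open>inverse z\<close> lies in \<open>star T\<close>. But
    \<open>inverse z - s\<close> is \<open>inverse z\<close> times the unit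
    \<open>1 - z * s\<close>, so its inverse is in \<open>fin S\<close>, contrary to
    \<open>key\<close>.\<close>
  have "T \<noteq> UNIV"
  proof
    assume T: "T = UNIV"
    obtain z where z: "z \<noteq> 0" "z \<in> infinitesimal S" using infinitesimal_exists[OF S] by blast
    obtain s where s: "s \<in> star S" "\<not> unit_in (fin S) (inverse z - s)"
      using key[of "inverse z"] T star_UNIV by auto
    have "z * s \<in> infinitesimal S" using infinitesimal_mult[OF S z(2)] s(1) star_subset_fin by blast
    then have u: "unit_in (fin S) (1 - z * s)" by (intro unit_one_minus inf_nonunit)
    have eq: "inverse z - s = (1 - z * s) * inverse z" using z(1) by (simp add: field_simps)
    have "z * inverse (1 - z * s) \<in> fin S"
      using u fin_mult[OF S] z(2) infinitesimal_subset_star star_subset_fin unfolding unit_in_def by blast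
    then have "unit_in (fin S) (inverse z - s)"
      unfolding eq using u z(1) by (simp add: unit_in_def mult.commute)
    then show False using s(2) by simp
  qed
  moreover have "\<exists>k. k \<noteq> 0 \<and> (\<forall>x\<in>T. \<forall>y\<in>T. k * (x + y) \<in> T)"
  proof -
    obtain k where k: "k \<noteq> 0" "\<And>x y. x \<in> S \<Longrightarrow> y \<in> S \<Longrightarrow> k * (x + y) \<in> S"
      using lb_set_addE[OF S] by metis
    have "k * (x + y) \<in> T" if xy: "x \<in> T" "y \<in> T" for x y
    proof -
      obtain s t where s: "s \<in> star S" "\<iota> x - s \<in> nonunits" and t: "t \<in> star S" "\<iota> y - t \<in> nonunits"
        using xy unfolding T_def' by blast
      have "\<iota> k * ((\<iota> x - s) + (\<iota> y - t)) \<in> nonunits"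
        by (intro nonunits_mult nonunits_add s t iota_fin S)
      then have "\<iota> (k * (x + y)) - \<iota> k * (s + t) \<in> nonunits"
        by (simp add: iota_mult iota_add algebra_simps)
      then show ?thesis unfolding T_def' using star_add[OF k(2) s(1) t(1)] by blast
    qed
    then show ?thesis using k(1) by blast
  qed
  moreover have "\<exists>k. k \<noteq> 0 \<and> (\<forall>x\<in>T. \<forall>y\<in>T. k * (x * y) \<in> T)"
  proof -
    obtain k where k: "k \<noteq> 0" "\<And>x y. x \<in> S \<Longrightarrow> y \<in> S \<Longrightarrow> k * (x * y) \<in> S"
      using lb_set_multE[OF S] by metis
    have "k * (x * y) \<in> T" if xy: "x \<in> T" "y \<in> T" for x y
    proof -
      obtain s t where s: "s \<in> star S" "\<iota> x - s \<in> nonunits" and t: "t \<in> star S" "\<iota> y - t \<in> nonunits"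
        using xy unfolding T_def' by blast
      have "t \<in> fin S" using t(1) star_subset_fin by blast
      then have "\<iota> k * (\<iota> x * (\<iota> y - t) + t * (\<iota> x - s)) \<in> nonunits"
        by (intro nonunits_mult nonunits_add s t iota_fin S)
      then have "\<iota> (k * (x * y)) - \<iota> k * (s * t) \<in> nonunits"
        by (simp add: iota_mult algebra_simps)
      then show ?thesis unfolding T_def' using star_mult[OF k(2) s(1) t(1)] by blast
    qed
    then show ?thesis using k(1) by blast
  qed
  moreover have "\<exists>k. k \<noteq> 0 \<and> (\<forall>x\<in>T. k * (- x) \<in> T)"
  proof -
    obtain k where k: "k \<noteq> 0" "\<And>x. x \<in> S \<Longrightarrow> k * (- x) \<in> S" using lb_set_negE[OF S] by metis
    have "k * (- x) \<in> T" if x: "x \<in> T" for x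
    proof -
      obtain s where s: "s \<in> star S" "\<iota> x - s \<in> nonunits" using x unfolding T_def' by blast
      have "\<iota> (- k) * (\<iota> x - s) \<in> nonunits" by (intro nonunits_mult s iota_fin S)
      then have "\<iota> (k * (- x)) - \<iota> (- k) * s \<in> nonunits"
        by (simp add: iota_mult iota_minus algebra_simps)
      moreover have "\<iota> (- k) * s \<in> star S" by (rule star_scale[OF _ s(1)]) (use k(2) in simp)
      ultimately show ?thesis unfolding T_def' by blast
    qed
    then show ?thesis using k(1) by blast
  qed
  ultimately have lb: "lb_set T" by (intro lb_set_vsetI[OF v])
  have le: "lb_le S T" unfolding lb_le_def
  proof (intro exI[of _ 1] conjI ballI)
    fix x assume "x \<in> S"
    then show "1 * x \<in> T" unfolding T_def' using zero_nonunits by (auto intro!: bexI[of _ "\<iota> x"])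
  qed simp
  \<comment> \<open>If \<open>inverse y\<close> were finite for \<open>T\<close>, then
    \<open>a / y\<close> would be in \<open>star T\<close> for some standard
    \<open>a \<noteq> 0\<close>. Subtracting \<open>s\<close> from it amounts to multiplying it by
    the unit \<open>q\<close>, and the product has its inverse in \<open>fin S\<close>, contrary to
    \<open>key\<close>.\<close>
  have dom: "nonunits \<subseteq> infinitesimal T"
  proof
    fix y assume y: "y \<in> nonunits"
    show "y \<in> infinitesimal T" unfolding infinitesimal_iff_vset[OF lb v]
    proof (rule ccontr)
      assume "\<not> (y = 0 \<or> inverse y \<notin> fin T)"
      then obtain a where y0: "y \<noteq> 0" and a: "a \<noteq> 0" "\<iota> a * inverse y \<in> star T" unfolding fin_def by blast
      obtain s where s: "s \<in> star S" "\<not> unit_in (fin S) (\<iota> a * inverse y - s)" using key[OF a(2)] by blast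
      have "s * \<iota> (inverse a) \<in> fin S" using s(1) star_subset_fin fin_mult[OF S _ iota_fin[OF S]] by blast
      then have u: "unit_in (fin S) (1 - s * \<iota> (inverse a) * y)" by (intro unit_one_minus nonunits_mult y)
      define q where "q = 1 - s * \<iota> (inverse a) * y"
      have eq: "\<iota> a * inverse y - s = \<iota> a * inverse y * q"
        using y0 a(1) by (simp add: q_def iota_inverse iota_divide field_simps)
      have "inverse (\<iota> a * inverse y * q) = \<iota> (inverse a) * y * inverse q"
        by (simp add: iota_inverse)
      moreover have "\<iota> (inverse a) * y * inverse q \<in> fin S"
        using u nonunits_subset[OF y] by (intro fin_mult[OF S] iota_fin[OF S]) (auto simp: unit_in_def q_def)
      moreover have "\<iota> a * inverse y * q \<noteq> 0" using u a(1) y0 by (auto simp: unit_in_def q_def)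
      ultimately have "unit_in (fin S) (\<iota> a * inverse y - s)" unfolding eq unit_in_def by simp
      then show False using s(2) by simp
    qed
  qed
  show "vset (dominating_set S)" "lb_set (dominating_set S)" "lb_le S (dominating_set S)"
    "local_subring.nonunits (fin S) \<subseteq> infinitesimal (dominating_set S)"
    using v lb le dom unfolding T_def by auto
qed

end

section \<open>Uniqueness of the V-coarsening of a local W-topology\<close>

context monster
begin

text \<open>In terms of the valuation with ring \<open>fin T\<close>, the member \<open>w i\<close>
  has least value.\<close>

lemma vset_minimal_value:
  assumes T: "lb_set T" "vset T" and "finite J" "J \<noteq> {}" and nz: "\<And>j. j \<in> J \<Longrightarrow> w j \<noteq> 0"
  shows "\<exists>i\<in>J. \<forall>j\<in>J. w j * inverse (w i) \<in> fin T"
  using \<open>finite J\<close> \<open>J \<noteq> {}\<close> nz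
proof (induction rule: finite_ne_induct)
  case (singleton x)
  then show ?case using fin_one[OF T(1)] by simp
next
  case (insert y J)
  then obtain i where i: "i \<in> J" "\<And>j. j \<in> J \<Longrightarrow> w j * inverse (w i) \<in> fin T" by auto
  have nz: "w i \<noteq> 0" "w y \<noteq> 0" using insert.prems i(1) by auto
  consider "w y * inverse (w i) \<in> fin T" | "w i * inverse (w y) \<in> fin T"
    using vset_fin[OF T, of "w y * inverse (w i)"] by (auto simp: mult.commute)
  then show ?case
  proof cases
    case 1
    then show ?thesis using i by blast
  next
    case 2
    have "w j * inverse (w y) \<in> fin T" if j: "j \<in> insert y J" for j
    proof (cases "j = y")
      case True
      then show ?thesis using nz fin_one[OF T(1)] by simp
    next
      case False
      then have "w j * inverse (w i) * (w i * inverse (w y)) \<in> fin T"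
        using fin_mult[OF T(1) i(2) 2] j by blast
      then show ?thesis by (simp only: inverse_cancel[OF nz(1)])
    qed
    then show ?thesis by blast
  qed
qed

text \<open>Each of the two valuations excludes at most one \<open>c\<close> of the ground field.\<close>

lemma common_minimal_coefficient:
  fixes S :: "'a set"
  assumes S: "lb_set S" and T0: "lb_set T0" "vset T0" and T1: "lb_set T1" "vset T1"
    and a: "a \<in> fin T0" and b: "b \<in> fin T1"
  obtains c where "inverse (1 + \<iota> c * a) \<in> fin T0" "1 + \<iota> c * a \<noteq> 0"
    "inverse (b + \<iota> c) \<in> fin T1" "b + \<iota> c \<noteq> 0"
proof -
  have iota_not_inf: "\<iota> x \<notin> infinitesimal T" if T: "lb_set T" and x: "x \<noteq> 0" for x T
  proof
    assume "\<iota> x \<in> infinitesimal T"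
    from infinitesimal_mult[OF T this iota_fin[OF T, of "inverse x"]] have "1 \<in> infinitesimal T"
      using x by (simp add: iota_inverse)
    then show False using one_not_infinitesimal[OF T] by simp
  qed
  have inf_diff: "x - y \<in> infinitesimal T" if T: "lb_set T" and xy: "x \<in> infinitesimal T" "y \<in> infinitesimal T"
    for x y T
    using infinitesimal_add[OF T xy(1) infinitesimal_mult[OF T xy(2) fin_uminus[OF T fin_one[OF T]]]]
    by simp
  have bad1: "c = c'" if cc: "b + \<iota> c \<in> infinitesimal T1" "b + \<iota> c' \<in> infinitesimal T1" for c c'
  proof (rule ccontr)
    assume "c \<noteq> c'"
    moreover have "(b + \<iota> c) - (b + \<iota> c') = \<iota> (c - c')"
      using iota_add[of "c - c'" c'] by simp
    ultimately show False using inf_diff[OF T1(1) cc] iota_not_inf[OF T1(1), of "c - c'"] by simp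
  qed
  \<comment> \<open>Two excluded values make \<open>(c - c') * a\<close> infinitesimal, hence also
    \<open>c * a\<close>, and then 1.\<close>
  have bad0: "c = c'" if cc: "1 + \<iota> c * a \<in> infinitesimal T0" "1 + \<iota> c' * a \<in> infinitesimal T0" for c c'
  proof (rule ccontr)
    assume neq: "c \<noteq> c'"
    have "(1 + \<iota> c * a) - (1 + \<iota> c' * a) = \<iota> (c - c') * a"
      using iota_add[of "c - c'" c'] by (simp add: algebra_simps)
    then have "\<iota> (c - c') * a \<in> infinitesimal T0" using inf_diff[OF T0(1) cc] by simp
    from infinitesimal_mult[OF T0(1) this iota_fin[OF T0(1), of "inverse (c - c') * c"]]
    have "\<iota> (c - c') * a * \<iota> (inverse (c - c') * c) \<in> infinitesimal T0" .
    also have "\<iota> (c - c') * a * \<iota> (inverse (c - c') * c) = \<iota> c * a"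
    proof -
      have "\<iota> (c - c') * \<iota> (inverse (c - c') * c) = \<iota> c"
        using neq by (simp flip: iota_mult)
      then show ?thesis by (metis mult.assoc mult.commute)
    qed
    finally have "1 \<in> infinitesimal T0" using inf_diff[OF T0(1) cc(1), of "\<iota> c * a"] by simp
    then show False using one_not_infinitesimal[OF T0(1)] by simp
  qed
  \<comment> \<open>Three candidates suffice, and properness of \<open>S\<close> supplies one
    besides 0 and 1.\<close>
  obtain d where d: "d \<notin> S" using lb_set_proper[OF S] by auto
  have distinct: "d \<noteq> 0" "d \<noteq> 1" using d lb_set_zero[OF S] lb_set_one[OF S] by auto
  have "\<exists>c\<in>{0, 1, d}. 1 + \<iota> c * a \<notin> infinitesimal T0 \<and> b + \<iota> c \<notin> infinitesimal T1"
  proof (rule ccontr)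
    assume "\<not> ?thesis"
    then have all: "1 + \<iota> c * a \<in> infinitesimal T0 \<or> b + \<iota> c \<in> infinitesimal T1" if "c \<in> {0, 1, d}" for c
      using that by blast
    show False using all[of 0] all[of 1] all[of d] bad0[of 0 1] bad0[of 0 d] bad0[of 1 d]
        bad1[of 0 1] bad1[of 0 d] bad1[of 1 d] distinct by auto
  qed
  then obtain c where "1 + \<iota> c * a \<notin> infinitesimal T0" "b + \<iota> c \<notin> infinitesimal T1" by blast
  then show thesis
    using that unfolding infinitesimal_iff_vset[OF T0] infinitesimal_iff_vset[OF T1] by blast
qed

text \<open>Division by a member of least value makes all quotients integral. If the two valuations
  single out different members, then \<open>v i0 + c * v i1\<close> with a suitable standard
  \<open>c\<close> has least value for both, and replacing \<open>v i0\<close> by it keeps the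
  family independent.\<close>

lemma normalized_independent_family:
  assumes S: "lb_set S" and loc: "local_subring (fin S)"
    and T0: "lb_set T0" "vset T0" and T1: "lb_set T1" "vset T1"
    and v: "local_subring.indep (fin S) {..<Suc n} v"
  obtains w k where "local_subring.indep (fin S) {..<Suc n} w" "k < Suc n" "w k = 1"
    "\<And>j. j < Suc n \<Longrightarrow> w j \<in> fin T0" "\<And>j. j < Suc n \<Longrightarrow> w j \<in> fin T1"
proof -
  interpret local_subring "fin S" by (rule loc)
  have nz: "v j \<noteq> 0" if "j \<in> {..<Suc n}" for j using indep_nonzero[OF v that] .
  have ne: "finite {..<Suc n}" "{..<Suc n} \<noteq> {}" by auto
  obtain i0 where i0: "i0 \<in> {..<Suc n}" "\<And>j. j \<in> {..<Suc n} \<Longrightarrow> v j * inverse (v i0) \<in> fin T0"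
    using vset_minimal_value[where w = v, OF T0 ne nz] by auto
  obtain i1 where i1: "i1 \<in> {..<Suc n}" "\<And>j. j \<in> {..<Suc n} \<Longrightarrow> v j * inverse (v i1) \<in> fin T1"
    using vset_minimal_value[where w = v, OF T1 ne nz] by auto
  have nz0: "v i0 \<noteq> 0" and nz1: "v i1 \<noteq> 0" using nz i0(1) i1(1) by auto
  have "\<exists>v'. indep {..<Suc n} v' \<and> v' i0 \<noteq> 0 \<and> (\<forall>j<Suc n. v' j * inverse (v' i0) \<in> fin T0) \<and>
      (\<forall>j<Suc n. v' j * inverse (v' i0) \<in> fin T1)"
  proof (cases "i0 = i1")
    case True
    then show ?thesis using v nz0 i0(2) i1(2) by (intro exI[of _ v]) auto
  next
    case False
    define a where "a = v i1 * inverse (v i0)"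
    define b where "b = v i0 * inverse (v i1)"
    obtain c where c: "inverse (1 + \<iota> c * a) \<in> fin T0" "1 + \<iota> c * a \<noteq> 0"
      "inverse (b + \<iota> c) \<in> fin T1" "b + \<iota> c \<noteq> 0"
      using common_minimal_coefficient[OF S T0 T1, of a b] i0(2)[OF i1(1)] i1(2)[OF i0(1)]
      unfolding a_def b_def by blast
    define u where "u = v i0 + \<iota> c * v i1"
    define v' where "v' = v(i0 := u)"
    have u0: "u = v i0 * (1 + \<iota> c * a)" and u1: "u = v i1 * (b + \<iota> c)"
      using nz0 nz1 by (simp_all add: u_def a_def b_def field_simps)
    have iv: "indep {..<Suc n} v'"
      unfolding v'_def u_def by (rule indep_replace[OF v _ i0(1) i1(1) False iota_fin[OF S]]) simp
    have unz: "u \<noteq> 0" using u0 nz0 c(2) by simp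
    have "v' j * inverse (v' i0) \<in> fin T"
      if T: "lb_set T" and u: "u = v i * q" "inverse q \<in> fin T"
        and i: "\<And>j. j \<in> {..<Suc n} \<Longrightarrow> v j * inverse (v i) \<in> fin T" and j: "j < Suc n" for T i q j
    proof (cases "j = i0")
      case True
      then show ?thesis using unz fin_one[OF T] by (simp add: v'_def)
    next
      case False
      have "v j * inverse (v i) * inverse q \<in> fin T" using fin_mult[OF T i u(2)] j by blast
      then show ?thesis using False by (simp add: v'_def u(1) mult.assoc)
    qed
    from this[OF T0(1) u0 c(1) i0(2)] this[OF T1(1) u1 c(3) i1(2)]
    have "\<forall>j<Suc n. v' j * inverse (v' i0) \<in> fin T0" "\<forall>j<Suc n. v' j * inverse (v' i0) \<in> fin T1"
      by blast+
    then show ?thesis using iv unz by (intro exI[of _ v']) (auto simp: v'_def)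
  qed
  then obtain v' where v': "indep {..<Suc n} v'" "v' i0 \<noteq> 0"
    "\<And>j. j < Suc n \<Longrightarrow> v' j * inverse (v' i0) \<in> fin T0" "\<And>j. j < Suc n \<Longrightarrow> v' j * inverse (v' i0) \<in> fin T1"
    by blast
  show thesis
    by (rule that[of "\<lambda>j. v' j / v' i0" i0])
      (use indep_scale[OF v'(1,2)] v'(2-4) i0(1) in \<open>auto simp: divide_inverse\<close>)
qed

lemma star_Int: "star (X \<inter> Y) = star X \<inter> star Y"
proof -
  have tr: "transfer_fm star (\<lambda>e. \<forall>x. (x \<in> X \<inter> Y \<longrightarrow> x \<in> X \<and> x \<in> Y) \<and> (x \<in> X \<longrightarrow> x \<in> Y \<longrightarrow> x \<in> X \<inter> Y))
    (\<lambda>e. \<forall>x. (x \<in> star (X \<inter> Y) \<longrightarrow> x \<in> star X \<and> x \<in> star Y) \<and> (x \<in> star X \<longrightarrow> x \<in> star Y \<longrightarrow> x \<in> star (X \<inter> Y)))"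
    by (intro transfer_fm_all1 transfer_fm_conj transfer_fm_imp transfer_fm_mem transfer_tm_var)
  have "\<forall>x. (x \<in> X \<inter> Y \<longrightarrow> x \<in> X \<and> x \<in> Y) \<and> (x \<in> X \<longrightarrow> x \<in> Y \<longrightarrow> x \<in> X \<inter> Y)" by blast
  from iffD1[OF transfer_elem[OF tr] this] show ?thesis by blast
qed

text \<open>Any \<open>c\<close> in the maximal ideal of the dominating valuation ring lies in \<open>R + M A\<close>, where \<open>M\<close>
  is the maximal ideal of \<open>R = fin S\<close> and \<open>A\<close> the intersection of the two valuation rings: this
  holds for standard \<open>c\<close> with uniform bounds, hence transfers.\<close>

lemma infinitesimal_subset_fin_coarsening:
  assumes S: "lb_set S" and loc: "local_subring (fin S)" and W: "W_set (Suc n) S"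
    and min: "\<And>c. c \<noteq> 0 \<Longrightarrow> \<not> W_set n {y. c * y \<in> S}"
    and T0: "lb_set T0" "vset T0" "lb_le S T0" and dom: "local_subring.nonunits (fin S) \<subseteq> infinitesimal T0"
    and T1: "lb_set T1" "vset T1" "lb_le S T1"
  shows "infinitesimal T0 \<subseteq> fin T1"
proof
  interpret local_subring "fin S" by (rule loc)
  fix c assume c: "c \<in> infinitesimal T0"
  obtain v where v: "indep {..<Suc n} v" using maximal_independent_family[OF S loc min] by blast
  obtain w k where w: "indep {..<Suc n} w" and k: "k < Suc n" "w k = 1"
    and w0: "\<And>j. j < Suc n \<Longrightarrow> w j \<in> fin T0" and w1: "\<And>j. j < Suc n \<Longrightarrow> w j \<in> fin T1"
    using normalized_independent_family[OF S loc T0(1,2) T1(1,2) v] by blast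
  define J where "J = {..<Suc n} - {k}"
  have J: "finite J" by (simp add: J_def)
  obtain a0 where a0: "a0 \<noteq> 0" "\<And>j. j \<in> J \<Longrightarrow> \<iota> a0 * w j \<in> star T0"
    using fin_common[OF T0(1) J, of w] w0 by (auto simp: J_def)
  obtain a1 where a1: "a1 \<noteq> 0" "\<And>j. j \<in> J \<Longrightarrow> \<iota> a1 * w j \<in> star T1"
    using fin_common[OF T1(1) J, of w] w1 by (auto simp: J_def)
  \<comment> \<open>A subset of \<open>K\<close> whose extension contains the \<open>w j\<close> and
    lies in both valuation rings, so that both bounds survive transfer.\<close>
  define X where "X = {y. a0 * y \<in> T0} \<inter> {y. a1 * y \<in> T1}"
  have starX: "x \<in> star X \<longleftrightarrow> \<iota> a0 * x \<in> star T0 \<and> \<iota> a1 * x \<in> star T1" for x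
    by (simp add: X_def star_Int star_scaled_iff)
  obtain z where z: "z \<noteq> 0" "z \<in> infinitesimal S" using infinitesimal_exists[OF S] by blast
  \<comment> \<open>The family \<open>w\<close> is nonstandard and cannot be a parameter of a
    formula over \<open>K\<close>; it is quantified over, with \<open>X\<close> as bound. The clause
    about \<open>s j * b * t\<close> stands in for \<open>s j\<close> being a nonunit.\<close>
  let ?\<Phi> = "\<lambda>c b. \<exists>w s. (\<forall>j\<in>J. w j \<in> X) \<and> (\<forall>j\<in>J. s j \<in> S) \<and> s k \<in> S \<and>
      (\<forall>j\<in>J. \<forall>t\<in>S. \<not> s j * b * t = 1) \<and>
      (c = s k + (\<Sum>j\<in>J. s j * w j) \<or> 1 = s k * c + (\<Sum>j\<in>J. s j * w j))"
  let ?\<Psi> = "\<lambda>c b. \<exists>w s. (\<forall>j\<in>J. w j \<in> star X) \<and> (\<forall>j\<in>J. s j \<in> star S) \<and> s k \<in> star S \<and>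
      (\<forall>j\<in>J. \<forall>t\<in>star S. \<not> s j * b * t = 1) \<and>
      (c = s k + (\<Sum>j\<in>J. s j * w j) \<or> 1 = s k * c + (\<Sum>j\<in>J. s j * w j))"
  have "?\<Psi> c (inverse z)"
  proof (rule transfer_binary[where X = UNIV and b = "inverse z" and \<Phi> = ?\<Phi> and \<Psi> = ?\<Psi>])
    show "transfer_fm star (\<lambda>e. ?\<Phi> (e 0) (e 1)) (\<lambda>e. ?\<Psi> (e 0) (e 1))"
      by (intro transfer_intros J)
    fix c b
    obtain s where s: "\<And>j. j < Suc n \<Longrightarrow> s j \<in> star S" "\<And>j. j \<in> J \<Longrightarrow> s j \<in> nonunits"
      and s_eq: "\<iota> c = s k + (\<Sum>j\<in>J. s j * w j) \<or> 1 = s k * \<iota> c + (\<Sum>j\<in>J. s j * w j)"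
    proof (rule W_set_dichotomy[OF star_W_set[OF W] star_subset_fin w k iota_fin[OF S, of c], folded J_def])
      fix s assume 1: "\<And>j. j < Suc n \<Longrightarrow> s j \<in> star S" and 2: "\<And>j. j \<in> J \<Longrightarrow> s j \<in> nonunits"
        and "\<iota> c - s k \<in> nonunits \<and> \<iota> c = s k + (\<Sum>j\<in>J. s j * w j) \<or>
          1 - s k * \<iota> c \<in> nonunits \<and> 1 = s k * \<iota> c + (\<Sum>j\<in>J. s j * w j)"
      then have "\<iota> c = s k + (\<Sum>j\<in>J. s j * w j) \<or> 1 = s k * \<iota> c + (\<Sum>j\<in>J. s j * w j)"
        by (elim disjE conjE) (rule disjI1, assumption, rule disjI2)
      from that[OF 1 2 this] show thesis .
    qed
    have not_one: "s j * \<iota> b * t \<noteq> 1" if j: "j \<in> J" and t: "t \<in> star S" for j t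
    proof -
      have "\<iota> b * t \<in> fin S" using fin_mult[OF S iota_fin[OF S]] t star_subset_fin by blast
      from nonunits_mult[OF this s(2)[OF j]] have "s j * \<iota> b * t \<in> nonunits" by (simp add: mult_ac)
      then show ?thesis using one_notin_nonunits by metis
    qed
    have s_star: "s j \<in> star S" if "j \<in> J" for j using s(1) that by (simp add: J_def)
    have w_star: "w j \<in> star X" if "j \<in> J" for j using a0(2) a1(2) that by (simp add: starX)
    show "?\<Psi> (\<iota> c) (\<iota> b)"
      by (intro exI[of _ w] exI[of _ s] conjI ballI w_star s_star s(1)[OF k(1)] not_one s_eq)
  qed (use z star_UNIV in auto)
  then obtain w s where w: "\<And>j. j \<in> J \<Longrightarrow> w j \<in> star X" and s: "\<And>j. j \<in> J \<Longrightarrow> s j \<in> star S"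
    and sk: "s k \<in> star S" and small: "\<And>j t. j \<in> J \<Longrightarrow> t \<in> star S \<Longrightarrow> s j * inverse z * t \<noteq> 1"
    and eq: "c = s k + (\<Sum>j\<in>J. s j * w j) \<or> 1 = s k * c + (\<Sum>j\<in>J. s j * w j)"
    by blast
  have w_fin: "w j \<in> fin T0" "w j \<in> fin T1" if "j \<in> J" for j
    using w[OF that] a0(1) a1(1) unfolding starX by (auto intro: finI)
  have s_nonunit: "s j \<in> nonunits" if j: "j \<in> J" for j
  proof (rule ccontr)
    have sR: "s j \<in> fin S" using s[OF j] star_subset_fin by blast
    assume "s j \<notin> nonunits"
    then have u: "unit_in (fin S) (s j)" using unit_if_not_nonunit[OF sR] by simp
    then have "z * inverse (s j) \<in> star S" using fin_subset_star_scaled[OF S z(2)] by (simp add: unit_in_def)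
    from small[OF j this] show False using u by (simp add: unit_in_def inverse_cancel[OF z(1)])
  qed
  have S_T0: "fin S \<subseteq> fin T0" and S_T1: "fin S \<subseteq> fin T1" using fin_mono T0(3) T1(3) by auto
  \<comment> \<open>For \<open>c\<close> in the maximal ideal of \<open>fin T0\<close> the second
    alternative would make 1 infinitesimal for \<open>T0\<close>: the coefficients
    \<open>s j\<close> are dominated nonunits and the \<open>w j\<close> are finite.\<close>
  have "1 \<noteq> s k * c + (\<Sum>j\<in>J. s j * w j)"
  proof
    assume *: "1 = s k * c + (\<Sum>j\<in>J. s j * w j)"
    have "(\<Sum>j\<in>J. s j * w j) \<in> infinitesimal T0"
    proof (rule infinitesimal_sum[OF T0(1)])
      fix j assume "j \<in> J"
      then show "s j * w j \<in> infinitesimal T0"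
        using infinitesimal_mult[OF T0(1)] dom s_nonunit w_fin by blast
    qed
    moreover have "c * s k \<in> infinitesimal T0"
      using infinitesimal_mult[OF T0(1) c] sk star_subset_fin S_T0 by blast
    ultimately have "1 \<in> infinitesimal T0" using infinitesimal_add[OF T0(1)] * by (metis mult.commute)
    then show False using one_not_infinitesimal[OF T0(1)] by simp
  qed
  then have c_eq: "c = s k + (\<Sum>j\<in>J. s j * w j)" using eq by blast
  have "star S \<subseteq> fin T1" using star_subset_fin[of S] S_T1 by blast
  then have "s k + (\<Sum>j\<in>J. s j * w j) \<in> fin T1"
    using sk s w_fin(2) by (intro fin_add fin_sum fin_mult T1(1)) auto
  then show "c \<in> fin T1" using c_eq by simp
qed

text \<open>That the infinitesimals of the dominating set are finite for \<open>T\<close> already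
  yields one comparison; the other follows because V-topologies are minimal.\<close>

lemma V_coarsening_set_unique:
  assumes S: "lb_set S" and loc: "local_subring (fin S)" and W: "W_set (Suc n) S"
    and min: "\<And>c. c \<noteq> 0 \<Longrightarrow> \<not> W_set n {y. c * y \<in> S}"
    and T: "lb_set T" "vset T" "lb_le S T"
  shows "lb_le (dominating_set S) T" "lb_le T (dominating_set S)"
proof -
  note D = dominating_set_properties[OF S loc W min]
  have sub: "infinitesimal (dominating_set S) \<subseteq> fin T"
    by (rule infinitesimal_subset_fin_coarsening[OF S loc W min D(2,1,3,4) T])
  obtain z where z: "z \<noteq> 0" "z \<in> infinitesimal S" using infinitesimal_exists[OF S] by blast
  have zD: "z \<in> infinitesimal (dominating_set S)" and zT: "z \<in> infinitesimal T"
    using z(2) infinitesimal_mono D(3) T(3) by auto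
  show le: "lb_le (dominating_set S) T"
  \<comment> \<open>One factor \<open>z\<close> moves \<open>star (dominating_set S)\<close> into
    the infinitesimals of the dominating set, hence into \<open>fin T\<close>; the other moves
    \<open>fin T\<close> into \<open>star T\<close>.\<close>
  proof (rule lb_leI_infinitesimal[of "z * z"])
    fix x assume "x \<in> star (dominating_set S)"
    then have "z * x \<in> fin T"
      using infinitesimal_mult[OF D(2) zD] star_subset_fin sub by blast
    then show "z * z * x \<in> star T"
      using fin_subset_star_scaled[OF T(1) zT] by (simp add: mult.assoc)
  qed (use z in simp)
  show "lb_le T (dominating_set S)" by (rule vset_lb_le_sym[OF D(2,1) T(1,2) le])
qed

end

section \<open>Localizations at maximal ideals\<close>

text \<open>Zorn's lemma; properness of an ideal is expressed by \<open>\<one> \<notin> I\<close>,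
  which survives unions of chains.\<close>

lemma (in cring) exists_maximalideal_above:
  assumes N: "ideal N R" "N \<noteq> carrier R"
  obtains M where "maximalideal M R" "N \<subseteq> M"
proof -
  define \<A> where "\<A> = {I. ideal I R \<and> N \<subseteq> I \<and> \<one> \<notin> I}"
  have "N \<in> \<A>" using N ideal.one_imp_carrier[OF N(1)] by (auto simp: \<A>_def)
  moreover have "\<Union>C \<in> \<A>" if C: "C \<noteq> {}" "subset.chain \<A> C" for C
  proof -
    have "subset.chain {I. ideal I R} C" using C(2) unfolding subset.chain_def by (auto simp: \<A>_def)
    from chain_Union_is_ideal[OF this] have "ideal (\<Union>C) R" using C(1) by simp
    moreover have "C \<subseteq> \<A>" using C(2) unfolding subset.chain_def by auto
    ultimately show ?thesis using C(1) unfolding \<A>_def by fastforce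
  qed
  ultimately obtain M where M: "M \<in> \<A>" "\<And>X. X \<in> \<A> \<Longrightarrow> M \<subseteq> X \<Longrightarrow> X = M"
    using subset_Zorn_nonempty[of \<A>] by blast
  have "maximalideal M R"
  proof (rule maximalidealI)
    show "ideal M R" using M(1) by (simp add: \<A>_def)
    show "carrier R \<noteq> M" using M(1) by (auto simp: \<A>_def)
    fix J assume J: "ideal J R" "M \<subseteq> J" "J \<subseteq> carrier R"
    show "J = M \<or> J = carrier R"
    proof (cases "\<one> \<in> J")
      case True
      then show ?thesis using ideal.one_imp_carrier[OF J(1)] by simp
    next
      case False
      then have "J \<in> \<A>" using J M(1) by (auto simp: \<A>_def)
      then show ?thesis using M(2) J(2) by blast
    qed
  qed
  then show thesis using that M(1) by (auto simp: \<A>_def)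
qed

section \<open>Ideals and localizations of a subring as plain subsets of the field\<close>

context field_subring
begin

lemma cring_record: "cring (subring_record R)"
proof (rule cringI)
  show "abelian_group (subring_record R)"
    by (rule abelian_groupI) (auto simp: subring_record_def add zero uminus add.assoc add.commute
        intro!: bexI[of _ "- _"])
  show "comm_monoid (subring_record R)"
    by (rule comm_monoidI) (auto simp: subring_record_def mult one mult.assoc mult.commute)
qed (auto simp: subring_record_def algebra_simps)

lemma ideal_record_iff:
  "ideal I (subring_record R) \<longleftrightarrow>
     I \<subseteq> R \<and> 0 \<in> I \<and> (\<forall>x\<in>I. \<forall>y\<in>I. x + y \<in> I) \<and> (\<forall>x\<in>R. \<forall>y\<in>I. x * y \<in> I)"
proof
  assume "ideal I (subring_record R)"
  then interpret I: ideal I "subring_record R" .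
  show "I \<subseteq> R \<and> 0 \<in> I \<and> (\<forall>x\<in>I. \<forall>y\<in>I. x + y \<in> I) \<and> (\<forall>x\<in>R. \<forall>y\<in>I. x * y \<in> I)"
    using I.a_subset subgroup.one_closed[OF I.a_subgroup] subgroup.m_closed[OF I.a_subgroup] I.I_l_closed
    by (auto simp: subring_record_def)
next
  assume I: "I \<subseteq> R \<and> 0 \<in> I \<and> (\<forall>x\<in>I. \<forall>y\<in>I. x + y \<in> I) \<and> (\<forall>x\<in>R. \<forall>y\<in>I. x * y \<in> I)"
  interpret A: cring "subring_record R" by (rule cring_record)
  show "ideal I (subring_record R)"
  proof (rule idealI)
    show "ring (subring_record R)" by (rule A.ring_axioms)
    have "\<ominus>\<^bsub>subring_record R\<^esub> x = - x" if "x \<in> R" for x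
      by (rule A.minus_equality) (use that uminus in \<open>auto simp: subring_record_def\<close>)
    moreover have "- x \<in> I" if "x \<in> I" for x
    proof -
      have "- 1 * x \<in> I" using I that uminus[OF one] by blast
      then show ?thesis by simp
    qed
    ultimately show "subgroup I (add_monoid (subring_record R))"
      using I by (intro subgroup.intro) (auto simp: subring_record_def a_inv_def subset_iff)
    fix a x assume a: "a \<in> I" and x: "x \<in> carrier (subring_record R)"
    have "x * a \<in> I" using I a x by (simp add: subring_record_def)
    then show "x \<otimes>\<^bsub>subring_record R\<^esub> a \<in> I" "a \<otimes>\<^bsub>subring_record R\<^esub> x \<in> I"
      by (simp_all add: subring_record_def mult.commute)
  qed
qed

lemma maximalideal_record:
  assumes "maximalideal M (subring_record R)"
  shows "M \<subseteq> R" "1 \<notin> M" "0 \<in> M" "\<And>x y. x \<in> M \<Longrightarrow> y \<in> M \<Longrightarrow> x + y \<in> M"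
    "\<And>x y. x \<in> R \<Longrightarrow> y \<in> M \<Longrightarrow> x * y \<in> M"
    "\<And>x y. x \<in> R \<Longrightarrow> y \<in> R \<Longrightarrow> x * y \<in> M \<Longrightarrow> x \<in> M \<or> y \<in> M"
proof -
  interpret A: cring "subring_record R" by (rule cring_record)
  interpret M: maximalideal M "subring_record R" by (rule assms)
  interpret P: primeideal M "subring_record R" by (rule A.maximalideal_prime[OF assms])
  have I: "M \<subseteq> R \<and> 0 \<in> M \<and> (\<forall>x\<in>M. \<forall>y\<in>M. x + y \<in> M) \<and> (\<forall>x\<in>R. \<forall>y\<in>M. x * y \<in> M)"
    using M.is_ideal unfolding ideal_record_iff .
  show "M \<subseteq> R" "0 \<in> M" "\<And>x y. x \<in> M \<Longrightarrow> y \<in> M \<Longrightarrow> x + y \<in> M"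
    "\<And>x y. x \<in> R \<Longrightarrow> y \<in> M \<Longrightarrow> x * y \<in> M" using I by blast+
  show "1 \<notin> M" using M.one_imp_carrier M.I_notcarr by (auto simp: subring_record_def)
  show "x \<in> M \<or> y \<in> M" if "x \<in> R" "y \<in> R" "x * y \<in> M" for x y
    using P.I_prime[of x y] that by (simp add: subring_record_def)
qed

lemma
  assumes M: "maximalideal M (subring_record R)"
  shows localization_local: "local_subring (localization R M)"
    and localization_maximal: "M \<subseteq> local_subring.nonunits (localization R M)"
    and localization_contains: "R \<subseteq> localization R M"
proof -
  note M' = maximalideal_record[OF M]
  define L where "L = localization R M"
  have LI: "a / s \<in> L" if "a \<in> R" "s \<in> R" "s \<notin> M" for a s
    using that unfolding L_def localization_def by blast
  have LE: "\<exists>a s. x = a / s \<and> a \<in> R \<and> s \<in> R \<and> s \<notin> M \<and> s \<noteq> 0" if "x \<in> L" for x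
    using that M'(3) unfolding L_def localization_def by blast
  have unit: "unit_in L (a / s)" if "a \<in> R" "a \<notin> M" "s \<in> R" "s \<notin> M" for a s
    using that LI[of s a] M'(3) by (auto simp: unit_in_def)
  have sub: "R \<subseteq> L" using LI[OF _ one M'(2)] by auto
  then show "R \<subseteq> localization R M" by (simp add: L_def)
  have "local_subring L"
  proof
    show "1 \<in> L" using sub one by blast
    fix x y
    assume x: "x \<in> L"
    obtain a s where a: "x = a / s" "a \<in> R" "s \<in> R" "s \<notin> M" "s \<noteq> 0" using LE[OF x] by blast
    have "- a / s \<in> L" by (rule LI) (use a uminus in auto)
    then show "- x \<in> L" using a(1) by simp
    \<comment> \<open>If \<open>a \<in> M\<close> and \<open>s \<notin> M\<close>, then
      \<open>s - a \<notin> M\<close>, so \<open>1 - a / s\<close> is a unit; if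
      \<open>a \<notin> M\<close>, already \<open>a / s\<close> is one.\<close>
    show "unit_in L x \<or> unit_in L (1 - x)"
    proof (cases "a \<in> M")
      case True
      have "s - a \<notin> M"
      proof
        assume "s - a \<in> M"
        then have "s - a + a \<in> M" using True M'(4) by blast
        then show False using a(4) by simp
      qed
      moreover have "s - a \<in> R" using add[OF a(3) uminus[OF a(2)]] by simp
      moreover have "1 - x = (s - a) / s" using a(1,5) by (simp add: field_simps)
      ultimately show ?thesis using unit a by simp
    next
      case False
      then show ?thesis using unit a by simp
    qed
    assume y: "y \<in> L"
    obtain b t where b: "y = b / t" "b \<in> R" "t \<in> R" "t \<notin> M" "t \<noteq> 0" using LE[OF y] by blast
    have st: "s * t \<in> R" "s * t \<notin> M" using a b M'(6) mult by auto
    have "(a * t + b * s) / (s * t) \<in> L" "a * b / (s * t) \<in> L"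
      by (intro LI st add mult a b)+
    moreover have "x + y = (a * t + b * s) / (s * t)" "x * y = a * b / (s * t)"
      using a b by (simp_all add: field_simps)
    ultimately show "x + y \<in> L" "x * y \<in> L" by simp_all
  qed
  then interpret L: local_subring L .
  show "local_subring (localization R M)" using L.local_subring_axioms by (simp add: L_def)
  have "M \<subseteq> L.nonunits"
  proof
    fix x assume x: "x \<in> M"
    have "\<not> unit_in L x"
    proof
      assume u: "unit_in L x"
      then obtain a s where a: "inverse x = a / s" "a \<in> R" "s \<notin> M" "s \<noteq> 0" using LE[of "inverse x"]
        by (auto simp: unit_in_def)
      have "s = a * x" using a(1,4) u by (simp add: unit_in_def field_simps)
      then show False using a(2,3) x M'(5) by blast
    qed
    then show "x \<in> L.nonunits" using x M'(1) sub by (auto simp: L.nonunits_def)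
  qed
  then show "M \<subseteq> local_subring.nonunits (localization R M)" by (simp add: L_def)
qed

end

section \<open>The theorem\<close>

context monster
begin

lemma fin_field_subring: "lb_set S \<Longrightarrow> field_subring (fin S)"
  by unfold_locales (auto intro: fin_one fin_add fin_mult fin_uminus)

lemma coarsening_iff_fin:
  assumes "lb_set S" "base_set \<tau> S" "lb_set T" "base_set \<sigma> T"
  shows "coarsening \<sigma> \<tau> \<longleftrightarrow> fin S \<subseteq> fin T"
  using coarsening_base[OF assms] lb_le_iff_fin assms by simp

text \<open>The set \<open>T\<close> and its domination of the nonunits are exported along with
  \<sigma>, because they recover a maximal ideal from its V-coarsening.\<close>

lemma local_W_topology_V_coarsening:
  assumes W: "W_topology \<tau>" and loc: "local_subring (R_top star \<tau>)"
  obtains \<sigma> T where "V_coarsening \<sigma> \<tau>" "lb_set T" "vset T" "base_set \<sigma> T"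
    "local_subring.nonunits (R_top star \<tau>) \<subseteq> infinitesimal T" "\<And>\<sigma>'. V_coarsening \<sigma>' \<tau> \<Longrightarrow> \<sigma>' = \<sigma>"
proof -
  obtain S n where S: "lb_set S" "base_set \<tau> S" and Wn: "W_set (Suc n) S"
    and min: "\<And>c. c \<noteq> 0 \<Longrightarrow> \<not> W_set n {y. c * y \<in> S}"
    using W_topology_minimal_base[OF W] by blast
  have R: "R_top star \<tau> = fin S" by (rule R_top_eq_fin[OF S])
  note loc' = loc[unfolded R]
  define T where "T = dominating_set S"
  note T = dominating_set_properties[OF S(1) loc' Wn min, folded T_def]
  obtain \<sigma> where \<sigma>: "base_set \<sigma> T" using lb_set_topology_exists[OF T(2)] by blast
  have "V_topology \<sigma>" by (rule vset_V_topology[OF T(2,1) \<sigma>])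
  moreover have "coarsening \<sigma> \<tau>" using coarsening_base[OF S T(2) \<sigma>] T(3) by simp
  ultimately have V: "V_coarsening \<sigma> \<tau>" unfolding V_coarsening_def by simp
  show thesis
  proof (rule that[OF V T(2,1) \<sigma>])
    show "local_subring.nonunits (R_top star \<tau>) \<subseteq> infinitesimal T" unfolding R by (rule T(4))
    fix \<sigma>' assume "V_coarsening \<sigma>' \<tau>"
    then have V': "V_topology \<sigma>'" "coarsening \<sigma>' \<tau>" unfolding V_coarsening_def by auto
    obtain T' where T': "lb_set T'" "vset T'" "base_set \<sigma>' T'" using V_topology_vset[OF V'(1)] by blast
    have "lb_le S T'" using coarsening_base[OF S T'(1,3)] V'(2) by simp
    from V_coarsening_set_unique[OF S(1) loc' Wn min T'(1,2) this, folded T_def]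
    have "coarsening \<sigma>' \<sigma>" "coarsening \<sigma> \<sigma>'"
      using coarsening_base[OF T(2) \<sigma> T'(1,3)] coarsening_base[OF T'(1,3) T(2) \<sigma>] by auto
    then show "\<sigma>' = \<sigma>" by (rule coarsening_antisym)
  qed
qed

text \<open>If \<open>T\<close> is a \<open>vset\<close>, this ideal is the centre of the valuation
  ring \<open>fin T\<close> on \<open>fin S\<close>.\<close>

lemma infinitesimal_ideal:
  assumes S: "lb_set S" and T: "lb_set T" and le: "fin S \<subseteq> fin T"
  shows "ideal (fin S \<inter> infinitesimal T) (subring_record (fin S))" "1 \<notin> fin S \<inter> infinitesimal T"
proof -
  interpret field_subring "fin S" by (rule fin_field_subring[OF S])
  have "x * y \<in> infinitesimal T" if "x \<in> fin S" "y \<in> infinitesimal T" for x y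
    using infinitesimal_mult[OF T that(2), of x] le that(1) by (auto simp: mult.commute)
  then show "ideal (fin S \<inter> infinitesimal T) (subring_record (fin S))"
    unfolding ideal_record_iff using infinitesimal_add[OF T] infinitesimal_zero[OF T] by (auto intro: zero add mult)
  show "1 \<notin> fin S \<inter> infinitesimal T" using one_not_infinitesimal[OF T] by simp
qed

lemma local_components_V_coarsenings:
  assumes W: "W_topology \<tau>" and comps: "local_components star \<tau> n t"
  shows "(\<forall>i<n. \<exists>!\<sigma>. V_coarsening \<sigma> (t i)) \<and>
         bij_betw (\<lambda>\<rho>. THE \<sigma>. V_coarsening \<sigma> \<rho>) (t ` {..<n}) {\<sigma>. V_coarsening \<sigma> \<tau>}"
proof -
  have base: "\<exists>S. lb_set S \<and> base_set \<rho> S" if "W_topology \<rho>" for \<rho> :: "'a topology"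
    using W_topology_minimal_base[OF that] by metis
  obtain S where S: "lb_set S" "base_set \<tau> S" using base[OF W] by blast
  define R where "R = R_top star \<tau>"
  have R: "R = fin S" unfolding R_def by (rule R_top_eq_fin[OF S])
  interpret field_subring R unfolding R by (rule fin_field_subring[OF S(1)])
  have tW: "\<And>i. i < n \<Longrightarrow> W_topology (t i)"
    and tR: "(\<lambda>i. R_top star (t i)) ` {..<n} = {localization R M | M. maximalideal M (subring_record R)}"
    using comps unfolding local_components_def R_def by auto
  have "\<exists>M. maximalideal M (subring_record R) \<and> R_top star (t i) = localization R M" if i: "i < n" for i
  proof -
    have "R_top star (t i) \<in> {localization R M | M. maximalideal M (subring_record R)}"
      unfolding tR[symmetric] using i by simp
    then show ?thesis by blast
  qed
  then obtain M where M: "\<And>i. i < n \<Longrightarrow> maximalideal (M i) (subring_record R)"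
    and RM: "\<And>i. i < n \<Longrightarrow> R_top star (t i) = localization R (M i)" by metis
  \<comment> \<open>One predicate for all the data, so that a single choice delivers matching
    \<open>v\<close> and \<open>T\<close>.\<close>
  define P where "P i \<sigma> X \<longleftrightarrow> V_coarsening \<sigma> (t i) \<and> lb_set X \<and> vset X \<and> base_set \<sigma> X \<and>
      local_subring.nonunits (R_top star (t i)) \<subseteq> infinitesimal X \<and>
      (\<forall>\<sigma>'. V_coarsening \<sigma>' (t i) \<longrightarrow> \<sigma>' = \<sigma>)" for i \<sigma> X
  have "\<exists>\<sigma> X. P i \<sigma> X" if i: "i < n" for i
  proof -
    have "local_subring (R_top star (t i))" unfolding RM[OF i] by (rule localization_local[OF M[OF i]])
    then show ?thesis
      by (rule local_W_topology_V_coarsening[OF tW[OF i]]) (unfold P_def, blast)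
  qed
  then obtain v T where P: "\<And>i. i < n \<Longrightarrow> P i (v i) (T i)" by metis
  have v: "V_coarsening (v i) (t i)" and T: "lb_set (T i)" "vset (T i)" "base_set (v i) (T i)"
    and dom: "local_subring.nonunits (R_top star (t i)) \<subseteq> infinitesimal (T i)"
    if "i < n" for i using P[OF that] unfolding P_def by auto
  have uniq: "\<sigma>' = v i" if "i < n" "V_coarsening \<sigma>' (t i)" for i \<sigma>'
    using P[OF that(1)] that(2) unfolding P_def by auto
  have ex1: "\<exists>!\<sigma>. V_coarsening \<sigma> (t i)" if "i < n" for i using v[OF that] uniq[OF that] by blast
  have the: "(THE \<sigma>. V_coarsening \<sigma> (t i)) = v i" if "i < n" for i
    using v[OF that] uniq[OF that] by blast
  have coarse_iff: "coarsening \<sigma> \<rho> \<longleftrightarrow> R_top star \<rho> \<subseteq> R_top star \<sigma>"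
    if "lb_set X" "base_set \<rho> X" "lb_set Y" "base_set \<sigma> Y" for \<rho> \<sigma> X Y
    using coarsening_iff_fin[OF that] R_top_eq_fin[OF that(1,2)] R_top_eq_fin[OF that(3,4)] by simp
  have t_coarse: "coarsening (t i) \<tau>" if i: "i < n" for i
  proof -
    obtain Si where Si: "lb_set Si" "base_set (t i) Si" using base[OF tW[OF i]] by blast
    show ?thesis unfolding coarse_iff[OF S Si] RM[OF i] R_def[symmetric]
      by (rule localization_contains[OF M[OF i]])
  qed
  \<comment> \<open>Domination gives the inclusion from left to right; the right-hand side is a
    proper ideal, so maximality of \<open>M i\<close> gives equality.\<close>
  have M_eq: "M i = R \<inter> infinitesimal (T i)" if i: "i < n" for i
  proof -
    interpret Mi: maximalideal "M i" "subring_record R" by (rule M[OF i])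
    have "coarsening (v i) \<tau>" using v[OF i] t_coarse[OF i] unfolding V_coarsening_def coarsening_def by blast
    then have "fin S \<subseteq> fin (T i)" using coarsening_iff_fin[OF S T(1)[OF i] T(3)[OF i]] by simp
    note N = infinitesimal_ideal[OF S(1) T(1)[OF i] this, folded R]
    have "M i \<subseteq> R \<inter> infinitesimal (T i)"
      using localization_maximal[OF M[OF i]] dom[OF i] maximalideal_record(1)[OF M[OF i]]
      unfolding RM[OF i] by blast
    then have "R \<inter> infinitesimal (T i) = M i \<or> R \<inter> infinitesimal (T i) = R"
      using Mi.I_maximal[OF N(1)] by (simp add: subring_record_def)
    then show ?thesis using N(2) one by auto
  qed
  \<comment> \<open>Equal coarsenings have bounded sets that contain each other up to scaling, hence
    the same infinitesimals, the same maximal ideal, the same localization, and finally the same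
    topology.\<close>
  have inj: "t i = t j" if ij: "i < n" "j < n" "v i = v j" for i j
  proof -
    have bj: "base_set (v i) (T j)" using T(3)[OF ij(2)] ij(3) by simp
    have "coarsening (v i) (v i)" unfolding coarsening_def by simp
    then have "lb_le (T i) (T j)" "lb_le (T j) (T i)"
      using coarsening_base[OF T(1)[OF ij(1)] T(3)[OF ij(1)] T(1)[OF ij(2)] bj]
        coarsening_base[OF T(1)[OF ij(2)] bj T(1)[OF ij(1)] T(3)[OF ij(1)]] by auto
    then have "infinitesimal (T i) = infinitesimal (T j)" using infinitesimal_mono by blast
    then have "M i = M j" using M_eq ij by simp
    then have Req: "R_top star (t i) = R_top star (t j)" using RM ij by simp
    obtain Si Sj where Si: "lb_set Si" "base_set (t i) Si" and Sj: "lb_set Sj" "base_set (t j) Sj"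
      using base[OF tW[OF ij(1)]] base[OF tW[OF ij(2)]] by blast
    show ?thesis using coarsening_antisym coarse_iff[OF Si Sj] coarse_iff[OF Sj Si] Req by blast
  qed
  have surj: "\<exists>i<n. \<sigma> = v i" if \<sigma>: "V_coarsening \<sigma> \<tau>" for \<sigma>
  proof -
    have V: "V_topology \<sigma>" "coarsening \<sigma> \<tau>" using \<sigma> unfolding V_coarsening_def by auto
    obtain Y where Y: "lb_set Y" "vset Y" "base_set \<sigma> Y" using V_topology_vset[OF V(1)] by blast
    have sub: "fin S \<subseteq> fin Y" using coarsening_iff_fin[OF S Y(1,3)] V(2) by simp
    note N = infinitesimal_ideal[OF S(1) Y(1) sub, folded R]
    interpret A: cring "subring_record R" by (rule cring_record)
    have "R \<inter> infinitesimal Y \<noteq> carrier (subring_record R)" using N(2) one by (auto simp: subring_record_def)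
    \<comment> \<open>A maximal ideal above the centre of \<open>fin Y\<close>. Denominators outside
      it are not infinitesimal for \<open>Y\<close>, hence invertible in \<open>fin Y\<close>, so
      the localization lies in \<open>fin Y\<close>.\<close>
    then obtain Q where Q: "maximalideal Q (subring_record R)" "R \<inter> infinitesimal Y \<subseteq> Q"
      using A.exists_maximalideal_above[OF N(1)] by blast
    have "localization R Q \<in> (\<lambda>i. R_top star (t i)) ` {..<n}" unfolding tR using Q(1) by blast
    then obtain i where i: "i < n" "R_top star (t i) = localization R Q" by auto
    have "localization R Q \<subseteq> fin Y"
    proof
      fix x assume "x \<in> localization R Q"
      then obtain a s where a: "x = a / s" "a \<in> R" "s \<in> R" "s \<notin> Q" unfolding localization_def by blast
      have "s \<notin> infinitesimal Y" using a Q(2) by blast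
      then have "inverse s \<in> fin Y" unfolding infinitesimal_iff_vset[OF Y(1,2)] by blast
      then show "x \<in> fin Y" using a(1,2) sub fin_mult[OF Y(1)] by (auto simp: divide_inverse R)
    qed
    then have "R_top star (t i) \<subseteq> R_top star \<sigma>" using i(2) R_top_eq_fin[OF Y(1,3)] by simp
    moreover obtain Si where Si: "lb_set Si" "base_set (t i) Si" using base[OF tW[OF i(1)]] by blast
    ultimately have "coarsening \<sigma> (t i)" using coarse_iff[OF Si Y(1,3)] by simp
    then show ?thesis using uniq[OF i(1)] i(1) V(1) unfolding V_coarsening_def by blast
  qed
  have "bij_betw (\<lambda>\<rho>. THE \<sigma>. V_coarsening \<sigma> \<rho>) (t ` {..<n}) {\<sigma>. V_coarsening \<sigma> \<tau>}"
    unfolding bij_betw_def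
  proof
    show "inj_on (\<lambda>\<rho>. THE \<sigma>. V_coarsening \<sigma> \<rho>) (t ` {..<n})"
    proof (rule inj_onI)
      fix x y assume "x \<in> t ` {..<n}" "y \<in> t ` {..<n}"
        and eq: "(THE \<sigma>. V_coarsening \<sigma> x) = (THE \<sigma>. V_coarsening \<sigma> y)"
      then obtain i j where ij: "i < n" "x = t i" "j < n" "y = t j" by blast
      have "v i = v j" using eq the[OF ij(1)] the[OF ij(3)] unfolding ij(2,4) by (rule box_equals)
      from inj[OF ij(1,3) this] show "x = y" unfolding ij(2,4) .
    qed
    have "V_coarsening (v i) \<tau>" if "i < n" for i
      using v[OF that] t_coarse[OF that] unfolding V_coarsening_def coarsening_def by blast
    then show "(\<lambda>\<rho>. THE \<sigma>. V_coarsening \<sigma> \<rho>) ` t ` {..<n} = {\<sigma>. V_coarsening \<sigma> \<tau>}"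
      unfolding image_image using the surj by force
  qed
  then show ?thesis using ex1 by blast
qed

end

theorem theorem4p9:
  fixes \<tau> :: "'a::field topology"
    and \<iota> :: "'a \<Rightarrow> 'b::field" and star :: "'a set \<Rightarrow> 'b set"
    and n :: nat and t :: "nat \<Rightarrow> 'a topology"
  assumes "monster_model \<iota> star"
    and "W_topology \<tau>"
    and "local_components star \<tau> n t"
  shows "(\<forall>i<n. \<exists>!\<sigma>. V_coarsening \<sigma> (t i)) \<and>
         bij_betw (\<lambda>\<rho>. THE \<sigma>. V_coarsening \<sigma> \<rho>) (t ` {..<n}) {\<sigma>. V_coarsening \<sigma> \<tau>}"
proof -
  interpret monster \<iota> star
    using assms(1) unfolding monster_model_def by unfold_locales auto
  show ?thesis by (rule local_components_V_coarsenings[OF assms(2,3)])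
qed

end
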